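(* Assume [H0], [H1], [H2] and [$\widetilde{\mathrm H}$3] (as listed in the context). Let $u:\mathcal S\to\mathbb R$ be a bounded, upper semicontinuous viscosity subsolution of (HJ) in $\mathcal S$ and let $v:\mathcal S\to\mathbb R$ be a bounded, lower semicontinuous viscosity supersolution of (HJ) in $\mathcal S$. Then $u\le v$ in $\mathcal S$.
   Context: **Geometry.** In $\mathbb R^3$ with Euclidean scalar product $x\cdot y$ and norm $|x|$, let $N>1$ and let $e_0,e_1,\dots,e_N$ be distinct unit vectors with $e_i\cdot e_0=0$ for $i=1,\dots,N$. Write $\mathbb R e_0\times\mathbb R e_i$ for the plane spanned by $e_0,e_i$. Let $\mathcal P_i=\{x_0e_0+x_ie_i: x_0\in\mathbb R,\ x_i\ge 0\}$ (closed half-plane), $\Gamma=\mathbb R e_0$, $\mathcal S=\bigcup_{i=1}^N\mathcal P_i$. **Assumptions.** $A$ is a metric space and $\lambda>0$. [H0] For $i=1,\dots,N$, $A_i\subset A$ is non-empty and compact, the $A_i$ are pairwise disjoint, $f_i:\mathcal P_i\times A_i\to\mathbb R e_0\times\mathbb R e_i$ is continuous and bounded, and there is $L_f>0$ with $|f_i(x,a)-f_i(y,a)|\le L_f|x-y|$ for all $i$, $x,y\in\mathcal P_i$, $a\in A_i$. [H1] For $i=1,\dots,N$, $\ell_i:\mathcal P_i\times A_i\to\mathbb R$ is continuous and bounded, and there is a modulus of continuity $\omega_\ell$ with $|\ell_i(x,a)-\ell_i(y,a)|\le\omega_\ell(|x-y|)$ for all $i$, $x,y\in\mathcal P_i$,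 $a\in A_i$. [H2] For all $i$ and $x\in\mathcal P_i$, the set $\mathrm{FL}_i(x)=\{(f_i(x,a),\ell_i(x,a)):a\in A_i\}$ is convex (it is non-empty and closed). [$\widetilde{\mathrm H}$3] (normal controllability) There is $\delta>0$ such that for all $i$ and $x\in\Gamma$, $[-\delta,\delta]\subset\{f_i(x,a)\cdot e_i:a\in A_i\}$. **Viscosity sub/supersolutions.** $\mathcal R(\mathcal S)$ is the set of continuous $\varphi:\mathcal S\to\mathbb R$ with $\varphi|_{\mathcal P_j}\in C^1(\mathcal P_j)$ (up to the boundary $\Gamma$) for every $j$; $D(\varphi|_{\mathcal P_j})(x)\in\mathbb R e_0\times\mathbb R e_j$ is the gradient (for $x\in\Gamma$, the limit of gradients from $\mathcal P_j\setminus\Gamma$). Let $H_i(x,p)=\max_{a\in A_i}(-p\cdot f_i(x,a)-\ell_i(x,a))$ for $x\in\mathcal P_i$, $p\in\mathbb R e_0\times\mathbb R e_i$; for $x\in\Gamma$, $H_i^+(x,p)=\max_{a\in A_i,\ f_i(x,a)\cdot e_i\ge0}(-p\cdot f_i(x,a)-\ell_i(x,a))$ and $H_\Gamma(x,p_1,\dots,p_N)=\max_iH_i^+(x,p_i)$. (HJ) denotes the equation $\lambda u+H_i(x,Du)=0$ in $\mathcal P_i\setminus\Gamma$ ($i=1,\dots,N$), $\lambda u+H_\Gamma(x,D(u|_{\mathcal P_1}),\dots,D(u|_{\mathcal P_N}))=0$ on $\Gamma$, in the following sense. An upper semicontinuous $u:\mathcal S\to\mathbb R$ is a viscosity subsolution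 if, for every $x\in\mathcal S$ and $\varphi\in\mathcal R(\mathcal S)$ such that $u-\varphi$ has a local maximum (on $\mathcal S$) at $x$: $\lambda u(x)+H_i(x,D(\varphi|_{\mathcal P_i})(x))\le0$ if $x\in\mathcal P_i\setminus\Gamma$, and $\lambda u(x)+H_\Gamma(x,D(\varphi|_{\mathcal P_1})(x),\dots,D(\varphi|_{\mathcal P_N})(x))\le0$ if $x\in\Gamma$. A lower semicontinuous $u$ is a viscosity supersolution if the reverse inequalities ($\ge0$) hold whenever $u-\varphi$ has a local minimum at $x$. *)

theory Defs
  imports "HOL-Analysis.Analysis"
begin

section \<open>The junction\<close>

text \<open>The unit vectors are \<open>e 0, e 1, \<dots>, e N\<close>; only \<open>e 0\<close> and \<open>e i\<close> with
  \<open>1 \<le> i \<le> N\<close> are ever used.\<close>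

definition edge :: "(nat \<Rightarrow> real^3) \<Rightarrow> (real^3) set" where
  "edge e = span {e 0}"

definition plane :: "(nat \<Rightarrow> real^3) \<Rightarrow> nat \<Rightarrow> (real^3) set" where
  "plane e i = span {e 0, e i}"

definition half_plane :: "(nat \<Rightarrow> real^3) \<Rightarrow> nat \<Rightarrow> (real^3) set" where
  "half_plane e i = {s *\<^sub>R e 0 + t *\<^sub>R e i | s t. 0 \<le> t}"

definition junction :: "(nat \<Rightarrow> real^3) \<Rightarrow> nat \<Rightarrow> (real^3) set" where
  "junction e N = (\<Union>i\<in>{1..N}. half_plane e i)"


section \<open>Moduli of continuity and semicontinuity\<close>

definition modulus_of_continuity :: "(real \<Rightarrow> real) \<Rightarrow> bool" where
  "modulus_of_continuity \<omega> \<longleftrightarrow>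
     (\<forall>t\<ge>0. 0 \<le> \<omega> t) \<and> mono_on {0..} \<omega> \<and> \<omega> 0 = 0 \<and> (\<omega> \<longlongrightarrow> 0) (at_right 0)"

definition usc_on :: "'b::topological_space set \<Rightarrow> ('b \<Rightarrow> real) \<Rightarrow> bool" where
  "usc_on S u \<longleftrightarrow> (\<forall>x\<in>S. \<forall>c. u x < c \<longrightarrow> (\<forall>\<^sub>F y in at x within S. u y < c))"

definition lsc_on :: "'b::topological_space set \<Rightarrow> ('b \<Rightarrow> real) \<Rightarrow> bool" where
  "lsc_on S u \<longleftrightarrow> (\<forall>x\<in>S. \<forall>c. c < u x \<longrightarrow> (\<forall>\<^sub>F y in at x within S. c < u y))"


section \<open>Test functions\<close>

text \<open>The derivative is taken within the closed half-plane, so that \<open>\<phi>\<close> is only used on it;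
  off the edge this is the derivative in the plane. It determines the gradient only up to
  vectors orthogonal to the plane, hence the condition \<open>p \<in> plane e i\<close>.\<close>

definition has_gradient ::
    "(nat \<Rightarrow> real^3) \<Rightarrow> nat \<Rightarrow> (real^3 \<Rightarrow> real) \<Rightarrow> real^3 \<Rightarrow> real^3 \<Rightarrow> bool" where
  "has_gradient e i \<phi> p x \<longleftrightarrow>
     p \<in> plane e i \<and> (\<phi> has_derivative (\<lambda>h. p \<bullet> h)) (at x within half_plane e i)"

definition grad :: "(nat \<Rightarrow> real^3) \<Rightarrow> nat \<Rightarrow> (real^3 \<Rightarrow> real) \<Rightarrow> real^3 \<Rightarrow> real^3" where
  "grad e i \<phi> x =
     (if x \<in> edge e
      then Lim (at x within (half_plane e i - edge e)) (\<lambda>y. THE p. has_gradient e i \<phi> p y)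
      else (THE p. has_gradient e i \<phi> p x))"

text \<open>Continuity of \<open>grad e i \<phi>\<close> at a point of the edge forces the limit in its definition
  to exist.\<close>

definition C1_half_plane :: "(nat \<Rightarrow> real^3) \<Rightarrow> nat \<Rightarrow> (real^3 \<Rightarrow> real) \<Rightarrow> bool" where
  "C1_half_plane e i \<phi> \<longleftrightarrow>
     (\<forall>x\<in>half_plane e i - edge e. \<phi> differentiable (at x within half_plane e i)) \<and>
     continuous_on (half_plane e i) (grad e i \<phi>)"

definition test_functions :: "(nat \<Rightarrow> real^3) \<Rightarrow> nat \<Rightarrow> (real^3 \<Rightarrow> real) set" where
  "test_functions e N =
     {\<phi>. continuous_on (junction e N) \<phi> \<and> (\<forall>i\<in>{1..N}. C1_half_plane e i \<phi>)}"


section \<open>Hamiltonians\<close>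

text \<open>The suprema are maxima in the situation of interest: the control sets are compact, the
  data continuous, and normal controllability makes the set in \<open>ham_plus\<close> non-empty.\<close>

definition ham ::
    "(nat \<Rightarrow> 'a set) \<Rightarrow> (nat \<Rightarrow> real^3 \<Rightarrow> 'a \<Rightarrow> real^3) \<Rightarrow> (nat \<Rightarrow> real^3 \<Rightarrow> 'a \<Rightarrow> real) \<Rightarrow>
     nat \<Rightarrow> real^3 \<Rightarrow> real^3 \<Rightarrow> real" where
  "ham A f l i x p = (SUP a\<in>A i. - (p \<bullet> f i x a) - l i x a)"

definition ham_plus ::
    "(nat \<Rightarrow> real^3) \<Rightarrow> (nat \<Rightarrow> 'a set) \<Rightarrow> (nat \<Rightarrow> real^3 \<Rightarrow> 'a \<Rightarrow> real^3) \<Rightarrow>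
     (nat \<Rightarrow> real^3 \<Rightarrow> 'a \<Rightarrow> real) \<Rightarrow> nat \<Rightarrow> real^3 \<Rightarrow> real^3 \<Rightarrow> real" where
  "ham_plus e A f l i x p =
     (SUP a\<in>{a \<in> A i. 0 \<le> f i x a \<bullet> e i}. - (p \<bullet> f i x a) - l i x a)"

definition ham_edge ::
    "(nat \<Rightarrow> real^3) \<Rightarrow> nat \<Rightarrow> (nat \<Rightarrow> 'a set) \<Rightarrow> (nat \<Rightarrow> real^3 \<Rightarrow> 'a \<Rightarrow> real^3) \<Rightarrow>
     (nat \<Rightarrow> real^3 \<Rightarrow> 'a \<Rightarrow> real) \<Rightarrow> real^3 \<Rightarrow> (nat \<Rightarrow> real^3) \<Rightarrow> real" where
  "ham_edge e N A f l x p = Max ((\<lambda>i. ham_plus e A f l i x (p i)) ` {1..N})"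


section \<open>Viscosity sub- and supersolutions\<close>

definition local_max_on :: "'b::topological_space set \<Rightarrow> ('b \<Rightarrow> real) \<Rightarrow> 'b \<Rightarrow> bool" where
  "local_max_on S g x \<longleftrightarrow> x \<in> S \<and> (\<forall>\<^sub>F y in at x within S. g y \<le> g x)"

definition local_min_on :: "'b::topological_space set \<Rightarrow> ('b \<Rightarrow> real) \<Rightarrow> 'b \<Rightarrow> bool" where
  "local_min_on S g x \<longleftrightarrow> x \<in> S \<and> (\<forall>\<^sub>F y in at x within S. g x \<le> g y)"

definition viscosity_subsolution ::
    "(nat \<Rightarrow> real^3) \<Rightarrow> nat \<Rightarrow> (nat \<Rightarrow> 'a set) \<Rightarrow> (nat \<Rightarrow> real^3 \<Rightarrow> 'a \<Rightarrow> real^3) \<Rightarrow>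
     (nat \<Rightarrow> real^3 \<Rightarrow> 'a \<Rightarrow> real) \<Rightarrow> real \<Rightarrow> (real^3 \<Rightarrow> real) \<Rightarrow> bool" where
  "viscosity_subsolution e N A f l lam u \<longleftrightarrow>
     usc_on (junction e N) u \<and>
     (\<forall>\<phi>\<in>test_functions e N. \<forall>x\<in>junction e N.
        local_max_on (junction e N) (\<lambda>y. u y - \<phi> y) x \<longrightarrow>
          (\<forall>i\<in>{1..N}. x \<in> half_plane e i - edge e \<longrightarrow>
             lam * u x + ham A f l i x (grad e i \<phi> x) \<le> 0) \<and>
          (x \<in> edge e \<longrightarrow>
             lam * u x + ham_edge e N A f l x (\<lambda>i. grad e i \<phi> x) \<le> 0))"

definition viscosity_supersolution ::
    "(nat \<Rightarrow> real^3) \<Rightarrow> nat \<Rightarrow> (nat \<Rightarrow> 'a set) \<Rightarrow> (nat \<Rightarrow> real^3 \<Rightarrow> 'a \<Rightarrow> real^3) \<Rightarrow>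
     (nat \<Rightarrow> real^3 \<Rightarrow> 'a \<Rightarrow> real) \<Rightarrow> real \<Rightarrow> (real^3 \<Rightarrow> real) \<Rightarrow> bool" where
  "viscosity_supersolution e N A f l lam v \<longleftrightarrow>
     lsc_on (junction e N) v \<and>
     (\<forall>\<phi>\<in>test_functions e N. \<forall>x\<in>junction e N.
        local_min_on (junction e N) (\<lambda>y. v y - \<phi> y) x \<longrightarrow>
          (\<forall>i\<in>{1..N}. x \<in> half_plane e i - edge e \<longrightarrow>
             lam * v x + ham A f l i x (grad e i \<phi> x) \<ge> 0) \<and>
          (x \<in> edge e \<longrightarrow>
             lam * v x + ham_edge e N A f l x (\<lambda>i. grad e i \<phi> x) \<ge> 0))"


section \<open>The gradient is well defined\<close>

lemma half_plane_interior:
  assumes "x \<in> half_plane e i - edge e" "h \<in> plane e i"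
  obtains d where "d > 0" "\<And>r. \<bar>r\<bar> < d \<Longrightarrow> x + r *\<^sub>R h \<in> half_plane e i"
proof -
  obtain s t where x: "x = s *\<^sub>R e 0 + t *\<^sub>R e i" "0 \<le> t"
    using assms by (auto simp: half_plane_def)
  have "t \<noteq> 0"
    using assms x by (auto simp: edge_def span_singleton)
  then have t: "t > 0" using x by simp
  obtain a b where h: "h = a *\<^sub>R e 0 + b *\<^sub>R e i"
    using assms(2) by (auto simp: plane_def span_insert span_singleton algebra_simps)
  let ?d = "t / (\<bar>b\<bar> + 1)"
  show ?thesis
  proof (rule that)
    show "?d > 0" using t by auto
    fix r :: real assume r: "\<bar>r\<bar> < ?d"
    then have "\<bar>r\<bar> * (\<bar>b\<bar> + 1) < t" by (simp add: pos_less_divide_eq)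
    moreover have "\<bar>r * b\<bar> \<le> \<bar>r\<bar> * (\<bar>b\<bar> + 1)"
      by (simp add: abs_mult algebra_simps)
    ultimately have "0 \<le> t + r * b" by linarith
    moreover have "x + r *\<^sub>R h = (s + r * a) *\<^sub>R e 0 + (t + r * b) *\<^sub>R e i"
      by (simp add: x h algebra_simps)
    ultimately show "x + r *\<^sub>R h \<in> half_plane e i"
      unfolding half_plane_def by blast
  qed
qed

lemma has_gradient_unique:
  assumes x: "x \<in> half_plane e i - edge e"
    and p: "has_gradient e i \<phi> p x" and q: "has_gradient e i \<phi> q x"
  shows "p = q"
proof -
  define h where "h = p - q"
  have h: "h \<in> plane e i"
    using p q by (auto simp: h_def has_gradient_def plane_def span_diff)
  obtain d where d: "d > 0" "\<And>r. \<bar>r\<bar> < d \<Longrightarrow> x + r *\<^sub>R h \<in> half_plane e i"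
    using half_plane_interior[OF x h] by blast
  have D: "((\<lambda>r. \<phi> (x + r *\<^sub>R h)) has_real_derivative (w \<bullet> h)) (at 0)"
    if "has_gradient e i \<phi> w x" for w
  proof -
    have 1: "((\<lambda>r. x + r *\<^sub>R h) has_derivative (\<lambda>r. r *\<^sub>R h)) (at 0 within {-d<..<d})"
      by (auto intro!: derivative_eq_intros)
    have im: "(\<lambda>r. x + r *\<^sub>R h) ` {-d<..<d} \<subseteq> half_plane e i"
      using d by auto
    have 2: "(\<phi> has_derivative (\<lambda>k. w \<bullet> k))
        (at (x + 0 *\<^sub>R h) within (\<lambda>r. x + r *\<^sub>R h) ` {-d<..<d})"
      using that has_derivative_subset[OF _ im, of \<phi> "\<lambda>k. w \<bullet> k" x]
      by (simp add: has_gradient_def)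
    have "((\<lambda>r. \<phi> (x + r *\<^sub>R h)) has_derivative (\<lambda>r. w \<bullet> (r *\<^sub>R h))) (at 0 within {-d<..<d})"
      by (rule has_derivative_in_compose[OF 1 2])
    then show ?thesis
      using d(1) by (simp add: at_within_open[of 0 "{-d<..<d}"] has_field_derivative_def mult_commute_abs)
  qed
  have "p \<bullet> h = q \<bullet> h"
    using DERIV_unique D p q by blast
  then have "h \<bullet> h = 0" by (simp add: h_def inner_diff_left)
  then show ?thesis by (simp add: h_def)
qed

lemma grad_eq:
  assumes e: "norm (e 0) = 1" "norm (e i) = 1" "e i \<bullet> e 0 = 0"
    and g: "continuous_on (half_plane e i) g"
    and D: "\<And>x. x \<in> half_plane e i - edge e \<Longrightarrow> has_gradient e i \<phi> (g x) x"
    and x: "x \<in> half_plane e i"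
  shows "grad e i \<phi> x = g x"
proof -
  have the: "(THE p. has_gradient e i \<phi> p y) = g y" if "y \<in> half_plane e i - edge e" for y
    using D[OF that] has_gradient_unique[OF that] by blast
  show ?thesis
  proof (cases "x \<in> edge e")
    case False
    then show ?thesis using the x by (simp add: grad_def)
  next
    case True
    let ?F = "at x within (half_plane e i - edge e)"
    have "(g \<longlongrightarrow> g x) (at x within half_plane e i)"
      using g x unfolding continuous_on_def by (rule bspec)
    then have "(g \<longlongrightarrow> g x) ?F"
      by (rule tendsto_within_subset) (rule Diff_subset)
    moreover have "\<forall>\<^sub>F y in ?F. g y = (THE p. has_gradient e i \<phi> p y)"
      unfolding eventually_at_filter by (rule always_eventually) (simp add: the)
    ultimately have lim: "((\<lambda>y. THE p. has_gradient e i \<phi> p y) \<longlongrightarrow> g x) ?F"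
      by (rule Lim_transform_eventually)
    obtain s where s: "x = s *\<^sub>R e 0"
      using True by (auto simp: edge_def span_singleton)
    have notin: "x + r *\<^sub>R e i \<in> half_plane e i - edge e" if "r > 0" for r
    proof -
      have "x + r *\<^sub>R e i \<in> half_plane e i"
        using less_imp_le[OF that] unfolding half_plane_def s by blast
      moreover have "x + r *\<^sub>R e i \<notin> edge e"
      proof
        assume "x + r *\<^sub>R e i \<in> edge e"
        then obtain c where "x + r *\<^sub>R e i = c *\<^sub>R e 0"
          by (auto simp: edge_def span_singleton)
        then have "(x + r *\<^sub>R e i) \<bullet> e i = c *\<^sub>R e 0 \<bullet> e i" by simp
        then have "r * (e i \<bullet> e i) = 0"
          using e by (simp add: s inner_add_left inner_add_right inner_commute)
        then show False using that e by (simp add: dot_square_norm)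
      qed
      ultimately show ?thesis by simp
    qed
    have "x islimpt (half_plane e i - edge e)"
      unfolding islimpt_approachable
    proof (intro allI impI)
      fix d :: real assume "d > 0"
      then show "\<exists>y\<in>half_plane e i - edge e. y \<noteq> x \<and> dist y x < d"
        using e notin[of "d/2"] True by (intro bexI[of _ "x + (d/2) *\<^sub>R e i"]) (auto simp: dist_norm)
    qed
    then have "?F \<noteq> bot" by (simp add: trivial_limit_within)
    then show ?thesis using lim True by (simp add: grad_def tendsto_Lim)
  qed
qed

end

theory Submission
  imports Defs
begin

text \<open>
  Doubling of variables, with a penalty \<open>n ((s - \<sigma>)\<^sup>2 + (\<tau> / t - 1)\<^sup>2)\<close> that compares the normal
  coordinates through their ratio, so that the two points of a maximum are both on the edge or
  both off it. Off the edge, normal controllability bounds the normal slope when \<open>t\<close> is small, and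
  the usual estimate goes through.

  On the edge let \<open>p\<close> be the common tangential slope and, on branch \<open>i\<close>, let \<open>q i\<close> be the least
  normal slope for which \<open>\<lambda> u + H\<^sub>i\<^sup>+(p, q i) \<le> 0\<close> at the point of \<open>u\<close>. It is finite because \<open>u\<close> can be
  touched from above with any slope beyond the coercivity bound. A smaller slope violates the
  subsolution inequality, so \<open>u\<close> grows at least with slope \<open>q i - \<epsilon>\<close> along branch \<open>i\<close>. By maximality
  \<open>v\<close> does too, hence \<open>v\<close> is touched from below with the slopes \<open>q i - \<epsilon>\<close>. Its supersolution
  inequality on the edge is then compared with the inequality defining \<open>q i\<close>.
\<close>

section \<open>Semicontinuous functions\<close>

text \<open>Controllability acts only across the edge. Nothing bounds the tangential slope
  \<open>p\<close>, and near the edge the normal slopes are bounded only by a multiple of 1 + |p|.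
  The estimates survive because \<open>p\<close> is 2 n times the tangential distance of the two
  points: a normal slope times that distance is of the order of the distance plus the penalty
  \<open>n * (s - \<sigma>)\<^sup>2\<close>, and both become small. For the same reason no Lipschitz
  bound along the edge is available for \<open>u\<close>. Its growth in a branch is measured on the
  tangential sup-convolution, the supremum over \<sigma> of
  \<open>U i \<sigma> t - n * (s - \<sigma>)\<^sup>2\<close>, which is also what maximality compares
  with \<open>v\<close>. A second obstacle is that the edge Hamiltonian sees only controls pointing
  into a branch, and this set of controls changes along the edge. Convexity of the velocity-cost
  sets serves to move such a control to a neighbouring edge point. All test functions are quadratic
  in the coordinates. Their tangential part is common to all branches, so that they agree on the
  edge, while the normal slopes are free in each branch.\<close>

lemma usc_onE:
  assumes u: "usc_on S u" "x \<in> S" "u x < c"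
  obtains T where "open T" "x \<in> T" "\<And>y. y \<in> T \<Longrightarrow> y \<in> S \<Longrightarrow> u y < c"
proof -
  have "\<forall>\<^sub>F y in at x within S. u y < c"
    using u unfolding usc_on_def by simp
  then obtain T where T: "open T" "x \<in> T" "\<forall>y\<in>T. y \<noteq> x \<longrightarrow> y \<in> S \<longrightarrow> u y < c"
    unfolding eventually_at_topological by auto
  show thesis
  proof (rule that[OF T(1,2)])
    fix y assume "y \<in> T" "y \<in> S"
    then show "u y < c" using T(3) u(3) by (cases "y = x") auto
  qed
qed

lemma usc_onI:
  assumes "\<And>x c. x \<in> S \<Longrightarrow> u x < c \<Longrightarrow> \<exists>T. open T \<and> x \<in> T \<and> (\<forall>y\<in>T \<inter> S. u y < c)"
  shows "usc_on S u"
  unfolding usc_on_def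
proof (intro ballI allI impI)
  fix x c assume "x \<in> S" "u x < c"
  from assms[OF this] obtain T where "open T" "x \<in> T" "\<forall>y\<in>T \<inter> S. u y < c" by auto
  then show "\<forall>\<^sub>F y in at x within S. u y < c"
    unfolding eventually_at_topological by (intro exI[of _ T]) simp
qed

lemma usc_on_subset:
  assumes "usc_on S u" "T \<subseteq> S"
  shows "usc_on T u"
proof (rule usc_onI)
  fix x c assume "x \<in> T" "u x < c"
  then obtain D where "open D" "x \<in> D" "\<And>y. y \<in> D \<Longrightarrow> y \<in> S \<Longrightarrow> u y < c"
    using usc_onE[OF assms(1), of x c] assms(2) by blast
  then show "\<exists>D. open D \<and> x \<in> D \<and> (\<forall>y\<in>D \<inter> T. u y < c)"
    using assms(2) by blast
qed

lemma usc_on_uminus_lsc: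
  assumes "lsc_on S u"
  shows "usc_on S (\<lambda>x. - u x)"
  unfolding usc_on_def
proof (intro ballI allI impI)
  fix x c assume "x \<in> S" "- u x < c"
  then have "\<forall>\<^sub>F y in at x within S. - c < u y"
    using assms unfolding lsc_on_def by simp
  then show "\<forall>\<^sub>F y in at x within S. - u y < c"
    by eventually_elim simp
qed

lemma usc_on_compose:
  assumes "usc_on S u" "continuous_on T g" "g ` T \<subseteq> S"
  shows "usc_on T (\<lambda>x. u (g x))"
proof (rule usc_onI)
  fix x c assume x: "x \<in> T" and c: "u (g x) < c"
  then obtain B where B: "open B" "g x \<in> B" "\<And>y. y \<in> B \<Longrightarrow> y \<in> S \<Longrightarrow> u y < c"
    using usc_onE[OF assms(1), of "g x" c] assms(3) by blast
  have "\<exists>D. open D \<and> x \<in> D \<and> (\<forall>y\<in>T. y \<in> D \<longrightarrow> g y \<in> B)"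
    using assms(2) x B(1,2) unfolding continuous_on_topological by simp
  then show "\<exists>D. open D \<and> x \<in> D \<and> (\<forall>y\<in>D \<inter> T. u (g y) < c)"
    using B(3) assms(3) by fast
qed

lemma usc_on_continuous:
  fixes g :: "'b::topological_space \<Rightarrow> real"
  assumes "continuous_on S g"
  shows "usc_on S g"
proof -
  have "usc_on UNIV (\<lambda>x::real. x)"
  proof (rule usc_onI)
    fix x c :: real assume "x < c"
    then show "\<exists>T. open T \<and> x \<in> T \<and> (\<forall>y\<in>T \<inter> UNIV. y < c)"
      by (intro exI[of _ "{..<c}"]) auto
  qed
  from usc_on_compose[OF this assms] show ?thesis by simp
qed

lemma usc_on_add:
  assumes "usc_on S u" "usc_on S w"
  shows "usc_on S (\<lambda>x. u x + w x)"
proof (rule usc_onI)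
  fix x c assume x: "x \<in> S" and c: "u x + w x < c"
  define d where "d = (c - u x - w x) / 2"
  have d: "u x < u x + d" "w x < w x + d" "u x + d + (w x + d) = c"
    using c by (auto simp: d_def field_simps)
  obtain T where T: "open T" "x \<in> T" "\<And>y. y \<in> T \<Longrightarrow> y \<in> S \<Longrightarrow> u y < u x + d"
    using usc_onE[OF assms(1) x d(1)] by blast
  obtain T' where T': "open T'" "x \<in> T'" "\<And>y. y \<in> T' \<Longrightarrow> y \<in> S \<Longrightarrow> w y < w x + d"
    using usc_onE[OF assms(2) x d(2)] by blast
  have "u y + w y < c" if "y \<in> T \<inter> T' \<inter> S" for y
    using add_strict_mono[OF T(3) T'(3), of y y] that unfolding d(3) by simp
  then show "\<exists>T. open T \<and> x \<in> T \<and> (\<forall>y\<in>T \<inter> S. u y + w y < c)"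
    using T T' by (intro exI[of _ "T \<inter> T'"]) (simp add: open_Int)
qed

lemma usc_on_diff_continuous:
  fixes u g :: "'b::topological_space \<Rightarrow> real"
  assumes "usc_on S u" "continuous_on S g"
  shows "usc_on S (\<lambda>x. u x - g x)"
  using usc_on_add[OF assms(1) usc_on_continuous[of S "\<lambda>x. - g x"]] assms(2)
  by (simp add: continuous_on_minus)

text \<open>If no point were maximal, every \<open>x\<close> would have a neighbourhood on which
  \<open>u\<close> stays below some value \<open>u (y x)\<close>. In a finite subcover, the point
  with the largest of these values lies in one of the neighbourhoods, hence has a value strictly
  below that largest one.\<close>

lemma usc_on_attains_max:
  fixes u :: "'b::topological_space \<Rightarrow> real"
  assumes "compact K" "K \<noteq> {}" "usc_on K u"
  shows "\<exists>x\<in>K. \<forall>y\<in>K. u y \<le> u x"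
proof (rule ccontr)
  assume "\<not> ?thesis"
  then obtain y where y: "\<And>x. x \<in> K \<Longrightarrow> y x \<in> K \<and> u x < u (y x)"
    by (metis linorder_not_le)
  have "\<exists>T. open T \<and> x \<in> T \<and> (\<forall>z\<in>T \<inter> K. u z < u (y x))" if x: "x \<in> K" for x
  proof -
    have "u x < u (y x)" using y x by simp
    from usc_onE[OF assms(3) x this] show ?thesis by (metis IntE)
  qed
  then obtain T where T: "\<And>x. x \<in> K \<Longrightarrow> open (T x) \<and> x \<in> T x \<and> (\<forall>z\<in>T x \<inter> K. u z < u (y x))"
    by metis
  obtain D where D: "D \<subseteq> K" "finite D" "K \<subseteq> (\<Union>x\<in>D. T x)"
    by (rule compactE_image[OF assms(1), of K T]) (use T in auto)
  have "D \<noteq> {}" using D assms(2) by auto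
  define m where "m = Max ((\<lambda>x. u (y x)) ` D)"
  have "m \<in> (\<lambda>x. u (y x)) ` D" unfolding m_def using D \<open>D \<noteq> {}\<close> by (intro Max_in) auto
  then obtain x where x: "x \<in> D" "m = u (y x)" by auto
  then have "y x \<in> K" using y D by auto
  then obtain x' where x': "x' \<in> D" "y x \<in> T x'" using D by auto
  then have "u (y x) < u (y x')" using T \<open>y x \<in> K\<close> D by blast
  also have "u (y x') \<le> m" unfolding m_def using D x' by auto
  finally show False using x by simp
qed

text \<open>The branch is treated as a discrete variable: the coordinates of all branches range over
  one and the same box.\<close>

lemma usc_on_family_attains_max:
  fixes u :: "'i \<Rightarrow> 'b::topological_space \<Rightarrow> real"
  assumes "finite I" "I \<noteq> {}" "compact K" "K \<noteq> {}" "\<And>i. i \<in> I \<Longrightarrow> usc_on K (u i)"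
  obtains i x where "i \<in> I" "x \<in> K" "\<And>j y. j \<in> I \<Longrightarrow> y \<in> K \<Longrightarrow> u j y \<le> u i x"
proof -
  have "\<forall>i\<in>I. \<exists>x\<in>K. \<forall>y\<in>K. u i y \<le> u i x"
    using usc_on_attains_max[OF assms(3,4)] assms(5) by blast
  then obtain z where z: "\<And>i. i \<in> I \<Longrightarrow> z i \<in> K \<and> (\<forall>y\<in>K. u i y \<le> u i (z i))" by metis
  define m where "m = Max ((\<lambda>i. u i (z i)) ` I)"
  have "m \<in> (\<lambda>i. u i (z i)) ` I" unfolding m_def using assms(1,2) by (intro Max_in) auto
  then obtain i where i: "i \<in> I" "m = u i (z i)" by auto
  have "u j y \<le> u i (z i)" if "j \<in> I" "y \<in> K" for j y
  proof -
    have "u j y \<le> u j (z j)" using z that by blast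
    also have "\<dots> \<le> m" unfolding m_def using assms(1) that by (intro Max_ge) auto
    finally show ?thesis using i by simp
  qed
  then show thesis using that[of i "z i"] i z by blast
qed

section \<open>Two elementary facts on real numbers\<close>

lemma le_0_if_le_mult_eps:
  fixes x C :: real
  assumes "\<And>\<epsilon>. 0 < \<epsilon> \<Longrightarrow> \<epsilon> < 1 \<Longrightarrow> x \<le> C * \<epsilon>"
  shows "x \<le> 0"
proof (rule ccontr)
  assume x: "\<not> x \<le> 0"
  define \<epsilon> where "\<epsilon> = min (1/2) (x / (2 * (\<bar>C\<bar> + 1)))"
  have \<epsilon>: "0 < \<epsilon>" "\<epsilon> < 1" using x by (auto simp: \<epsilon>_def)
  have "x \<le> C * \<epsilon>" by (rule assms[OF \<epsilon>])
  also have "\<dots> \<le> (\<bar>C\<bar> + 1) * \<epsilon>" using \<epsilon> by (intro mult_right_mono) auto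
  also have "\<dots> \<le> (\<bar>C\<bar> + 1) * (x / (2 * (\<bar>C\<bar> + 1)))"
    by (intro mult_left_mono) (auto simp: \<epsilon>_def)
  also have "\<dots> = x / 2" by (simp add: field_simps add_nonneg_pos)
  finally show False using x by simp
qed

text \<open>Otherwise \<open>S\<close> would drop by at least \<epsilon> at every step and become
  negative. It is applied to the maximal values that belong to the penalty parameters
  \<open>2 ^ k\<close>.\<close>

lemma decreasing_has_small_step:
  fixes S :: "nat \<Rightarrow> real"
  assumes "\<And>k. 0 \<le> S k" "0 < \<epsilon>"
  shows "\<exists>k. S k - S (Suc k) < \<epsilon>"
proof (rule ccontr)
  assume "\<not> ?thesis"
  then have step: "S (Suc k) \<le> S k - \<epsilon>" for k by (smt (verit) not_less)
  have "S k \<le> S 0 - real k * \<epsilon>" for k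
  proof (induction k)
    case (Suc k)
    then show ?case using step[of k] by (simp add: algebra_simps)
  qed simp
  moreover obtain k where "S 0 < real k * \<epsilon>" using reals_Archimedean3[OF assms(2)] by blast
  ultimately show False using assms(1)[of k] by (metis diff_ge_0_iff_ge linorder_not_less order_trans)
qed


section \<open>Sub- and supersolutions in coordinates\<close>

text \<open>The point with coordinates \<open>(s, t)\<close> in branch \<open>i\<close> stands for \<open>s e\<^sub>0 + t e\<^sub>i\<close>; the edge is
  \<open>t = 0\<close>.\<close>

locale junction_coords =
  fixes I :: "'i set"
    and U V :: "'i \<Rightarrow> real \<Rightarrow> real \<Rightarrow> real"
    and A :: "'i \<Rightarrow> 'a set"
    and F0 F1 l :: "'i \<Rightarrow> real \<Rightarrow> real \<Rightarrow> 'a \<Rightarrow> real"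
    and lam M L \<delta> :: real
  assumes I: "finite I" "I \<noteq> {}"
    and U_edge: "\<And>i j s. i \<in> I \<Longrightarrow> j \<in> I \<Longrightarrow> U i s 0 = U j s 0"
    and V_edge: "\<And>i j s. i \<in> I \<Longrightarrow> j \<in> I \<Longrightarrow> V i s 0 = V j s 0"
    and U_usc: "\<And>i. i \<in> I \<Longrightarrow> usc_on {z. 0 \<le> snd z} (\<lambda>z. U i (fst z) (snd z))"
    and V_lsc: "\<And>i. i \<in> I \<Longrightarrow> usc_on {z. 0 \<le> snd z} (\<lambda>z. - V i (fst z) (snd z))"
    and U_bdd: "\<And>i s t. i \<in> I \<Longrightarrow> 0 \<le> t \<Longrightarrow> \<bar>U i s t\<bar> \<le> M"
    and V_bdd: "\<And>i s t. i \<in> I \<Longrightarrow> 0 \<le> t \<Longrightarrow> \<bar>V i s t\<bar> \<le> M"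
    and F0_bdd: "\<And>i s t a. i \<in> I \<Longrightarrow> 0 \<le> t \<Longrightarrow> a \<in> A i \<Longrightarrow> \<bar>F0 i s t a\<bar> \<le> M"
    and F1_bdd: "\<And>i s t a. i \<in> I \<Longrightarrow> 0 \<le> t \<Longrightarrow> a \<in> A i \<Longrightarrow> \<bar>F1 i s t a\<bar> \<le> M"
    and l_bdd: "\<And>i s t a. i \<in> I \<Longrightarrow> 0 \<le> t \<Longrightarrow> a \<in> A i \<Longrightarrow> \<bar>l i s t a\<bar> \<le> M"
    and pos: "0 < lam" "0 < M" "0 < L" "0 < \<delta>"
    and F0_lip: "\<And>i s t s' t' a. i \<in> I \<Longrightarrow> 0 \<le> t \<Longrightarrow> 0 \<le> t' \<Longrightarrow> a \<in> A i \<Longrightarrow>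
          \<bar>F0 i s t a - F0 i s' t' a\<bar> \<le> L * (\<bar>s - s'\<bar> + \<bar>t - t'\<bar>)"
    and F1_lip: "\<And>i s t s' t' a. i \<in> I \<Longrightarrow> 0 \<le> t \<Longrightarrow> 0 \<le> t' \<Longrightarrow> a \<in> A i \<Longrightarrow>
          \<bar>F1 i s t a - F1 i s' t' a\<bar> \<le> L * (\<bar>s - s'\<bar> + \<bar>t - t'\<bar>)"
    and l_unif: "\<And>\<epsilon>. 0 < \<epsilon> \<Longrightarrow> \<exists>\<eta>>0. \<forall>i\<in>I. \<forall>s s' t t'. \<forall>a\<in>A i. 0 \<le> t \<longrightarrow> 0 \<le> t' \<longrightarrow>
          \<bar>s - s'\<bar> + \<bar>t - t'\<bar> < \<eta> \<longrightarrow> \<bar>l i s t a - l i s' t' a\<bar> < \<epsilon>"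
    and controllable: "\<And>i s y. i \<in> I \<Longrightarrow> \<bar>y\<bar> \<le> \<delta> \<Longrightarrow> \<exists>a\<in>A i. F1 i s 0 a = y"
    and convex_edge: "\<And>i s a b \<mu>. i \<in> I \<Longrightarrow> a \<in> A i \<Longrightarrow> b \<in> A i \<Longrightarrow> 0 \<le> \<mu> \<Longrightarrow> \<mu> \<le> 1 \<Longrightarrow>
          \<exists>c\<in>A i. F0 i s 0 c = (1 - \<mu>) * F0 i s 0 a + \<mu> * F0 i s 0 b \<and>
                 F1 i s 0 c = (1 - \<mu>) * F1 i s 0 a + \<mu> * F1 i s 0 b \<and>
                 l i s 0 c = (1 - \<mu>) * l i s 0 a + \<mu> * l i s 0 b"
    and sub_interior: "\<And>i s t \<eta> a\<^sub>1 a\<^sub>2 b\<^sub>1 b\<^sub>2 a. i \<in> I \<Longrightarrow> 0 < t \<Longrightarrow> 0 < \<eta> \<Longrightarrow>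
          (\<And>s' t'. \<bar>s' - s\<bar> < \<eta> \<Longrightarrow> \<bar>t' - t\<bar> < \<eta> \<Longrightarrow> 0 \<le> t' \<Longrightarrow>
             U i s' t' - (a\<^sub>1 * s' + a\<^sub>2 * s'\<^sup>2 + b\<^sub>1 * t' + b\<^sub>2 * t'\<^sup>2)
             \<le> U i s t - (a\<^sub>1 * s + a\<^sub>2 * s\<^sup>2 + b\<^sub>1 * t + b\<^sub>2 * t\<^sup>2)) \<Longrightarrow> a \<in> A i \<Longrightarrow>
          lam * U i s t - (a\<^sub>1 + 2 * a\<^sub>2 * s) * F0 i s t a - (b\<^sub>1 + 2 * b\<^sub>2 * t) * F1 i s t a - l i s t a \<le> 0"
    and sub_edge: "\<And>i s \<eta> a\<^sub>1 a\<^sub>2 b\<^sub>1 b\<^sub>2 a. 0 < \<eta> \<Longrightarrow>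
          (\<And>j s' t'. j \<in> I \<Longrightarrow> \<bar>s' - s\<bar> < \<eta> \<Longrightarrow> 0 \<le> t' \<Longrightarrow> t' < \<eta> \<Longrightarrow>
             U j s' t' - (a\<^sub>1 * s' + a\<^sub>2 * s'\<^sup>2 + b\<^sub>1 j * t' + b\<^sub>2 j * t'\<^sup>2)
             \<le> U j s 0 - (a\<^sub>1 * s + a\<^sub>2 * s\<^sup>2)) \<Longrightarrow> i \<in> I \<Longrightarrow> a \<in> A i \<Longrightarrow> 0 \<le> F1 i s 0 a \<Longrightarrow>
          lam * U i s 0 - (a\<^sub>1 + 2 * a\<^sub>2 * s) * F0 i s 0 a - b\<^sub>1 i * F1 i s 0 a - l i s 0 a \<le> 0"
    and super_interior: "\<And>i s t \<eta> a\<^sub>1 a\<^sub>2 b\<^sub>1 b\<^sub>2 \<epsilon>. i \<in> I \<Longrightarrow> 0 < t \<Longrightarrow> 0 < \<eta> \<Longrightarrow>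
          (\<And>s' t'. \<bar>s' - s\<bar> < \<eta> \<Longrightarrow> \<bar>t' - t\<bar> < \<eta> \<Longrightarrow> 0 \<le> t' \<Longrightarrow>
             V i s t - (a\<^sub>1 * s + a\<^sub>2 * s\<^sup>2 + b\<^sub>1 * t + b\<^sub>2 * t\<^sup>2)
             \<le> V i s' t' - (a\<^sub>1 * s' + a\<^sub>2 * s'\<^sup>2 + b\<^sub>1 * t' + b\<^sub>2 * t'\<^sup>2)) \<Longrightarrow> 0 < \<epsilon> \<Longrightarrow>
          \<exists>a\<in>A i. - \<epsilon> \<le> lam * V i s t - (a\<^sub>1 + 2 * a\<^sub>2 * s) * F0 i s t a
                       - (b\<^sub>1 + 2 * b\<^sub>2 * t) * F1 i s t a - l i s t a"
    and super_edge: "\<And>s \<eta> a\<^sub>1 a\<^sub>2 b\<^sub>1 b\<^sub>2 \<epsilon>. 0 < \<eta> \<Longrightarrow>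
          (\<And>j s' t'. j \<in> I \<Longrightarrow> \<bar>s' - s\<bar> < \<eta> \<Longrightarrow> 0 \<le> t' \<Longrightarrow> t' < \<eta> \<Longrightarrow>
             V j s 0 - (a\<^sub>1 * s + a\<^sub>2 * s\<^sup>2)
             \<le> V j s' t' - (a\<^sub>1 * s' + a\<^sub>2 * s'\<^sup>2 + b\<^sub>1 j * t' + b\<^sub>2 j * t'\<^sup>2)) \<Longrightarrow> 0 < \<epsilon> \<Longrightarrow>
          \<exists>i\<in>I. \<exists>a\<in>A i. 0 \<le> F1 i s 0 a \<and>
             - \<epsilon> \<le> lam * V i s 0 - (a\<^sub>1 + 2 * a\<^sub>2 * s) * F0 i s 0 a - b\<^sub>1 i * F1 i s 0 a - l i s 0 a"
begin

section \<open>Coercivity in the normal slope\<close>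

definition slope_bound :: "real \<Rightarrow> real" where
  "slope_bound p = 2 / \<delta> * (lam * M + M + M * \<bar>p\<bar>)"

lemma slope_bound_mono: "\<bar>p\<bar> \<le> \<bar>p'\<bar> \<Longrightarrow> slope_bound p \<le> slope_bound p'"
  unfolding slope_bound_def using pos by (intro mult_left_mono add_left_mono) auto

text \<open>Up to the height \<open>\<delta> / (2 * L)\<close> Lipschitz continuity preserves half
  of the normal speed \<delta> available on the edge. Testing with a control that moves against the
  sign of \<open>q\<close> leaves \<open>\<bar>q\<bar> * (\<delta> / 2)\<close> on the left and at
  most \<open>lam * M + M + M * \<bar>p\<bar>\<close> on the right; \<open>slope_bound\<close> is
  the quotient.\<close>

lemma normal_slope_le:
  assumes i: "i \<in> I" and t: "0 \<le> t" "t \<le> \<delta> / (2 * L)"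
    and sub: "\<And>a. a \<in> A i \<Longrightarrow> lam * U i s t - p * F0 i s t a - q * F1 i s t a - l i s t a \<le> 0"
  shows "\<bar>q\<bar> \<le> slope_bound p"
proof -
  have "\<bar>if q \<ge> 0 then - \<delta> else \<delta>\<bar> \<le> \<delta>" using pos by simp
  then obtain a where a: "a \<in> A i" "F1 i s 0 a = (if q \<ge> 0 then - \<delta> else \<delta>)"
    using controllable[OF i, of "if q \<ge> 0 then - \<delta> else \<delta>" s] by blast
  have "\<bar>F1 i s t a - F1 i s 0 a\<bar> \<le> L * t"
    using F1_lip[of i t 0 a s s] i t a by simp
  also have "L * t \<le> \<delta> / 2" using t pos by (simp add: field_simps)
  finally have d: "\<bar>F1 i s t a - F1 i s 0 a\<bar> \<le> \<delta> / 2" .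
  have F1: "\<delta> / 2 \<le> (if q \<ge> 0 then - F1 i s t a else F1 i s t a)"
  proof (cases "q \<ge> 0")
    case True
    then have "F1 i s 0 a = - \<delta>" using a(2) by simp
    then have "\<delta> / 2 \<le> - F1 i s t a" using d by linarith
    then show ?thesis using True by simp
  next
    case False
    then have "F1 i s 0 a = \<delta>" using a(2) by simp
    then have "\<delta> / 2 \<le> F1 i s t a" using d by linarith
    then show ?thesis using False by simp
  qed
  have "\<bar>q\<bar> * (\<delta> / 2) \<le> \<bar>q\<bar> * (if q \<ge> 0 then - F1 i s t a else F1 i s t a)"
    using F1 by (intro mult_left_mono) auto
  also have "\<dots> = - q * F1 i s t a" by auto
  also have "\<dots> \<le> - lam * U i s t + p * F0 i s t a + l i s t a" using sub[OF a(1)] by simp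
  also have "\<dots> \<le> lam * M + M * \<bar>p\<bar> + M"
  proof -
    have "lam * (- M) \<le> lam * U i s t"
      using U_bdd[of i t s] i t pos by (intro mult_left_mono) auto
    then have "- lam * U i s t \<le> lam * M" by simp
    moreover have "p * F0 i s t a \<le> M * \<bar>p\<bar>"
      using F0_bdd[of i t a s] i t a
      by (metis abs_ge_self abs_ge_zero abs_mult mult.commute mult_right_mono order_trans)
    moreover have "l i s t a \<le> M" using l_bdd[of i t a s] i t a by auto
    ultimately show ?thesis by simp
  qed
  finally show ?thesis using pos by (simp add: slope_bound_def field_simps)
qed

section \<open>Moving inward controls along the edge\<close>

text \<open>A control at \<open>\<sigma>\<close> pointing into the branch is mixed with one of normal speed \<open>\<delta>\<close> at \<open>\<sigma>'\<close>,
  the weight of the latter being just large enough to point into the branch at \<open>\<sigma>'\<close> as well.\<close>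

definition transfer_const :: real where
  "transfer_const = L * (1 + 2 * M / \<delta>)"

lemma transfer_const_pos: "0 < transfer_const"
  unfolding transfer_const_def using pos by (simp add: add_pos_pos)

lemma inward_control_transfer:
  assumes i: "i \<in> I" and a: "a \<in> A i" "0 \<le> F1 i \<sigma> 0 a"
  shows "\<exists>a'\<in>A i. 0 \<le> F1 i \<sigma>' 0 a' \<and>
    \<bar>F0 i \<sigma>' 0 a' - F0 i \<sigma> 0 a\<bar> \<le> transfer_const * \<bar>\<sigma> - \<sigma>'\<bar> \<and>
    \<bar>F1 i \<sigma>' 0 a' - F1 i \<sigma> 0 a\<bar> \<le> transfer_const * \<bar>\<sigma> - \<sigma>'\<bar> \<and>
    \<bar>l i \<sigma>' 0 a' - l i \<sigma> 0 a\<bar> \<le> \<bar>l i \<sigma>' 0 a - l i \<sigma> 0 a\<bar> + transfer_const * \<bar>\<sigma> - \<sigma>'\<bar>"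
proof -
  define d where "d = L * \<bar>\<sigma> - \<sigma>'\<bar>"
  \<comment> \<open>Passing from \<sigma> to \<sigma>' lowers the normal speed of \<open>a\<close>
    by at most \<open>d\<close>, so the mixture has speed at least
    \<open>(1 - \<mu>) * (- d) + \<mu> * \<delta>\<close>. This \<mu> makes the bound zero.\<close>
  define \<mu> where "\<mu> = d / (d + \<delta>)"
  have d: "0 \<le> d" unfolding d_def using pos by simp
  have \<mu>: "0 \<le> \<mu>" "\<mu> \<le> 1" "\<mu> \<le> d / \<delta>"
    unfolding \<mu>_def using d pos by (auto simp: field_simps)
  obtain b where b: "b \<in> A i" "F1 i \<sigma>' 0 b = \<delta>"
    using controllable[of i \<delta>] i pos by auto
  obtain c where c: "c \<in> A i"
    "F0 i \<sigma>' 0 c = (1 - \<mu>) * F0 i \<sigma>' 0 a + \<mu> * F0 i \<sigma>' 0 b"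
    "F1 i \<sigma>' 0 c = (1 - \<mu>) * F1 i \<sigma>' 0 a + \<mu> * F1 i \<sigma>' 0 b"
    "l i \<sigma>' 0 c = (1 - \<mu>) * l i \<sigma>' 0 a + \<mu> * l i \<sigma>' 0 b"
    using convex_edge[OF i a(1) b(1) \<mu>(1,2)] by blast
  have F0: "\<bar>F0 i \<sigma>' 0 a - F0 i \<sigma> 0 a\<bar> \<le> d" and F1: "\<bar>F1 i \<sigma>' 0 a - F1 i \<sigma> 0 a\<bar> \<le> d"
    using F0_lip[of i 0 0 a \<sigma>' \<sigma>] F1_lip[of i 0 0 a \<sigma>' \<sigma>] i a by (auto simp: d_def abs_minus_commute)
  \<comment> \<open>Origin of \<open>transfer_const\<close>: \<open>d\<close> is the Lipschitz
    change of \<open>a\<close> itself, and mixing two values bounded by \<open>M\<close> with weight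
    \<open>\<mu> \<le> d / \<delta>\<close> moves the first by at most
    \<open>\<mu> * (2 * M)\<close>.\<close>
  have TC: "d + \<mu> * (2 * M) \<le> transfer_const * \<bar>\<sigma> - \<sigma>'\<bar>"
  proof -
    have "\<mu> * (2 * M) \<le> d / \<delta> * (2 * M)" using \<mu> pos by (intro mult_right_mono) auto
    then show ?thesis by (simp add: transfer_const_def d_def algebra_simps)
  qed
  have mix: "\<bar>(1 - \<mu>) * x + \<mu> * y - z\<bar> \<le> \<bar>x - z\<bar> + \<mu> * (2 * M)"
    if "\<bar>x\<bar> \<le> M" "\<bar>y\<bar> \<le> M" for x y z
  proof -
    have "(1 - \<mu>) * x + \<mu> * y - z = (x - z) + \<mu> * (y - x)" by (simp add: algebra_simps)
    moreover have "\<bar>\<mu> * (y - x)\<bar> \<le> \<mu> * (2 * M)"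
      using that \<mu> by (simp add: abs_mult) (intro mult_left_mono; simp)
    ultimately show ?thesis by linarith
  qed
  have "0 \<le> F1 i \<sigma>' 0 c"
  proof -
    have "(1 - \<mu>) * (- d) \<le> (1 - \<mu>) * F1 i \<sigma>' 0 a"
      using F1 a \<mu> by (intro mult_left_mono) auto
    moreover have "(1 - \<mu>) * (- d) + \<mu> * \<delta> = 0"
      unfolding \<mu>_def using d pos by (simp add: field_simps)
    ultimately show ?thesis using c b by simp
  qed
  moreover have "\<bar>F0 i \<sigma>' 0 c - F0 i \<sigma> 0 a\<bar> \<le> transfer_const * \<bar>\<sigma> - \<sigma>'\<bar>"
    using mix[of "F0 i \<sigma>' 0 a" "F0 i \<sigma>' 0 b" "F0 i \<sigma> 0 a"] F0 TC c F0_bdd[of i 0] i a b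
    by fastforce
  moreover have "\<bar>F1 i \<sigma>' 0 c - F1 i \<sigma> 0 a\<bar> \<le> transfer_const * \<bar>\<sigma> - \<sigma>'\<bar>"
    using mix[of "F1 i \<sigma>' 0 a" "F1 i \<sigma>' 0 b" "F1 i \<sigma> 0 a"] F1 TC c F1_bdd[of i 0] i a b
    by fastforce
  moreover have "\<bar>l i \<sigma>' 0 c - l i \<sigma> 0 a\<bar> \<le> \<bar>l i \<sigma>' 0 a - l i \<sigma> 0 a\<bar> + transfer_const * \<bar>\<sigma> - \<sigma>'\<bar>"
    using mix[of "l i \<sigma>' 0 a" "l i \<sigma>' 0 b" "l i \<sigma> 0 a"] TC d c l_bdd[of i 0] i a b
    by fastforce
  ultimately show ?thesis using c(1) by blast
qed

section \<open>The subsolution near an edge point\<close>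

text \<open>The term \<open>(\<sigma> - sg)\<^sup>2\<close> makes \<open>sg\<close> the only
  maximizer on the edge. Almost maximal points at heights tending to 0 that stay \<eta> away from
  \<open>sg\<close> would accumulate at another edge point, where the value is strictly smaller;
  this contradicts upper semicontinuity.\<close>

lemma edge_maximizer_stable:
  assumes i\<^sub>0: "i\<^sub>0 \<in> I" and max: "\<And>\<sigma>. U i\<^sub>0 \<sigma> 0 - n * (sb - \<sigma>)\<^sup>2 \<le> U i\<^sub>0 sg 0 - n * (sb - sg)\<^sup>2"
    and \<eta>: "0 < \<eta>"
  shows "\<exists>\<kappa>>0. \<forall>j\<in>I. \<forall>\<sigma> t. \<bar>\<sigma> - sg\<bar> \<le> 1 \<longrightarrow> 0 \<le> t \<longrightarrow> t < \<kappa> \<longrightarrow>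
    U i\<^sub>0 sg 0 - n * (sb - sg)\<^sup>2 - \<kappa> < U j \<sigma> t - n * (sb - \<sigma>)\<^sup>2 - (\<sigma> - sg)\<^sup>2 \<longrightarrow> \<bar>\<sigma> - sg\<bar> < \<eta>"
proof -
  define X where "X = U i\<^sub>0 sg 0 - n * (sb - sg)\<^sup>2"
  define \<Psi> where "\<Psi> j z = U j (fst z) (snd z) - (n * (sb - fst z)\<^sup>2 + (fst z - sg)\<^sup>2)" for j z
  have "\<exists>\<kappa>>0. \<forall>\<sigma> t. \<bar>\<sigma> - sg\<bar> \<le> 1 \<longrightarrow> 0 \<le> t \<longrightarrow> t < \<kappa> \<longrightarrow> X - \<kappa> < \<Psi> j (\<sigma>, t) \<longrightarrow> \<bar>\<sigma> - sg\<bar> < \<eta>"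
    if j: "j \<in> I" for j
  proof (rule ccontr)
    assume neg: "\<not> ?thesis"
    have "\<exists>z. \<bar>fst z - sg\<bar> \<le> 1 \<and> 0 \<le> snd z \<and> snd z < inverse (real (Suc k)) \<and>
        X - inverse (real (Suc k)) < \<Psi> j z \<and> \<eta> \<le> \<bar>fst z - sg\<bar>" for k
    proof -
      have "0 < inverse (real (Suc k))" by simp
      with neg obtain \<sigma> t where "\<bar>\<sigma> - sg\<bar> \<le> 1" "0 \<le> t" "t < inverse (real (Suc k))"
        "X - inverse (real (Suc k)) < \<Psi> j (\<sigma>, t)" "\<not> \<bar>\<sigma> - sg\<bar> < \<eta>" by blast
      then show ?thesis by (intro exI[of _ "(\<sigma>, t)"]) auto
    qed
    then obtain z where z: "\<And>k. \<bar>fst (z k) - sg\<bar> \<le> 1" "\<And>k. 0 \<le> snd (z k)"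
      "\<And>k. snd (z k) < inverse (real (Suc k))" "\<And>k. X - inverse (real (Suc k)) < \<Psi> j (z k)"
      "\<And>k. \<eta> \<le> \<bar>fst (z k) - sg\<bar>" by metis
    define C where "C = (cball sg 1 - ball sg \<eta>) \<times> {0..1::real}"
    have "compact C" unfolding C_def by (intro compact_Times compact_diff) auto
    moreover have "\<forall>k. z k \<in> C"
    proof
      fix k
      have "inverse (real (Suc k)) \<le> 1" by (simp add: field_simps)
      then have "snd (z k) \<le> 1" using z(3)[of k] by linarith
      moreover have "fst (z k) \<in> cball sg 1 - ball sg \<eta>"
        using z(1,5)[of k] by (simp add: dist_real_def abs_minus_commute not_less)
      ultimately show "z k \<in> C" using z(2)[of k] unfolding C_def by (simp add: mem_Times_iff)
    qed
    ultimately obtain x r where x: "x \<in> C" "strict_mono (r :: nat \<Rightarrow> nat)" "(z \<circ> r) \<longlonglongrightarrow> x"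
      unfolding compact_def by meson
    have inv: "(\<lambda>k. inverse (real (Suc (r k)))) \<longlonglongrightarrow> 0"
      using LIMSEQ_subseq_LIMSEQ[OF LIMSEQ_inverse_real_of_nat x(2)] by (simp add: o_def)
    have "(\<lambda>k. snd (z (r k))) \<longlonglongrightarrow> snd x"
      using tendsto_snd[OF x(3)] by (simp add: o_def)
    moreover have "(\<lambda>k. snd (z (r k))) \<longlonglongrightarrow> 0"
      by (rule tendsto_sandwich[OF _ _ tendsto_const inv])
       (use z(2) less_imp_le[OF z(3)] in \<open>auto intro!: always_eventually simp del: of_nat_Suc\<close>)
    ultimately have x0: "snd x = 0" by (rule LIMSEQ_unique)
    have "\<eta>\<^sup>2 \<le> (fst x - sg)\<^sup>2"
    proof -
      have "\<eta> \<le> \<bar>fst x - sg\<bar>" using x(1) by (auto simp: C_def dist_real_def)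
      then show ?thesis using \<eta> by (metis less_imp_le power2_abs power_mono)
    qed
    moreover have "0 < \<eta>\<^sup>2" using \<eta> by simp
    ultimately have lt: "\<Psi> j x < X"
      using max[of "fst x"] unfolding \<Psi>_def X_def x0 U_edge[OF j i\<^sub>0, of "fst x"] by linarith
    define c where "c = (\<Psi> j x + X) / 2"
    have c: "\<Psi> j x < c" "c < X" using lt by (auto simp: c_def)
    have usc: "usc_on {z. 0 \<le> snd z} (\<Psi> j)"
      unfolding \<Psi>_def by (intro usc_on_diff_continuous[OF U_usc[OF j]] continuous_intros)
    obtain T where T: "open T" "x \<in> T" "\<And>y. y \<in> T \<Longrightarrow> 0 \<le> snd y \<Longrightarrow> \<Psi> j y < c"
      using usc_onE[OF usc _ c(1)] x0 by auto
    have "\<forall>\<^sub>F k in sequentially. (z \<circ> r) k \<in> T" using x(3) T(1,2) by (rule topological_tendstoD)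
    moreover have "\<forall>\<^sub>F k in sequentially. inverse (real (Suc (r k))) < X - c"
      using inv c(2) by (intro order_tendstoD) auto
    ultimately have "\<forall>\<^sub>F k in sequentially. False"
    proof eventually_elim
      case (elim k)
      have "\<Psi> j (z (r k)) < c" using T(3) elim z(2) by simp
      then show False using z(4)[of "r k"] elim by linarith
    qed
    then show False by simp
  qed
  then obtain \<kappa> where \<kappa>: "\<And>j. j \<in> I \<Longrightarrow> 0 < \<kappa> j" "\<And>j \<sigma> t. j \<in> I \<Longrightarrow> \<bar>\<sigma> - sg\<bar> \<le> 1 \<Longrightarrow> 0 \<le> t \<Longrightarrow>
      t < \<kappa> j \<Longrightarrow> X - \<kappa> j < \<Psi> j (\<sigma>, t) \<Longrightarrow> \<bar>\<sigma> - sg\<bar> < \<eta>" by metis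
  define k where "k = Min (\<kappa> ` I)"
  have "0 < k" unfolding k_def using I \<kappa>(1) by simp
  moreover have "k \<le> \<kappa> j" if "j \<in> I" for j unfolding k_def using I that by simp
  ultimately show ?thesis
    using \<kappa>(2) unfolding X_def \<Psi>_def
    by (intro exI[of _ k]) (smt (verit) fst_conv snd_conv)
qed

text \<open>By \<open>top\<close> the function is smaller on the face \<open>t = t\<^sub>1\<close>
  than at \<open>(sg, 0)\<close>, so the maximum over the box lies below that face. The lateral
  faces are left to \<open>edge_maximizer_stable\<close>; the face \<open>t = 0\<close> is the edge,
  where a maximum is welcome.\<close>

lemma edge_box_max:
  assumes i\<^sub>0: "i\<^sub>0 \<in> I" and t\<^sub>1: "0 < t\<^sub>1"
    and top: "\<And>j \<sigma>. j \<in> I \<Longrightarrow> \<bar>\<sigma> - sg\<bar> \<le> 1 \<Longrightarrow>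
      U j \<sigma> t\<^sub>1 - n * (s\<^sub>1 - \<sigma>)\<^sup>2 - (\<sigma> - sg)\<^sup>2 - (Q j * t\<^sub>1 + B j * t\<^sub>1\<^sup>2) < U i\<^sub>0 sg 0 - n * (s\<^sub>1 - sg)\<^sup>2"
  obtains j \<sigma> t where "j \<in> I" "\<bar>\<sigma> - sg\<bar> \<le> 1" "0 \<le> t" "t < t\<^sub>1"
    "U i\<^sub>0 sg 0 - n * (s\<^sub>1 - sg)\<^sup>2 \<le> U j \<sigma> t - n * (s\<^sub>1 - \<sigma>)\<^sup>2 - (\<sigma> - sg)\<^sup>2 - (Q j * t + B j * t\<^sup>2)"
    "\<forall>j'\<in>I. \<forall>\<sigma>' t'. \<bar>\<sigma>' - sg\<bar> \<le> 1 \<longrightarrow> 0 \<le> t' \<longrightarrow> t' \<le> t\<^sub>1 \<longrightarrow>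
       U j' \<sigma>' t' - n * (s\<^sub>1 - \<sigma>')\<^sup>2 - (\<sigma>' - sg)\<^sup>2 - (Q j' * t' + B j' * t'\<^sup>2)
       \<le> U j \<sigma> t - n * (s\<^sub>1 - \<sigma>)\<^sup>2 - (\<sigma> - sg)\<^sup>2 - (Q j * t + B j * t\<^sup>2)"
proof -
  define \<Psi> where "\<Psi> j z = U j (fst z) (snd z) -
    (n * (s\<^sub>1 - fst z)\<^sup>2 + (fst z - sg)\<^sup>2 + (Q j * snd z + B j * (snd z)\<^sup>2))" for j z
  define K where "K = cball sg 1 \<times> {0..t\<^sub>1}"
  have K: "compact K" "K \<noteq> {}" using t\<^sub>1 by (auto simp: K_def compact_Times)
  have "usc_on {z. 0 \<le> snd z} (\<Psi> j)" if "j \<in> I" for j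
    unfolding \<Psi>_def by (intro usc_on_diff_continuous[OF U_usc[OF that]] continuous_intros)
  then have usc: "usc_on K (\<Psi> j)" if "j \<in> I" for j
    by (rule usc_on_subset) (use that in \<open>auto simp: K_def\<close>)
  obtain j z where j: "j \<in> I" "z \<in> K" and max: "\<And>j' y. j' \<in> I \<Longrightarrow> y \<in> K \<Longrightarrow> \<Psi> j' y \<le> \<Psi> j z"
    using usc_on_family_attains_max[where u = \<Psi>, OF I K usc] by blast
  obtain \<sigma> t where z: "z = (\<sigma>, t)" by (cases z)
  have st: "\<bar>\<sigma> - sg\<bar> \<le> 1" "0 \<le> t" "t \<le> t\<^sub>1"
    using j z by (auto simp: K_def dist_real_def abs_minus_commute)
  have "\<Psi> i\<^sub>0 (sg, 0) \<le> \<Psi> j z" using max[OF i\<^sub>0, of "(sg, 0)"] t\<^sub>1 by (simp add: K_def)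
  then have ge: "U i\<^sub>0 sg 0 - n * (s\<^sub>1 - sg)\<^sup>2 \<le> \<Psi> j z" by (simp add: \<Psi>_def)
  have "t \<noteq> t\<^sub>1"
  proof
    assume "t = t\<^sub>1"
    with top[OF j(1) st(1)] ge show False by (simp add: \<Psi>_def z)
  qed
  with st have lt: "t < t\<^sub>1" by simp
  have mx: "U j' \<sigma>' t' - n * (s\<^sub>1 - \<sigma>')\<^sup>2 - (\<sigma>' - sg)\<^sup>2 - (Q j' * t' + B j' * t'\<^sup>2)
       \<le> U j \<sigma> t - n * (s\<^sub>1 - \<sigma>)\<^sup>2 - (\<sigma> - sg)\<^sup>2 - (Q j * t + B j * t\<^sup>2)"
    if "j' \<in> I" "\<bar>\<sigma>' - sg\<bar> \<le> 1" "0 \<le> t'" "t' \<le> t\<^sub>1" for j' \<sigma>' t'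
    using max[OF that(1), of "(\<sigma>', t')"] that
    by (simp add: K_def \<Psi>_def z dist_real_def abs_minus_commute algebra_simps)
  show thesis
  proof (rule that[OF j(1) st(1,2) lt])
    show "U i\<^sub>0 sg 0 - n * (s\<^sub>1 - sg)\<^sup>2 \<le> U j \<sigma> t - n * (s\<^sub>1 - \<sigma>)\<^sup>2 - (\<sigma> - sg)\<^sup>2 - (Q j * t + B j * t\<^sup>2)"
      using ge by (simp add: \<Psi>_def z algebra_simps)
  qed (use mx in blast)
qed

text \<open>The function \<open>U j \<sigma> t - n (s\<^sub>1 - \<sigma>)\<^sup>2 - (\<sigma> - sg)\<^sup>2 - Q j t - B j t\<^sup>2\<close> has a maximum near the edge.
  A slope \<open>Q j\<close> above the coercivity bound forbids that it is attained inside branch \<open>j\<close>, so only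
  branch \<open>i\<close> and the edge remain. There the subsolution inequality is tested with controls close
  to the given one.\<close>

lemma edge_sub_limit:
  assumes i\<^sub>0: "i\<^sub>0 \<in> I" and n: "0 \<le> n"
    and max: "\<And>\<sigma>. U i\<^sub>0 \<sigma> 0 - n * (sb - \<sigma>)\<^sup>2 \<le> U i\<^sub>0 sg 0 - n * (sb - sg)\<^sup>2"
    and p: "p = 2 * n * (sg - sb)"
    and Q: "\<And>j. j \<in> I \<Longrightarrow> \<bar>Q j\<bar> \<le> Kq"
    and top: "\<And>\<eta>. 0 < \<eta> \<Longrightarrow> \<exists>s\<^sub>1 t\<^sub>1 B. \<bar>s\<^sub>1 - sb\<bar> < \<eta> \<and> 0 < t\<^sub>1 \<and> t\<^sub>1 < \<eta> \<and>
      (\<forall>j\<in>I. 0 \<le> B j \<and> (Q j \<ge> slope_bound (\<bar>p\<bar> + 1) + 1 \<or> j = i \<and> B j = 0) \<and>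
        (\<forall>\<sigma>. \<bar>\<sigma> - sg\<bar> \<le> 1 \<longrightarrow>
          U j \<sigma> t\<^sub>1 - n * (s\<^sub>1 - \<sigma>)\<^sup>2 - (\<sigma> - sg)\<^sup>2 - (Q j * t\<^sub>1 + B j * t\<^sub>1\<^sup>2)
          < U i\<^sub>0 sg 0 - n * (s\<^sub>1 - sg)\<^sup>2))"
    and i: "i \<in> I" and a: "a \<in> A i" "0 \<le> F1 i sg 0 a"
  shows "lam * U i sg 0 \<le> p * F0 i sg 0 a + Q i * F1 i sg 0 a + l i sg 0 a"
proof -
  define C\<^sub>1 where "C\<^sub>1 = 2 * (L + transfer_const)"
  have C\<^sub>1: "0 \<le> C\<^sub>1" using pos transfer_const_pos by (simp add: C\<^sub>1_def)
  have "lam * U i sg 0 - (p * F0 i sg 0 a + Q i * F1 i sg 0 a + l i sg 0 a)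
      \<le> (lam + M + \<bar>p\<bar> * C\<^sub>1 + \<bar>Q i\<bar> * C\<^sub>1 + 1 + C\<^sub>1) * \<epsilon>" if \<epsilon>: "0 < \<epsilon>" "\<epsilon> < 1" for \<epsilon>
  proof -
    obtain \<eta>\<^sub>l where \<eta>\<^sub>l: "0 < \<eta>\<^sub>l" "\<And>s s' t t' a. a \<in> A i \<Longrightarrow> 0 \<le> t \<Longrightarrow> 0 \<le> t' \<Longrightarrow>
        \<bar>s - s'\<bar> + \<bar>t - t'\<bar> < \<eta>\<^sub>l \<Longrightarrow> \<bar>l i s t a - l i s' t' a\<bar> < \<epsilon>"
      using l_unif[OF \<epsilon>(1)] i by blast
    \<comment> \<open>In order, the entries keep the maximum off the lateral faces, the tangential
      slope \<open>p\<^sub>1\<close> close to \<open>p\<close>, the value of \<open>U\<close> close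
      to that at \<open>sg\<close>, the points within the range where \<open>l\<close> varies by
      less than \<epsilon>, and their distance of order \<epsilon>.\<close>
    define \<eta> where "\<eta> = Min {1, \<epsilon> / (2 * (2 * n + 2)), \<epsilon> / (2 * (\<bar>p\<bar> + 1)), \<eta>\<^sub>l / 2, \<epsilon>}"
    have \<eta>0: "0 < \<eta>" using \<epsilon> n \<eta>\<^sub>l(1) by (simp add: \<eta>_def add_nonneg_pos)
    have \<eta>le: "\<eta> \<le> 1" "\<eta> \<le> \<epsilon> / (2 * (2 * n + 2))" "\<eta> \<le> \<epsilon> / (2 * (\<bar>p\<bar> + 1))"
      "\<eta> \<le> \<eta>\<^sub>l / 2" "\<eta> \<le> \<epsilon>"
      unfolding \<eta>_def by (intro Min_le; simp)+
    note \<eta> = \<eta>0 \<eta>le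
    obtain \<kappa> where \<kappa>: "0 < \<kappa>" "\<And>j \<sigma> t. j \<in> I \<Longrightarrow> \<bar>\<sigma> - sg\<bar> \<le> 1 \<Longrightarrow> 0 \<le> t \<Longrightarrow> t < \<kappa> \<Longrightarrow>
        U i\<^sub>0 sg 0 - n * (sb - sg)\<^sup>2 - \<kappa> < U j \<sigma> t - n * (sb - \<sigma>)\<^sup>2 - (\<sigma> - sg)\<^sup>2 \<Longrightarrow> \<bar>\<sigma> - sg\<bar> < \<eta>"
      using edge_maximizer_stable[OF i\<^sub>0 max \<eta>(1)] by blast
    define \<kappa>' where "\<kappa>' = min \<kappa> (\<epsilon> / 2)"
    have Kq: "0 \<le> Kq" using Q[OF i] by simp
    \<comment> \<open>The first entry absorbs the shift of the centre and the linear normal term in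
      \<open>close\<close>, the second the effect of the shift on \<open>p\<^sub>1\<close>. The
      others make the height small enough for the distance estimate, for \<kappa> and for
      coercivity.\<close>
    define \<eta>\<^sub>1 where "\<eta>\<^sub>1 = Min {\<kappa>' / (2 * n + Kq + 1), \<epsilon> / (2 * (2 * n + 1)), \<eta>, \<kappa>, \<delta> / (2 * L)}"
    have \<eta>\<^sub>10: "0 < \<eta>\<^sub>1" using \<epsilon> n Kq \<eta>(1) \<kappa>(1) pos by (simp add: \<eta>\<^sub>1_def \<kappa>'_def add_nonneg_pos)
    have \<eta>\<^sub>1le: "\<eta>\<^sub>1 \<le> \<kappa>' / (2 * n + Kq + 1)" "\<eta>\<^sub>1 \<le> \<epsilon> / (2 * (2 * n + 1))" "\<eta>\<^sub>1 \<le> \<eta>"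
      "\<eta>\<^sub>1 \<le> \<kappa>" "\<eta>\<^sub>1 \<le> \<delta> / (2 * L)"
      unfolding \<eta>\<^sub>1_def by (intro Min_le; simp)+
    note \<eta>\<^sub>1 = \<eta>\<^sub>10 \<eta>\<^sub>1le
    obtain s\<^sub>1 t\<^sub>1 B where st: "\<bar>s\<^sub>1 - sb\<bar> < \<eta>\<^sub>1" "0 < t\<^sub>1" "t\<^sub>1 < \<eta>\<^sub>1"
      and B: "\<And>j. j \<in> I \<Longrightarrow> 0 \<le> B j"
      and QB: "\<And>j. j \<in> I \<Longrightarrow> Q j \<ge> slope_bound (\<bar>p\<bar> + 1) + 1 \<or> j = i \<and> B j = 0"
      and tp: "\<And>j \<sigma>. j \<in> I \<Longrightarrow> \<bar>\<sigma> - sg\<bar> \<le> 1 \<Longrightarrow>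
          U j \<sigma> t\<^sub>1 - n * (s\<^sub>1 - \<sigma>)\<^sup>2 - (\<sigma> - sg)\<^sup>2 - (Q j * t\<^sub>1 + B j * t\<^sub>1\<^sup>2)
          < U i\<^sub>0 sg 0 - n * (s\<^sub>1 - sg)\<^sup>2"
      using top[OF \<eta>\<^sub>1(1)] by blast
    obtain j \<sigma> t where j: "j \<in> I" and \<sigma>1: "\<bar>\<sigma> - sg\<bar> \<le> 1" and t: "0 \<le> t" "t < t\<^sub>1"
      and ge: "U i\<^sub>0 sg 0 - n * (s\<^sub>1 - sg)\<^sup>2 \<le> U j \<sigma> t - n * (s\<^sub>1 - \<sigma>)\<^sup>2 - (\<sigma> - sg)\<^sup>2 - (Q j * t + B j * t\<^sup>2)"
      and mx': "\<forall>j'\<in>I. \<forall>\<sigma>' t'. \<bar>\<sigma>' - sg\<bar> \<le> 1 \<longrightarrow> 0 \<le> t' \<longrightarrow> t' \<le> t\<^sub>1 \<longrightarrow>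
        U j' \<sigma>' t' - n * (s\<^sub>1 - \<sigma>')\<^sup>2 - (\<sigma>' - sg)\<^sup>2 - (Q j' * t' + B j' * t'\<^sup>2)
        \<le> U j \<sigma> t - n * (s\<^sub>1 - \<sigma>)\<^sup>2 - (\<sigma> - sg)\<^sup>2 - (Q j * t + B j * t\<^sup>2)"
      by (rule edge_box_max[where n = n and Q = Q and B = B, OF i\<^sub>0 st(2) tp])
    note mx = mx'[rule_format]
    \<comment> \<open>Replacing the centre \<open>s\<^sub>1\<close> by \<open>sb\<close> costs at
      most \<open>2 * n * \<eta>\<^sub>1\<close> and dropping the linear normal term at most
      \<open>Kq * \<eta>\<^sub>1\<close>. The quadratic normal term has the favourable sign, so the
      size of \<open>B\<close> does not enter.\<close>
    have close: "U i\<^sub>0 sg 0 - n * (sb - sg)\<^sup>2 - \<kappa>' < U j \<sigma> t - n * (sb - \<sigma>)\<^sup>2 - (\<sigma> - sg)\<^sup>2"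
    proof -
      have "n * (s\<^sub>1 - \<sigma>)\<^sup>2 - n * (s\<^sub>1 - sg)\<^sup>2 =
          n * (sb - \<sigma>)\<^sup>2 - n * (sb - sg)\<^sup>2 - 2 * n * ((s\<^sub>1 - sb) * (\<sigma> - sg))"
        by (simp add: power2_eq_square algebra_simps)
      moreover have "\<bar>2 * n * ((s\<^sub>1 - sb) * (\<sigma> - sg))\<bar> \<le> 2 * n * \<eta>\<^sub>1"
      proof -
        have "\<bar>(s\<^sub>1 - sb) * (\<sigma> - sg)\<bar> \<le> \<eta>\<^sub>1 * 1"
          unfolding abs_mult using st(1) \<sigma>1 by (intro mult_mono) auto
        then show ?thesis using n by (simp add: abs_mult mult_left_mono)
      qed
      moreover have "\<bar>Q j * t\<bar> \<le> Kq * \<eta>\<^sub>1"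
        unfolding abs_mult using Q[OF j] t st(3) by (intro mult_mono) auto
      moreover have "0 \<le> B j * t\<^sup>2" using B[OF j] by simp
      moreover have "2 * n * \<eta>\<^sub>1 + Kq * \<eta>\<^sub>1 < \<kappa>'"
      proof -
        have "(2 * n + Kq + 1) * \<eta>\<^sub>1 \<le> \<kappa>'"
          using \<eta>\<^sub>1(2) n Kq by (simp add: pos_le_divide_eq add_nonneg_pos mult.commute)
        then show ?thesis using \<eta>\<^sub>1(1) by (simp add: algebra_simps)
      qed
      ultimately show ?thesis using ge by linarith
    qed
    have \<sigma>: "\<bar>\<sigma> - sg\<bar> < \<eta>"
      using \<kappa>(2)[OF j \<sigma>1 t(1)] t st \<eta>\<^sub>1(5) close by (simp add: \<kappa>'_def)
    have t\<eta>: "t < \<eta>" "t \<le> \<delta> / (2 * L)" using t st \<eta>\<^sub>1 by auto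
    have U: "U i\<^sub>0 sg 0 - \<epsilon> \<le> U j \<sigma> t"
    proof -
      have eq: "n * (sb - \<sigma>)\<^sup>2 - n * (sb - sg)\<^sup>2 = n * (\<sigma> - sg)\<^sup>2 + p * (\<sigma> - sg)"
        unfolding p by (simp add: power2_eq_square algebra_simps)
      have "\<bar>p * (\<sigma> - sg)\<bar> \<le> (\<bar>p\<bar> + 1) * \<eta>"
        unfolding abs_mult using \<sigma> by (intro mult_mono) auto
      also have "\<dots> \<le> \<epsilon> / 2" using \<eta>(4) by (simp add: pos_le_divide_eq add_nonneg_pos algebra_simps)
      finally have "- (\<epsilon> / 2) \<le> p * (\<sigma> - sg)" by linarith
      moreover have "0 \<le> n * (\<sigma> - sg)\<^sup>2" "0 \<le> (\<sigma> - sg)\<^sup>2" using n by auto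
      moreover have "\<kappa>' \<le> \<epsilon> / 2" by (simp add: \<kappa>'_def)
      ultimately show ?thesis using close eq by linarith
    qed
    define p\<^sub>1 where "p\<^sub>1 = 2 * n * (\<sigma> - s\<^sub>1) + 2 * (\<sigma> - sg)"
    have p\<^sub>1: "\<bar>p\<^sub>1 - p\<bar> \<le> \<epsilon>"
    proof -
      have "p\<^sub>1 - p = (2 * n + 2) * (\<sigma> - sg) - 2 * n * (s\<^sub>1 - sb)"
        unfolding p\<^sub>1_def p by (simp add: algebra_simps)
      moreover have "\<bar>(2 * n + 2) * (\<sigma> - sg)\<bar> \<le> \<epsilon> / 2"
      proof -
        have "\<bar>(2 * n + 2) * (\<sigma> - sg)\<bar> \<le> (2 * n + 2) * \<eta>"
          unfolding abs_mult using \<sigma> n by (intro mult_mono) auto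
        also have "\<dots> \<le> \<epsilon> / 2" using \<eta>(3) n by (simp add: pos_le_divide_eq add_nonneg_pos algebra_simps)
        finally show ?thesis .
      qed
      moreover have "\<bar>2 * n * (s\<^sub>1 - sb)\<bar> \<le> \<epsilon> / 2"
      proof -
        have "\<bar>2 * n * (s\<^sub>1 - sb)\<bar> \<le> (2 * n + 1) * \<eta>\<^sub>1"
          unfolding abs_mult using st n by (intro mult_mono) auto
        also have "\<dots> \<le> \<epsilon> / 2" using \<eta>\<^sub>1(3) n by (simp add: pos_le_divide_eq add_nonneg_pos algebra_simps)
        finally show ?thesis .
      qed
      ultimately show ?thesis by linarith
    qed
    \<comment> \<open>Expanding
      \<open>n * (s\<^sub>1 - \<sigma>)\<^sup>2 + (\<sigma> - sg)\<^sup>2\<close> gives the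
      coefficients \<open>a\<^sub>1 = - 2 * n * s\<^sub>1 - 2 * sg\<close> and
      \<open>a\<^sub>2 = n + 1\<close> in which the locale expects a test function.\<close>
    have grad: "- 2 * n * s\<^sub>1 - 2 * sg + 2 * (n + 1) * \<sigma> = p\<^sub>1"
      by (simp add: p\<^sub>1_def algebra_simps)
    have "\<exists>a'\<in>A i. \<bar>F0 i \<sigma> t a' - F0 i sg 0 a\<bar> \<le> C\<^sub>1 * \<epsilon> \<and> \<bar>F1 i \<sigma> t a' - F1 i sg 0 a\<bar> \<le> C\<^sub>1 * \<epsilon> \<and>
        \<bar>l i \<sigma> t a' - l i sg 0 a\<bar> \<le> \<epsilon> + C\<^sub>1 * \<epsilon> \<and>
        lam * U j \<sigma> t \<le> p\<^sub>1 * F0 i \<sigma> t a' + Q i * F1 i \<sigma> t a' + l i \<sigma> t a'"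
    proof (cases "t = 0")
      case True
      define \<eta>' where "\<eta>' = min (1 - \<bar>\<sigma> - sg\<bar>) t\<^sub>1"
      have \<eta>': "0 < \<eta>'" using \<sigma> \<eta>(2) st by (simp add: \<eta>'_def)
      obtain a' where a': "a' \<in> A i" "0 \<le> F1 i \<sigma> 0 a'"
        "\<bar>F0 i \<sigma> 0 a' - F0 i sg 0 a\<bar> \<le> transfer_const * \<bar>sg - \<sigma>\<bar>"
        "\<bar>F1 i \<sigma> 0 a' - F1 i sg 0 a\<bar> \<le> transfer_const * \<bar>sg - \<sigma>\<bar>"
        "\<bar>l i \<sigma> 0 a' - l i sg 0 a\<bar> \<le> \<bar>l i \<sigma> 0 a - l i sg 0 a\<bar> + transfer_const * \<bar>sg - \<sigma>\<bar>"
        using inward_control_transfer[OF i a, of \<sigma>] by blast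
      have TC: "transfer_const * \<bar>sg - \<sigma>\<bar> \<le> C\<^sub>1 * \<epsilon>"
        using \<sigma> \<eta>(6) pos transfer_const_pos by (intro mult_mono) (auto simp: C\<^sub>1_def)
      have "\<bar>l i \<sigma> 0 a - l i sg 0 a\<bar> \<le> \<epsilon>"
        using \<eta>\<^sub>l(2)[OF a(1), of 0 0 \<sigma> sg] \<sigma> \<eta>(5) \<eta>\<^sub>l(1) by simp
      moreover have "lam * U i \<sigma> 0 - (- 2 * n * s\<^sub>1 - 2 * sg + 2 * (n + 1) * \<sigma>) * F0 i \<sigma> 0 a'
          - Q i * F1 i \<sigma> 0 a' - l i \<sigma> 0 a' \<le> 0"
      proof (rule sub_edge[where b\<^sub>2 = B, OF \<eta>' _ i a'(1,2)])
        fix j' \<sigma>' t' assume H: "j' \<in> I" "\<bar>\<sigma>' - \<sigma>\<bar> < \<eta>'" "0 \<le> t'" "t' < \<eta>'"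
        then have "\<bar>\<sigma>' - sg\<bar> \<le> 1" "t' \<le> t\<^sub>1" by (auto simp: \<eta>'_def)
        from mx[OF H(1) this(1) H(3) this(2)]
        show "U j' \<sigma>' t' - ((- 2 * n * s\<^sub>1 - 2 * sg) * \<sigma>' + (n + 1) * \<sigma>'\<^sup>2 + Q j' * t' + B j' * t'\<^sup>2)
            \<le> U j' \<sigma> 0 - ((- 2 * n * s\<^sub>1 - 2 * sg) * \<sigma> + (n + 1) * \<sigma>\<^sup>2)"
          unfolding True U_edge[OF H(1) j] by (simp add: power2_eq_square algebra_simps)
      qed
      ultimately show ?thesis
        using a' TC U_edge[OF j i, of \<sigma>] unfolding True grad
        by (intro bexI[of _ a']) auto
    next
      case False
      then have t0: "0 < t" using t by simp
      define \<eta>' where "\<eta>' = Min {1 - \<bar>\<sigma> - sg\<bar>, t\<^sub>1 - t}"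
      have \<eta>': "0 < \<eta>'" using \<sigma> \<eta>(2) t by (simp add: \<eta>'_def)
      have sub: "lam * U j \<sigma> t - p\<^sub>1 * F0 j \<sigma> t b - (Q j + 2 * B j * t) * F1 j \<sigma> t b - l j \<sigma> t b \<le> 0"
        if b: "b \<in> A j" for b
        unfolding grad[symmetric]
      proof (rule sub_interior[OF j t0 \<eta>' _ b])
        fix \<sigma>' t' assume H: "\<bar>\<sigma>' - \<sigma>\<bar> < \<eta>'" "\<bar>t' - t\<bar> < \<eta>'" "0 \<le> t'"
        then have "\<bar>\<sigma>' - sg\<bar> \<le> 1" "t' \<le> t\<^sub>1" by (auto simp: \<eta>'_def)
        from mx[OF j this(1) H(3) this(2)]
        show "U j \<sigma>' t' - ((- 2 * n * s\<^sub>1 - 2 * sg) * \<sigma>' + (n + 1) * \<sigma>'\<^sup>2 + Q j * t' + B j * t'\<^sup>2)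
            \<le> U j \<sigma> t - ((- 2 * n * s\<^sub>1 - 2 * sg) * \<sigma> + (n + 1) * \<sigma>\<^sup>2 + Q j * t + B j * t\<^sup>2)"
          by (simp add: power2_eq_square algebra_simps)
      qed
      have "\<bar>p\<^sub>1\<bar> \<le> \<bar>\<bar>p\<bar> + 1\<bar>" using p\<^sub>1 \<epsilon> by linarith
      then have "\<bar>Q j + 2 * B j * t\<bar> \<le> slope_bound (\<bar>p\<bar> + 1)"
        using normal_slope_le[OF j t(1) t\<eta>(2) sub] slope_bound_mono order_trans by blast
      moreover have "0 \<le> B j * t" using B[OF j] t by simp
      ultimately have ji: "j = i" "B i = 0" using QB[OF j] by auto
      have D: "\<bar>\<sigma> - sg\<bar> + \<bar>t - 0\<bar> \<le> 2 * \<epsilon>" using \<sigma> t\<eta> t \<eta>(6) by simp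
      have LD: "L * (\<bar>\<sigma> - sg\<bar> + \<bar>t - 0\<bar>) \<le> C\<^sub>1 * \<epsilon>"
      proof -
        have "L * (\<bar>\<sigma> - sg\<bar> + \<bar>t - 0\<bar>) \<le> L * (2 * \<epsilon>)" using D pos by (intro mult_left_mono) auto
        also have "\<dots> \<le> C\<^sub>1 * \<epsilon>" using transfer_const_pos \<epsilon> by (simp add: C\<^sub>1_def algebra_simps)
        finally show ?thesis .
      qed
      have "\<bar>l i \<sigma> t a - l i sg 0 a\<bar> \<le> \<epsilon>"
        using \<eta>\<^sub>l(2)[OF a(1), of t 0 \<sigma> sg] \<sigma> t\<eta> t \<eta>(5) by simp
      moreover have "0 \<le> C\<^sub>1 * \<epsilon>" using C\<^sub>1 \<epsilon> by simp
      ultimately show ?thesis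
        using F0_lip[OF i t(1) _ a(1), of 0 \<sigma> sg] F1_lip[OF i t(1) _ a(1), of 0 \<sigma> sg] LD sub[of a] a(1)
        unfolding ji by (intro bexI[of _ a]) auto
    qed
    then obtain a' where a': "a' \<in> A i"
      "\<bar>F0 i \<sigma> t a' - F0 i sg 0 a\<bar> \<le> C\<^sub>1 * \<epsilon>" "\<bar>F1 i \<sigma> t a' - F1 i sg 0 a\<bar> \<le> C\<^sub>1 * \<epsilon>"
      "\<bar>l i \<sigma> t a' - l i sg 0 a\<bar> \<le> \<epsilon> + C\<^sub>1 * \<epsilon>"
      "lam * U j \<sigma> t \<le> p\<^sub>1 * F0 i \<sigma> t a' + Q i * F1 i \<sigma> t a' + l i \<sigma> t a'" by blast
    have "lam * (U i sg 0 - \<epsilon>) \<le> lam * U j \<sigma> t"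
      using U pos U_edge[OF i i\<^sub>0, of sg] by (intro mult_left_mono) auto
    moreover have "p\<^sub>1 * F0 i \<sigma> t a' - p * F0 i sg 0 a \<le> \<epsilon> * M + \<bar>p\<bar> * (C\<^sub>1 * \<epsilon>)"
    proof -
      have "p\<^sub>1 * F0 i \<sigma> t a' - p * F0 i sg 0 a
          = (p\<^sub>1 - p) * F0 i \<sigma> t a' + p * (F0 i \<sigma> t a' - F0 i sg 0 a)" by (simp add: algebra_simps)
      moreover have "\<bar>(p\<^sub>1 - p) * F0 i \<sigma> t a'\<bar> \<le> \<epsilon> * M"
        unfolding abs_mult using p\<^sub>1 F0_bdd[OF i t(1) a'(1), of \<sigma>] \<epsilon> by (intro mult_mono) auto
      moreover have "\<bar>p * (F0 i \<sigma> t a' - F0 i sg 0 a)\<bar> \<le> \<bar>p\<bar> * (C\<^sub>1 * \<epsilon>)"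
        unfolding abs_mult using a'(2) by (intro mult_left_mono) auto
      ultimately show ?thesis by linarith
    qed
    moreover have "Q i * F1 i \<sigma> t a' - Q i * F1 i sg 0 a \<le> \<bar>Q i\<bar> * (C\<^sub>1 * \<epsilon>)"
    proof -
      have "\<bar>Q i * (F1 i \<sigma> t a' - F1 i sg 0 a)\<bar> \<le> \<bar>Q i\<bar> * (C\<^sub>1 * \<epsilon>)"
        unfolding abs_mult using a'(3) by (intro mult_left_mono) auto
      then show ?thesis by (simp add: right_diff_distrib)
    qed
    ultimately show ?thesis using a'(4,5) by (simp add: algebra_simps)
  qed
  then have "lam * U i sg 0 - (p * F0 i sg 0 a + Q i * F1 i sg 0 a + l i sg 0 a) \<le> 0"
    by (rule le_0_if_le_mult_eps)
  then show ?thesis by simp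
qed

text \<open>The coefficient makes the quadratic term equal to
  \<open>2 * M + n * (s - sg)\<^sup>2 + 1\<close> at height \<open>t\<close>: \<open>2 * M\<close>
  covers the oscillation of \<open>U\<close>, the middle term the penalty on the right, and 1 gives
  strictness. The slope at the edge remains \<open>q\<close>.\<close>

lemma barrier_top:
  assumes "i\<^sub>0 \<in> I" "j \<in> I" "0 < t" "0 \<le> q" "0 \<le> n"
  shows "U j \<sigma> t - n * (s - \<sigma>)\<^sup>2 - (\<sigma> - sg)\<^sup>2 - (q * t + (2 * M + n * (s - sg)\<^sup>2 + 1) / t\<^sup>2 * t\<^sup>2)
    < U i\<^sub>0 sg 0 - n * (s - sg)\<^sup>2"
proof -
  have "(2 * M + n * (s - sg)\<^sup>2 + 1) / t\<^sup>2 * t\<^sup>2 = 2 * M + n * (s - sg)\<^sup>2 + 1" using assms by simp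
  moreover have "\<bar>U j \<sigma> t\<bar> \<le> M" "\<bar>U i\<^sub>0 sg 0\<bar> \<le> M" using U_bdd assms by auto
  moreover have "0 \<le> q * t" "0 \<le> n * (s - \<sigma>)\<^sup>2" "0 \<le> (\<sigma> - sg)\<^sup>2" using assms by auto
  ultimately show ?thesis by linarith
qed

lemma slope_bound_nonneg: "0 \<le> slope_bound p"
  unfolding slope_bound_def using pos by simp

text \<open>With a slope beyond the coercivity bound in every branch the maximum in
  \<open>edge_sub_limit\<close> can only sit on the edge. This provides the first admissible slope
  in \<open>edge_estimate\<close>.\<close>

lemma edge_large_slope:
  assumes i\<^sub>0: "i\<^sub>0 \<in> I" and n: "0 \<le> n"
    and max: "\<And>\<sigma>. U i\<^sub>0 \<sigma> 0 - n * (sb - \<sigma>)\<^sup>2 \<le> U i\<^sub>0 sg 0 - n * (sb - sg)\<^sup>2"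
    and p: "p = 2 * n * (sg - sb)"
    and i: "i \<in> I" and a: "a \<in> A i" "0 \<le> F1 i sg 0 a"
  shows "lam * U i sg 0 \<le> p * F0 i sg 0 a + (slope_bound (\<bar>p\<bar> + 1) + 1) * F1 i sg 0 a + l i sg 0 a"
proof (rule edge_sub_limit[where Q = "\<lambda>_. slope_bound (\<bar>p\<bar> + 1) + 1"
      and Kq = "\<bar>slope_bound (\<bar>p\<bar> + 1) + 1\<bar>", OF i\<^sub>0 n max p _ _ i a])
  fix \<eta> :: real assume \<eta>: "0 < \<eta>"
  define B where "B = (\<lambda>j :: 'i. (2 * M + n * (sb - sg)\<^sup>2 + 1) / (\<eta> / 2)\<^sup>2)"
  have "0 \<le> B j" for j using pos n by (auto simp: B_def intro!: divide_nonneg_nonneg add_nonneg_nonneg)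
  moreover have "U j \<sigma> (\<eta> / 2) - n * (sb - \<sigma>)\<^sup>2 - (\<sigma> - sg)\<^sup>2
      - ((slope_bound (\<bar>p\<bar> + 1) + 1) * (\<eta> / 2) + B j * (\<eta> / 2)\<^sup>2) < U i\<^sub>0 sg 0 - n * (sb - sg)\<^sup>2"
    if "j \<in> I" for j \<sigma>
    unfolding B_def using barrier_top[OF i\<^sub>0 that] \<eta> n slope_bound_nonneg
    by (simp only: half_gt_zero add_nonneg_nonneg zero_le_one)
  ultimately show "\<exists>s\<^sub>1 t\<^sub>1 B. \<bar>s\<^sub>1 - sb\<bar> < \<eta> \<and> 0 < t\<^sub>1 \<and> t\<^sub>1 < \<eta> \<and>
      (\<forall>j\<in>I. 0 \<le> B j \<and> (slope_bound (\<bar>p\<bar> + 1) + 1 \<ge> slope_bound (\<bar>p\<bar> + 1) + 1 \<or> j = i \<and> B j = 0) \<and>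
        (\<forall>\<sigma>. \<bar>\<sigma> - sg\<bar> \<le> 1 \<longrightarrow>
          U j \<sigma> t\<^sub>1 - n * (s\<^sub>1 - \<sigma>)\<^sup>2 - (\<sigma> - sg)\<^sup>2 - ((slope_bound (\<bar>p\<bar> + 1) + 1) * t\<^sub>1 + B j * t\<^sub>1\<^sup>2)
          < U i\<^sub>0 sg 0 - n * (s\<^sub>1 - sg)\<^sup>2))"
    using \<eta> by (intro exI[of _ sb] exI[of _ "\<eta> / 2"] exI[of _ B]) simp
qed simp

text \<open>If the growth failed at points \<open>(s, t)\<close> arbitrarily close to
  \<open>(sb, 0)\<close>, each such \<open>t\<close> could be the top of the box in
  \<open>edge_sub_limit\<close>, with slope \<open>q\<close> and no quadratic term in branch
  \<open>i\<close> and a steep barrier in the others. The limit would give the inequality that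
  \<open>a\<close> violates. The failure may occur only at some \<open>s\<close> next to
  \<open>sb\<close>, which is why \<open>edge_sub_limit\<close> lets its centre
  \<open>s\<^sub>1\<close> vary.\<close>

lemma edge_slope_below:
  assumes i\<^sub>0: "i\<^sub>0 \<in> I" and n: "0 \<le> n"
    and max: "\<And>\<sigma>. U i\<^sub>0 \<sigma> 0 - n * (sb - \<sigma>)\<^sup>2 \<le> U i\<^sub>0 sg 0 - n * (sb - sg)\<^sup>2"
    and p: "p = 2 * n * (sg - sb)"
    and i: "i \<in> I" and a: "a \<in> A i" "0 \<le> F1 i sg 0 a"
      "\<not> lam * U i sg 0 \<le> p * F0 i sg 0 a + q * F1 i sg 0 a + l i sg 0 a"
  shows "\<exists>\<eta>>0. \<forall>s t. \<bar>s - sb\<bar> < \<eta> \<longrightarrow> 0 < t \<longrightarrow> t < \<eta> \<longrightarrow>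
    (\<exists>\<sigma>. U i\<^sub>0 sg 0 - n * (s - sg)\<^sup>2 + q * t \<le> U i \<sigma> t - n * (s - \<sigma>)\<^sup>2)"
proof (rule ccontr)
  assume neg: "\<not> ?thesis"
  define K where "K = slope_bound (\<bar>p\<bar> + 1) + 1"
  have K: "0 \<le> K" using slope_bound_nonneg by (simp add: K_def add_nonneg_nonneg)
  define Q where "Q j = (if j = i then q else K)" for j
  have "lam * U i sg 0 \<le> p * F0 i sg 0 a + Q i * F1 i sg 0 a + l i sg 0 a"
  proof (rule edge_sub_limit[where Q = Q and Kq = "\<bar>q\<bar> + K", OF i\<^sub>0 n max p _ _ i a(1,2)])
    show "\<bar>Q j\<bar> \<le> \<bar>q\<bar> + K" for j using K by (simp add: Q_def)
    fix \<eta> :: real assume \<eta>: "0 < \<eta>"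
    with neg obtain s t where st: "\<bar>s - sb\<bar> < \<eta>" "0 < t" "t < \<eta>"
      and less: "\<And>\<sigma>. U i \<sigma> t - n * (s - \<sigma>)\<^sup>2 < U i\<^sub>0 sg 0 - n * (s - sg)\<^sup>2 + q * t"
      by (auto simp: not_le)
    define B where "B j = (if j = i then 0 else (2 * M + n * (s - sg)\<^sup>2 + 1) / t\<^sup>2)" for j
    have "0 \<le> B j" for j using pos n by (auto simp: B_def intro!: divide_nonneg_nonneg add_nonneg_nonneg)
    moreover have "Q j \<ge> slope_bound (\<bar>p\<bar> + 1) + 1 \<or> j = i \<and> B j = 0" for j
      by (simp add: Q_def B_def K_def)
    moreover have "U j \<sigma> t - n * (s - \<sigma>)\<^sup>2 - (\<sigma> - sg)\<^sup>2 - (Q j * t + B j * t\<^sup>2) < U i\<^sub>0 sg 0 - n * (s - sg)\<^sup>2"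
      if j: "j \<in> I" for j \<sigma>
    proof (cases "j = i")
      case True
      have "0 \<le> (\<sigma> - sg)\<^sup>2" by simp
      then have "U i \<sigma> t - n * (s - \<sigma>)\<^sup>2 - (\<sigma> - sg)\<^sup>2 - (q * t + 0 * t\<^sup>2) < U i\<^sub>0 sg 0 - n * (s - sg)\<^sup>2"
        using less[of \<sigma>] by linarith
      then show ?thesis using True by (simp add: Q_def B_def)
    next
      case False
      then show ?thesis unfolding Q_def B_def
        using barrier_top[OF i\<^sub>0 j st(2) K n, of \<sigma> s sg] by simp
    qed
    ultimately show "\<exists>s\<^sub>1 t\<^sub>1 B. \<bar>s\<^sub>1 - sb\<bar> < \<eta> \<and> 0 < t\<^sub>1 \<and> t\<^sub>1 < \<eta> \<and>
      (\<forall>j\<in>I. 0 \<le> B j \<and> (Q j \<ge> slope_bound (\<bar>p\<bar> + 1) + 1 \<or> j = i \<and> B j = 0) \<and>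
        (\<forall>\<sigma>. \<bar>\<sigma> - sg\<bar> \<le> 1 \<longrightarrow>
          U j \<sigma> t\<^sub>1 - n * (s\<^sub>1 - \<sigma>)\<^sup>2 - (\<sigma> - sg)\<^sup>2 - (Q j * t\<^sub>1 + B j * t\<^sub>1\<^sup>2)
          < U i\<^sub>0 sg 0 - n * (s\<^sub>1 - sg)\<^sup>2))"
      using st by (intro exI[of _ s] exI[of _ t] exI[of _ B]) simp
  qed
  then show False using a(3) by (simp add: Q_def)
qed

section \<open>Comparison at a maximum on the edge\<close>

definition edge_const :: real where
  "edge_const = 1 + M + transfer_const * (4 + 2 / \<delta> * (lam * M + 4 * M))"

lemma edge_estimate:
  assumes i\<^sub>0: "i\<^sub>0 \<in> I" and n: "1 \<le> n" and \<beta>: "0 < \<beta>" and \<epsilon>: "0 < \<epsilon>" "\<epsilon> \<le> 1"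
    and gmax: "\<And>j \<sigma> s t. j \<in> I \<Longrightarrow> 0 \<le> t \<Longrightarrow> U j \<sigma> t - V j s t - n * (s - \<sigma>)\<^sup>2 - \<beta> * (s\<^sup>2 + t\<^sup>2)
        \<le> U i\<^sub>0 sg 0 - V i\<^sub>0 sb 0 - n * (sb - sg)\<^sup>2 - \<beta> * sb\<^sup>2"
    and small: "n * (sb - sg)\<^sup>2 \<le> \<epsilon>\<^sup>2" and b: "\<beta> * \<bar>sb\<bar> \<le> b"
    and l: "\<And>i a. i \<in> I \<Longrightarrow> a \<in> A i \<Longrightarrow> \<bar>l i sg 0 a - l i sb 0 a\<bar> \<le> \<zeta>"
  shows "lam * (U i\<^sub>0 sg 0 - V i\<^sub>0 sb 0)
    \<le> edge_const * \<epsilon> + 2 * b * M + \<zeta>"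
proof -
  define p where "p = 2 * n * (sg - sb)"
  define K where "K = slope_bound (\<bar>p\<bar> + 1) + 1"
  have n0: "0 \<le> n" using n by simp
  have max: "U i\<^sub>0 \<sigma> 0 - n * (sb - \<sigma>)\<^sup>2 \<le> U i\<^sub>0 sg 0 - n * (sb - sg)\<^sup>2" for \<sigma>
    using gmax[OF i\<^sub>0, of 0 \<sigma> sb] by simp
  \<comment> \<open>The admissible normal slopes of branch \<open>i\<close>. The set contains
    \<open>K\<close>, and the control of normal speed \<delta> bounds it below by
    \<open>- K\<close>, so the infimum is finite and at most \<open>K\<close> in absolute
    value.\<close>
  define G where "G i = {q. \<forall>a\<in>A i. 0 \<le> F1 i sg 0 a \<longrightarrow>
      lam * U i sg 0 \<le> p * F0 i sg 0 a + q * F1 i sg 0 a + l i sg 0 a}" for i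
  define q where "q i = Inf (G i)" for i
  have KG: "K \<in> G i" if "i \<in> I" for i
    unfolding G_def K_def using edge_large_slope[OF i\<^sub>0 n0 max p_def that] by blast
  have lower: "- K \<le> q'" if i: "i \<in> I" and q': "q' \<in> G i" for i q'
  proof -
    obtain a where a: "a \<in> A i" "F1 i sg 0 a = \<delta>"
      using controllable[OF i, of \<delta> sg] pos by auto
    have "lam * U i sg 0 \<le> p * F0 i sg 0 a + q' * \<delta> + l i sg 0 a"
      using q' a pos unfolding G_def by auto
    moreover have "lam * (- M) \<le> lam * U i sg 0"
      using U_bdd[OF i, of 0 sg] pos by (intro mult_left_mono) auto
    moreover have "\<bar>p * F0 i sg 0 a\<bar> \<le> M * \<bar>p\<bar>"
      unfolding abs_mult using mult_left_mono[OF F0_bdd[OF i _ a(1), of 0 sg], of "\<bar>p\<bar>"]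
      by (simp add: mult.commute)
    moreover have "\<bar>l i sg 0 a\<bar> \<le> M" using l_bdd[OF i _ a(1), of 0 sg] by simp
    ultimately have "- (lam * M + M + M * \<bar>p\<bar>) \<le> q' * \<delta>" by linarith
    then have "- slope_bound p / 2 \<le> q'" using pos by (simp add: slope_bound_def field_simps)
    moreover have "slope_bound p \<le> slope_bound (\<bar>p\<bar> + 1)" by (rule slope_bound_mono) simp
    ultimately show ?thesis using slope_bound_nonneg[of p] by (simp add: K_def)
  qed
  have bdd: "bdd_below (G i)" if "i \<in> I" for i using lower[OF that] by (rule bdd_belowI)
  have qK: "\<bar>q i\<bar> \<le> K" if "i \<in> I" for i
  proof -
    have "q i \<le> K" unfolding q_def by (rule cInf_lower[OF KG[OF that] bdd[OF that]])
    moreover have "- K \<le> q i" unfolding q_def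
      using KG[OF that] lower[OF that] by (intro cInf_greatest) auto
    ultimately show ?thesis by simp
  qed
  \<comment> \<open>The infimum is itself admissible: a control of normal speed 0 gives a condition
    free of the slope, and one of positive speed gives a lower bound on the slope, which passes to
    the infimum.\<close>
  have qG: "lam * U i sg 0 \<le> p * F0 i sg 0 a + q i * F1 i sg 0 a + l i sg 0 a"
    if i: "i \<in> I" and a: "a \<in> A i" "0 \<le> F1 i sg 0 a" for i a
  proof (cases "F1 i sg 0 a = 0")
    case True
    then show ?thesis using KG[OF i] a by (auto simp: G_def)
  next
    case False
    then have F: "0 < F1 i sg 0 a" using a by simp
    have "(lam * U i sg 0 - p * F0 i sg 0 a - l i sg 0 a) / F1 i sg 0 a \<le> q i" unfolding q_def
    proof (rule cInf_greatest)
      show "G i \<noteq> {}" using KG[OF i] by auto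
      fix q' assume "q' \<in> G i"
      then have "lam * U i sg 0 \<le> p * F0 i sg 0 a + q' * F1 i sg 0 a + l i sg 0 a"
        using a by (simp add: G_def)
      then show "(lam * U i sg 0 - p * F0 i sg 0 a - l i sg 0 a) / F1 i sg 0 a \<le> q'"
        using F by (simp add: pos_divide_le_eq)
    qed
    then show ?thesis using F by (simp add: pos_divide_le_eq)
  qed
  have "\<exists>\<eta>>0. \<forall>s t. \<bar>s - sb\<bar> < \<eta> \<longrightarrow> 0 < t \<longrightarrow> t < \<eta> \<longrightarrow>
      (\<exists>\<sigma>. U i\<^sub>0 sg 0 - n * (s - sg)\<^sup>2 + (q i - \<epsilon>) * t \<le> U i \<sigma> t - n * (s - \<sigma>)\<^sup>2)"
    if i: "i \<in> I" for i
  proof -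
    have "q i - \<epsilon> \<notin> G i"
      using cInf_lower[of "q i - \<epsilon>" "G i"] bdd[OF i] \<epsilon> unfolding q_def by auto
    then obtain a where "a \<in> A i" "0 \<le> F1 i sg 0 a"
      "\<not> lam * U i sg 0 \<le> p * F0 i sg 0 a + (q i - \<epsilon>) * F1 i sg 0 a + l i sg 0 a"
      unfolding G_def by blast
    then show ?thesis by (rule edge_slope_below[OF i\<^sub>0 n0 max p_def i])
  qed
  then obtain \<eta> where \<eta>: "\<And>i. i \<in> I \<Longrightarrow> 0 < \<eta> i" "\<And>i s t. i \<in> I \<Longrightarrow> \<bar>s - sb\<bar> < \<eta> i \<Longrightarrow> 0 < t \<Longrightarrow> t < \<eta> i \<Longrightarrow>
      \<exists>\<sigma>. U i\<^sub>0 sg 0 - n * (s - sg)\<^sup>2 + (q i - \<epsilon>) * t \<le> U i \<sigma> t - n * (s - \<sigma>)\<^sup>2" by metis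
  define h where "h = Min (\<eta> ` I)"
  have h: "0 < h" "\<And>i. i \<in> I \<Longrightarrow> h \<le> \<eta> i" unfolding h_def using I \<eta>(1) by auto
  \<comment> \<open>By \<open>gmax\<close>, \<open>V j s t\<close> is at least \<open>U j \<sigma> t
    - n * (s - \<sigma>)\<^sup>2 - \<beta> * (s\<^sup>2 + t\<^sup>2)\<close> minus the maximal
    value, for every \<sigma>. Choosing the \<sigma> that realises the growth of slope
    \<open>q j - \<epsilon>\<close> removes \<sigma> from the bound and leaves a quadratic function
    touching \<open>V\<close> from below at \<open>(sb, 0)\<close>.\<close>
  have "\<exists>i\<in>I. \<exists>a\<in>A i. 0 \<le> F1 i sb 0 a \<and>
     - \<epsilon> \<le> lam * V i sb 0 - (2 * n * sg + 2 * - (n + \<beta>) * sb) * F0 i sb 0 a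
            - (q i - \<epsilon>) * F1 i sb 0 a - l i sb 0 a"
  proof (rule super_edge[where b\<^sub>2 = "\<lambda>_. - \<beta>", OF h(1) _ \<epsilon>(1)])
    fix j s t assume j: "j \<in> I" and st: "\<bar>s - sb\<bar> < h" "0 \<le> t" "t < h"
    have "\<exists>\<sigma>. U i\<^sub>0 sg 0 - n * (s - sg)\<^sup>2 + (q j - \<epsilon>) * t \<le> U j \<sigma> t - n * (s - \<sigma>)\<^sup>2"
    proof (cases "t = 0")
      case True
      then show ?thesis using U_edge[OF j i\<^sub>0, of sg] by (intro exI[of _ sg]) simp
    next
      case False
      then show ?thesis using \<eta>(2)[OF j, of s t] h(2)[OF j] st by simp
    qed
    then obtain \<sigma> where "U i\<^sub>0 sg 0 - n * (s - sg)\<^sup>2 + (q j - \<epsilon>) * t \<le> U j \<sigma> t - n * (s - \<sigma>)\<^sup>2" ..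
    then show "V j sb 0 - (2 * n * sg * sb + - (n + \<beta>) * sb\<^sup>2)
        \<le> V j s t - (2 * n * sg * s + - (n + \<beta>) * s\<^sup>2 + (q j - \<epsilon>) * t + - \<beta> * t\<^sup>2)"
      using gmax[OF j st(2), of \<sigma> s] V_edge[OF j i\<^sub>0, of sb]
      by (simp add: power2_eq_square algebra_simps)
  qed
  then obtain i a where i: "i \<in> I" and a: "a \<in> A i" "0 \<le> F1 i sb 0 a"
    and sup: "- \<epsilon> \<le> lam * V i sb 0 - (p - 2 * \<beta> * sb) * F0 i sb 0 a
        - (q i - \<epsilon>) * F1 i sb 0 a - l i sb 0 a"
    unfolding p_def by (auto simp: algebra_simps)
  define x where "x = \<bar>sb - sg\<bar>"
  define T where "T = transfer_const"
  have T: "0 < T" unfolding T_def by (rule transfer_const_pos)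
  \<comment> \<open>The supersolution supplies a control that is inward at \<open>sb\<close>,
    whereas \<open>qG\<close> needs one that is inward at \<open>sg\<close>.\<close>
  obtain a' where a': "a' \<in> A i" "0 \<le> F1 i sg 0 a'"
    "\<bar>F0 i sg 0 a' - F0 i sb 0 a\<bar> \<le> T * x" "\<bar>F1 i sg 0 a' - F1 i sb 0 a\<bar> \<le> T * x"
    "\<bar>l i sg 0 a' - l i sb 0 a\<bar> \<le> \<bar>l i sg 0 a - l i sb 0 a\<bar> + T * x"
    using inward_control_transfer[OF i a, of sg] unfolding x_def T_def by blast
  have x: "0 \<le> x" "x \<le> \<epsilon>" "\<bar>p\<bar> * x \<le> 2 * \<epsilon>"
  proof -
    show "0 \<le> x" by (simp add: x_def)
    have sq: "n * x\<^sup>2 \<le> \<epsilon>\<^sup>2" using small by (simp add: x_def)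
    moreover have "1 * x\<^sup>2 \<le> n * x\<^sup>2" using n by (intro mult_right_mono) auto
    ultimately have "x\<^sup>2 \<le> \<epsilon>\<^sup>2" by simp
    then show "x \<le> \<epsilon>" using \<epsilon> by (simp add: power2_le_iff_abs_le)
    have "\<bar>p\<bar> * x = 2 * (n * x\<^sup>2)"
      using n0 by (simp add: p_def x_def abs_mult power2_eq_square abs_minus_commute)
    also have "\<dots> \<le> 2 * \<epsilon>\<^sup>2" using sq by simp
    also have "\<dots> \<le> 2 * \<epsilon>" using \<epsilon> by (simp add: power2_eq_square mult_left_le)
    finally show "\<bar>p\<bar> * x \<le> 2 * \<epsilon>" .
  qed
  \<comment> \<open>\<open>K\<close> grows linearly in \<open>\<bar>p\<bar>\<close>, which need not
    stay bounded as \<open>n\<close> grows; but \<open>\<bar>p\<bar> * x\<close> is twice the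
    tangential penalty, so the product is still of order \<epsilon>.\<close>
  have Kx: "K * x \<le> (2 / \<delta> * (lam * M + 4 * M) + 1) * \<epsilon>"
  proof -
    define k where "k = 2 / \<delta>"
    have k: "0 \<le> k" using pos by (simp add: k_def)
    have "K * x = k * (lam * M + 2 * M) * x + k * M * (\<bar>p\<bar> * x) + x"
      by (simp add: K_def slope_bound_def k_def algebra_simps)
    also have "\<dots> \<le> k * (lam * M + 2 * M) * \<epsilon> + k * M * (2 * \<epsilon>) + \<epsilon>"
      using x k pos by (intro add_mono mult_left_mono) auto
    finally show ?thesis by (simp add: k_def algebra_simps)
  qed
  have "lam * (U i\<^sub>0 sg 0 - V i\<^sub>0 sb 0) = lam * U i sg 0 - lam * V i sb 0"
    using U_edge[OF i i\<^sub>0, of sg] V_edge[OF i i\<^sub>0, of sb] by (simp add: algebra_simps)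
  also have "\<dots> \<le> (p * F0 i sg 0 a' + q i * F1 i sg 0 a' + l i sg 0 a')
      - ((p - 2 * \<beta> * sb) * F0 i sb 0 a + (q i - \<epsilon>) * F1 i sb 0 a + l i sb 0 a) + \<epsilon>"
    using qG[OF i a'(1,2)] sup by linarith
  also have "\<dots> = p * (F0 i sg 0 a' - F0 i sb 0 a) + q i * (F1 i sg 0 a' - F1 i sb 0 a)
      + (l i sg 0 a' - l i sb 0 a) + 2 * (\<beta> * sb * F0 i sb 0 a) + \<epsilon> * F1 i sb 0 a + \<epsilon>"
    by (simp add: algebra_simps)
  also have "\<dots> \<le> T * (2 * \<epsilon>) + T * ((2 / \<delta> * (lam * M + 4 * M) + 1) * \<epsilon>)
      + (\<zeta> + T * \<epsilon>) + 2 * (b * M) + \<epsilon> * M + \<epsilon>"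
  proof -
    have "p * (F0 i sg 0 a' - F0 i sb 0 a) \<le> \<bar>p\<bar> * \<bar>F0 i sg 0 a' - F0 i sb 0 a\<bar>"
      by (metis abs_ge_self abs_mult)
    also have "\<dots> \<le> \<bar>p\<bar> * (T * x)" using a' by (intro mult_left_mono) auto
    also have "\<dots> = T * (\<bar>p\<bar> * x)" by simp
    also have "\<dots> \<le> T * (2 * \<epsilon>)" using x T by (intro mult_left_mono) auto
    finally have 1: "p * (F0 i sg 0 a' - F0 i sb 0 a) \<le> T * (2 * \<epsilon>)" .
    have "q i * (F1 i sg 0 a' - F1 i sb 0 a) \<le> \<bar>q i\<bar> * \<bar>F1 i sg 0 a' - F1 i sb 0 a\<bar>"
      by (metis abs_ge_self abs_mult)
    also have "\<dots> \<le> K * (T * x)" using a' qK[OF i] by (intro mult_mono) auto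
    also have "\<dots> = T * (K * x)" by simp
    also have "\<dots> \<le> T * ((2 / \<delta> * (lam * M + 4 * M) + 1) * \<epsilon>)"
      using Kx T by (intro mult_left_mono) auto
    finally have 2: "q i * (F1 i sg 0 a' - F1 i sb 0 a) \<le> T * ((2 / \<delta> * (lam * M + 4 * M) + 1) * \<epsilon>)" .
    have "T * x \<le> T * \<epsilon>" using x T by (intro mult_left_mono) auto
    then have 3: "l i sg 0 a' - l i sb 0 a \<le> \<zeta> + T * \<epsilon>" using a'(5) l[OF i a(1)] by linarith
    have "\<beta> * sb * F0 i sb 0 a \<le> \<bar>\<beta> * sb\<bar> * \<bar>F0 i sb 0 a\<bar>" by (metis abs_ge_self abs_mult)
    also have "\<dots> \<le> b * M"
      using b \<beta> F0_bdd[OF i _ a(1), of 0 sb] by (intro mult_mono) (auto simp: abs_mult intro: order_trans[OF _ b])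
    finally have 4: "\<beta> * sb * F0 i sb 0 a \<le> b * M" .
    have "F1 i sb 0 a \<le> M" using F1_bdd[OF i _ a(1), of 0 sb] by simp
    then have 5: "\<epsilon> * F1 i sb 0 a \<le> \<epsilon> * M" using \<epsilon> by (intro mult_left_mono) auto
    show ?thesis using 1 2 3 4 5 by linarith
  qed
  also have "\<dots> = edge_const * \<epsilon> + 2 * b * M + \<zeta>"
    by (simp add: edge_const_def T_def algebra_simps)
  finally show ?thesis .
qed

section \<open>Comparison at a maximum off the edge\<close>

definition interior_const :: "real \<Rightarrow> real" where
  "interior_const R = 1 + 4 * L * R
    + L * R * (2 * (2 / \<delta> * (lam * M + M)) + 4 * (2 / \<delta> * M) + 16 * L / \<delta>)
    + M * (2 / \<delta> * (lam * M + M) + 2 * (2 / \<delta> * M) + 8 * L / \<delta>)"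

text \<open>As a function of the point of \<open>v\<close> the penalty has the normal coordinate in
  the denominator, while the locale tests with quadratic polynomials only. The right-hand side is
  such a polynomial and agrees with the penalty at \<open>t' = t\<close> to first order, so it
  yields the same normal slope there.\<close>

lemma inverse_square_taylor:
  fixes r t t' :: real
  assumes t: "0 < t" "t / 2 \<le> t'" and r: "0 \<le> r" "r \<le> 2"
  shows "(t * r / t' - 1)\<^sup>2 \<le> (r - 1)\<^sup>2 - 2 * (r - 1) * r / t * (t' - t) + 32 / t\<^sup>2 * (t' - t)\<^sup>2"
proof -
  define x where "x = (t' - t) / t"
  have x: "- 1 / 2 \<le> x" "t' = t * (1 + x)" using t by (auto simp: x_def field_simps)
  define y where "y = 1 / (1 + x)"
  have y: "0 < y" "y \<le> 2" "y * (1 + x) = 1" using x by (auto simp: y_def field_simps)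
  \<comment> \<open>Exact Taylor formulas for \<open>1 / (1 + x)\<close> and its square, with the
    remainders expressed through \<open>y\<close>. As \<open>y \<le> 2\<close>, the remainder of the
    square is at most \<open>8 * x\<^sup>2\<close>; the factor \<open>r\<^sup>2 \<le> 4\<close>
    turns 8 into 32.\<close>
  have y1: "y = 1 - x + x\<^sup>2 * y"
    using y(3) by (simp add: power2_eq_square) algebra
  have "y\<^sup>2 = 1 - 2 * x + x\<^sup>2 * (3 + 2 * x) * y\<^sup>2"
    using y(3) by algebra
  moreover have "x\<^sup>2 * (3 + 2 * x) * y\<^sup>2 \<le> x\<^sup>2 * 8"
  proof -
    have "(3 + 2 * x) * y\<^sup>2 = 2 * y + y\<^sup>2" using y(3) by algebra
    also have "\<dots> \<le> 2 * 2 + 2\<^sup>2" using y by (intro add_mono power_mono) auto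
    finally show ?thesis unfolding mult.assoc by (intro mult_left_mono) auto
  qed
  ultimately have y2: "y\<^sup>2 \<le> 1 - 2 * x + 8 * x\<^sup>2" by simp
  have "(r * y - 1)\<^sup>2 = r\<^sup>2 * y\<^sup>2 - 2 * r * y + 1" by (simp add: power2_eq_square algebra_simps)
  also have "\<dots> \<le> r\<^sup>2 * (1 - 2 * x + 8 * x\<^sup>2) - 2 * r * (1 - x) + 1"
  proof -
    have "1 - x \<le> y" using y1 y(1) by (smt (verit) mult_nonneg_nonneg zero_le_power2)
    then have "2 * r * (1 - x) \<le> 2 * r * y" using r by (intro mult_left_mono) auto
    moreover have "r\<^sup>2 * y\<^sup>2 \<le> r\<^sup>2 * (1 - 2 * x + 8 * x\<^sup>2)" using y2 by (intro mult_left_mono) auto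
    ultimately show ?thesis by linarith
  qed
  also have "\<dots> = (r - 1)\<^sup>2 - 2 * (r - 1) * r * x + 8 * r\<^sup>2 * x\<^sup>2"
    by (simp add: power2_eq_square algebra_simps)
  also have "8 * r\<^sup>2 * x\<^sup>2 \<le> 8 * 2\<^sup>2 * x\<^sup>2"
    using r by (intro mult_right_mono mult_left_mono power_mono) auto
  finally have "(r * y - 1)\<^sup>2 \<le> (r - 1)\<^sup>2 - 2 * (r - 1) * r * x + 32 * x\<^sup>2" by simp
  moreover have "t * r / t' = r * y" using t(1) x by (simp add: y_def)
  ultimately show ?thesis by (simp add: x_def power_divide)
qed

text \<open>The penalty depends on the normal coordinates \<open>\<tau> = t r\<close> and \<open>t\<close> only through their ratio \<open>r\<close>.
  Hence the normal slopes of the two test functions differ by the factor \<open>r\<close>, and the maximum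
  cannot have exactly one of its two points on the edge.\<close>

lemma interior_estimate:
  assumes i: "i \<in> I" and n: "1 \<le> n" and \<beta>: "0 < \<beta>" and \<epsilon>: "0 < \<epsilon>" "\<epsilon> \<le> 1 / 4"
    and tb: "0 < tb" "tb \<le> R" and R: "1 \<le> R"
    and gmax: "\<And>\<sigma> s t r. 0 \<le> t \<Longrightarrow> 1 / 2 \<le> r \<Longrightarrow> r \<le> 2 \<Longrightarrow>
        U i \<sigma> (t * r) - V i s t - n * ((s - \<sigma>)\<^sup>2 + (r - 1)\<^sup>2) - \<beta> * (s\<^sup>2 + t\<^sup>2)
        \<le> U i sg (tb * rb) - V i sb tb - n * ((sb - sg)\<^sup>2 + (rb - 1)\<^sup>2) - \<beta> * (sb\<^sup>2 + tb\<^sup>2)"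
    and small: "n * ((sb - sg)\<^sup>2 + (rb - 1)\<^sup>2) \<le> \<epsilon>\<^sup>2" and b: "\<beta> * (\<bar>sb\<bar> + tb) \<le> b"
    and l: "\<And>a. a \<in> A i \<Longrightarrow> \<bar>l i sg (tb * rb) a - l i sb tb a\<bar> \<le> \<zeta>"
  shows "lam * (U i sg (tb * rb) - V i sb tb) \<le> interior_const R * \<epsilon> + 2 * b * M + \<zeta>"
proof -
  define x where "x = \<bar>sb - sg\<bar>"
  define y where "y = \<bar>rb - 1\<bar>"
  have xy0: "0 \<le> x" "0 \<le> y" by (auto simp: x_def y_def)
  have sum: "n * x\<^sup>2 + n * y\<^sup>2 \<le> \<epsilon>\<^sup>2" using small by (simp add: x_def y_def algebra_simps)
  have nn: "0 \<le> n * x\<^sup>2" "0 \<le> n * y\<^sup>2" "x\<^sup>2 \<le> n * x\<^sup>2" "y\<^sup>2 \<le> n * y\<^sup>2"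
    using n mult_right_mono[of 1 n "x\<^sup>2"] mult_right_mono[of 1 n "y\<^sup>2"] by auto
  have "\<epsilon>\<^sup>2 \<le> 1 * \<epsilon>" unfolding power2_eq_square using \<epsilon> by (intro mult_right_mono) auto
  then have nx: "n * x\<^sup>2 \<le> \<epsilon>" and ny: "n * y\<^sup>2 \<le> \<epsilon>" using sum nn by auto
  have "x\<^sup>2 \<le> \<epsilon>\<^sup>2" "y\<^sup>2 \<le> \<epsilon>\<^sup>2" using sum nn by linarith+
  then have x: "x \<le> \<epsilon>" and y: "y \<le> \<epsilon>" using \<epsilon> xy0 by (auto simp: power2_le_iff_abs_le)
  have nxy: "n * (x * y) \<le> \<epsilon>"
  proof -
    have "0 \<le> n * (x - y)\<^sup>2" using n by simp
    then have "2 * (n * (x * y)) \<le> n * x\<^sup>2 + n * y\<^sup>2" by (simp add: power2_eq_square algebra_simps)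
    then show ?thesis using nx ny by linarith
  qed
  have rb: "3 / 4 \<le> rb" "rb \<le> 5 / 4" using y \<epsilon> by (auto simp: y_def)
  define \<tau> where "\<tau> = tb * rb"
  have \<tau>: "0 < \<tau>" using tb rb by (simp add: \<tau>_def)
  define p where "p = 2 * n * (sg - sb)"
  define q where "q = 2 * n * (rb - 1) / tb"
  have tb4: "0 < tb / 4" using tb by simp
  \<comment> \<open>With \<open>tb\<close> fixed the penalty is quadratic in the normal coordinate
    of \<open>u\<close>, so it serves as a test function directly. The radius \<open>tb / 4\<close>
    changes the ratio by less than 1/4, which keeps it in the range of \<open>gmax\<close> because
    \<open>rb\<close> is between 3/4 and 5/4.\<close>
  have sub: "lam * U i sg \<tau> - p * F0 i sg \<tau> a - q * F1 i sg \<tau> a - l i sg \<tau> a \<le> 0" if a: "a \<in> A i" for a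
  proof -
    have "lam * U i sg \<tau> - (- 2 * n * sb + 2 * n * sg) * F0 i sg \<tau> a
        - (- 2 * n / tb + 2 * (n / tb\<^sup>2) * \<tau>) * F1 i sg \<tau> a - l i sg \<tau> a \<le> 0"
    proof (rule sub_interior[OF i \<tau> tb4 _ a])
      fix \<sigma> t' assume H: "\<bar>\<sigma> - sg\<bar> < tb / 4" "\<bar>t' - \<tau>\<bar> < tb / 4" "0 \<le> t'"
      define r where "r = t' / tb"
      have t': "t' = tb * r" using tb by (simp add: r_def)
      have "\<bar>t' - \<tau>\<bar> = tb * \<bar>r - rb\<bar>"
        using tb by (simp add: t' \<tau>_def abs_mult flip: right_diff_distrib)
      then have "\<bar>r - rb\<bar> < 1 / 4" using H(2) tb by simp
      then have r: "1 / 2 \<le> r" "r \<le> 2" using rb by linarith+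
      have eq: "n / tb\<^sup>2 * (tb * r)\<^sup>2 + - 2 * n / tb * (tb * r) = n * (r - 1)\<^sup>2 - n" for r
        using tb by (simp add: power2_eq_square algebra_simps)
      show "U i \<sigma> t' - (- 2 * n * sb * \<sigma> + n * \<sigma>\<^sup>2 + - 2 * n / tb * t' + n / tb\<^sup>2 * t'\<^sup>2)
          \<le> U i sg \<tau> - (- 2 * n * sb * sg + n * sg\<^sup>2 + - 2 * n / tb * \<tau> + n / tb\<^sup>2 * \<tau>\<^sup>2)"
        using gmax[OF less_imp_le[OF tb(1)] r, of \<sigma> sb] eq[of r] eq[of rb] unfolding t' \<tau>_def
        by (simp add: power2_eq_square algebra_simps)
    qed
    moreover have "- 2 * n * sb + 2 * n * sg = p" by (simp add: p_def algebra_simps)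
    moreover have "- 2 * n / tb + 2 * (n / tb\<^sup>2) * \<tau> = q"
      using tb by (simp add: q_def \<tau>_def power2_eq_square field_simps)
    ultimately show ?thesis by simp
  qed
  \<comment> \<open>Here the point of \<open>u\<close> is fixed and the penalty is replaced by its
    quadratic majorant. The coefficient \<open>64 * n / tb\<close> comes from centring the majorant
    at \<open>tb\<close>; it cancels in the slope, which is
    \<open>rb * q - 2 * \<beta> * tb\<close>.\<close>
  have "\<exists>a\<in>A i. - \<epsilon> \<le> lam * V i sb tb - (2 * n * sg + 2 * - (n + \<beta>) * sb) * F0 i sb tb a
      - ((rb * q + 64 * n / tb) + 2 * (- 32 * n / tb\<^sup>2 - \<beta>) * tb) * F1 i sb tb a - l i sb tb a"
  proof (rule super_interior[OF i tb(1) tb4 _ \<epsilon>(1)])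
    fix s t assume H: "\<bar>s - sb\<bar> < tb / 4" "\<bar>t - tb\<bar> < tb / 4" "0 \<le> t"
    have t: "3 / 4 * tb < t" "t < 5 / 4 * tb" using H(2) by linarith+
    then have t0: "0 < t" using tb by linarith
    define r where "r = \<tau> / t"
    have tr: "t * r = \<tau>" using t0 by (simp add: r_def)
    have r: "1 / 2 \<le> r" "r \<le> 2"
    proof -
      have "tb * (3 / 4) \<le> tb * rb" "tb * rb \<le> tb * (5 / 4)" using rb tb by (auto intro!: mult_left_mono)
      then have "t * (1 / 2) \<le> \<tau>" "\<tau> \<le> t * 2" using t tb unfolding \<tau>_def by linarith+
      then show "1 / 2 \<le> r" "r \<le> 2" using t0 by (auto simp: r_def field_simps)
    qed
    have "(r - 1)\<^sup>2 \<le> (rb - 1)\<^sup>2 - 2 * (rb - 1) * rb / tb * (t - tb) + 32 / tb\<^sup>2 * (t - tb)\<^sup>2"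
      unfolding r_def \<tau>_def using t tb rb by (intro inverse_square_taylor) auto
    then have "n * (r - 1)\<^sup>2 \<le> n * ((rb - 1)\<^sup>2 - 2 * (rb - 1) * rb / tb * (t - tb) + 32 / tb\<^sup>2 * (t - tb)\<^sup>2)"
      using n by (intro mult_left_mono) auto
    also have "\<dots> = n * (rb - 1)\<^sup>2 - rb * q * (t - tb) + 32 * n / tb\<^sup>2 * (t - tb)\<^sup>2"
      by (simp add: q_def algebra_simps)
    finally have pen: "n * (r - 1)\<^sup>2 \<le> n * (rb - 1)\<^sup>2 - rb * q * (t - tb) + 32 * n / tb\<^sup>2 * (t - tb)\<^sup>2" .
    define k where "k = 32 * n / tb\<^sup>2"
    have ck: "64 * n / tb = 2 * k * tb" using tb by (simp add: k_def power2_eq_square)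
    have ge: "U i sg \<tau> - V i s t - n * ((s - sg)\<^sup>2 + (r - 1)\<^sup>2) - \<beta> * (s\<^sup>2 + t\<^sup>2)
        \<le> U i sg \<tau> - V i sb tb - n * ((sb - sg)\<^sup>2 + (rb - 1)\<^sup>2) - \<beta> * (sb\<^sup>2 + tb\<^sup>2)"
      using gmax[OF H(3) r, of sg s] unfolding tr \<tau>_def[symmetric] .
    have neg: "- 32 * n / tb\<^sup>2 - \<beta> = - k - \<beta>" by (simp add: k_def)
    show "V i sb tb - (2 * n * sg * sb + - (n + \<beta>) * sb\<^sup>2
          + (rb * q + 64 * n / tb) * tb + (- 32 * n / tb\<^sup>2 - \<beta>) * tb\<^sup>2)
        \<le> V i s t - (2 * n * sg * s + - (n + \<beta>) * s\<^sup>2 + (rb * q + 64 * n / tb) * t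
          + (- 32 * n / tb\<^sup>2 - \<beta>) * t\<^sup>2)"
      using pen ge unfolding neg ck unfolding k_def[symmetric]
      by (simp add: power2_eq_square algebra_simps)
  qed
  then obtain a where a: "a \<in> A i"
    and supa: "- \<epsilon> \<le> lam * V i sb tb - (2 * n * sg + 2 * - (n + \<beta>) * sb) * F0 i sb tb a
      - ((rb * q + 64 * n / tb) + 2 * (- 32 * n / tb\<^sup>2 - \<beta>) * tb) * F1 i sb tb a - l i sb tb a" by blast
  have s_slope: "2 * n * sg + 2 * - (n + \<beta>) * sb = p - 2 * \<beta> * sb"
    by (simp add: p_def algebra_simps)
  have t_slope: "(rb * q + 64 * n / tb) + 2 * (- 32 * n / tb\<^sup>2 - \<beta>) * tb = rb * q - 2 * \<beta> * tb"
    using tb by (simp add: power2_eq_square field_simps)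
  note sup = supa[unfolded s_slope t_slope]
  define k\<^sub>1 where "k\<^sub>1 = 2 / \<delta> * (lam * M + M)"
  define k\<^sub>2 where "k\<^sub>2 = 2 / \<delta> * M"
  define k\<^sub>3 where "k\<^sub>3 = 8 * L / \<delta>"
  have k: "0 \<le> k\<^sub>1" "0 \<le> k\<^sub>2" "0 \<le> k\<^sub>3" using pos by (auto simp: k\<^sub>1_def k\<^sub>2_def k\<^sub>3_def)
  have p: "\<bar>p\<bar> = 2 * (n * x)"
    using n by (simp add: p_def x_def abs_mult abs_minus_commute)
  \<comment> \<open>Close to the edge coercivity applies, and
    \<open>k\<^sub>1 + k\<^sub>2 * \<bar>p\<bar>\<close> is \<open>slope_bound p\<close>. Otherwise
    \<open>tb\<close> is at least \<open>\<delta> / (4 * L)\<close>, and the definition of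
    \<open>q\<close> gives a multiple of \<open>n * y\<close>.\<close>
  have q: "\<bar>q\<bar> \<le> k\<^sub>1 + k\<^sub>2 * \<bar>p\<bar> + k\<^sub>3 * (n * y)"
  proof (cases "\<tau> \<le> \<delta> / (2 * L)")
    case True
    have "\<bar>q\<bar> \<le> slope_bound p" by (rule normal_slope_le[OF i less_imp_le[OF \<tau>] True sub])
    also have "\<dots> = k\<^sub>1 + k\<^sub>2 * \<bar>p\<bar>" by (simp add: slope_bound_def k\<^sub>1_def k\<^sub>2_def divide_inverse algebra_simps)
    finally show ?thesis using k n xy0 by (simp add: add_increasing2)
  next
    case False
    have "tb * rb \<le> tb * 2" using rb tb by (intro mult_left_mono) auto
    then have "\<delta> / (4 * L) \<le> tb" using False by (simp add: \<tau>_def)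
    then have "1 / tb \<le> 4 * L / \<delta>" using tb pos by (simp add: field_simps)
    then have "2 * (n * y) * (1 / tb) \<le> 2 * (n * y) * (4 * L / \<delta>)"
      using n xy0 by (intro mult_left_mono) auto
    moreover have "\<bar>q\<bar> = 2 * n * y / tb" using n tb by (simp add: q_def y_def abs_mult)
    ultimately have "\<bar>q\<bar> \<le> k\<^sub>3 * (n * y)" by (simp add: k\<^sub>3_def mult.commute mult.left_commute)
    moreover have "0 \<le> k\<^sub>2 * \<bar>p\<bar>" using k by simp
    ultimately show ?thesis using k by linarith
  qed
  \<comment> \<open>Bounds the distance of the two points, whose normal coordinates differ by
    \<open>tb * y\<close> with \<open>tb \<le> R\<close>.\<close>
  define d where "d = x + R * y"
  have d: "0 \<le> d" "d \<le> 2 * R * \<epsilon>" "n * x * d \<le> 2 * R * \<epsilon>" "n * y * d \<le> 2 * R * \<epsilon>"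
  proof -
    have E: "\<epsilon> \<le> R * \<epsilon>" using R \<epsilon> by simp
    show "0 \<le> d" using xy0 R by (simp add: d_def)
    have "R * y \<le> R * \<epsilon>" "R * (n * (x * y)) \<le> R * \<epsilon>" "R * (n * y\<^sup>2) \<le> R * \<epsilon>"
      using y nxy ny R by (auto intro: mult_left_mono)
    moreover have "n * x * d = n * x\<^sup>2 + R * (n * (x * y))" "n * y * d = n * (x * y) + R * (n * y\<^sup>2)"
      by (auto simp: d_def power2_eq_square algebra_simps)
    ultimately show "d \<le> 2 * R * \<epsilon>" "n * x * d \<le> 2 * R * \<epsilon>" "n * y * d \<le> 2 * R * \<epsilon>"
      using x nx nxy E unfolding d_def by linarith+
  qed
  have pd: "\<bar>p\<bar> * d \<le> 4 * R * \<epsilon>" using d(3) by (simp add: p mult.commute mult.left_commute)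
  have qd: "\<bar>q\<bar> * d \<le> R * (2 * k\<^sub>1 + 4 * k\<^sub>2 + 2 * k\<^sub>3) * \<epsilon>"
  proof -
    have "\<bar>q\<bar> * d \<le> (k\<^sub>1 + k\<^sub>2 * \<bar>p\<bar> + k\<^sub>3 * (n * y)) * d" using q d(1) by (intro mult_right_mono) auto
    also have "\<dots> = k\<^sub>1 * d + k\<^sub>2 * (\<bar>p\<bar> * d) + k\<^sub>3 * (n * y * d)" by (simp add: algebra_simps)
    also have "\<dots> \<le> k\<^sub>1 * (2 * R * \<epsilon>) + k\<^sub>2 * (4 * R * \<epsilon>) + k\<^sub>3 * (2 * R * \<epsilon>)"
      using d pd k by (intro add_mono mult_left_mono) auto
    finally show ?thesis by (simp add: algebra_simps)
  qed
  \<comment> \<open>The normal slopes of the two tests are \<open>q\<close> and, up to the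
    localization, \<open>rb * q\<close>. The mismatch multiplies a speed and not a difference of
    speeds, so \<open>\<bar>q\<bar> * y\<close> has to be small by itself.\<close>
  have qy: "\<bar>q\<bar> * y \<le> (k\<^sub>1 + 2 * k\<^sub>2 + k\<^sub>3) * \<epsilon>"
  proof -
    have "\<bar>q\<bar> * y \<le> (k\<^sub>1 + k\<^sub>2 * \<bar>p\<bar> + k\<^sub>3 * (n * y)) * y" using q xy0 by (intro mult_right_mono) auto
    also have "\<dots> = k\<^sub>1 * y + k\<^sub>2 * (2 * (n * (x * y))) + k\<^sub>3 * (n * y\<^sup>2)"
      by (simp add: p power2_eq_square algebra_simps)
    also have "\<dots> \<le> k\<^sub>1 * \<epsilon> + k\<^sub>2 * (2 * \<epsilon>) + k\<^sub>3 * \<epsilon>"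
      using y nxy ny k by (intro add_mono mult_left_mono) auto
    finally show ?thesis by (simp add: algebra_simps)
  qed
  have dist: "\<bar>sg - sb\<bar> + \<bar>\<tau> - tb\<bar> \<le> d"
  proof -
    have "\<bar>\<tau> - tb\<bar> = tb * y"
    proof -
      have "\<tau> - tb = tb * (rb - 1)" by (simp add: \<tau>_def algebra_simps)
      then show ?thesis using tb by (simp add: y_def abs_mult)
    qed
    also have "\<dots> \<le> R * y" using tb xy0 by (intro mult_right_mono) auto
    finally show ?thesis by (simp add: d_def x_def abs_minus_commute)
  qed
  have Ld: "L * (\<bar>sg - sb\<bar> + \<bar>\<tau> - tb\<bar>) \<le> L * d" using dist pos by (intro mult_left_mono) auto
  have F0: "\<bar>F0 i sg \<tau> a - F0 i sb tb a\<bar> \<le> L * d" and F1: "\<bar>F1 i sg \<tau> a - F1 i sb tb a\<bar> \<le> L * d"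
    using F0_lip[OF i less_imp_le[OF \<tau>] less_imp_le[OF tb(1)] a, of sg sb]
      F1_lip[OF i less_imp_le[OF \<tau>] less_imp_le[OF tb(1)] a, of sg sb] Ld by linarith+
  have "lam * (U i sg \<tau> - V i sb tb) = lam * U i sg \<tau> - lam * V i sb tb" by (simp add: algebra_simps)
  also have "\<dots> \<le> (p * F0 i sg \<tau> a + q * F1 i sg \<tau> a + l i sg \<tau> a)
      - ((p - 2 * \<beta> * sb) * F0 i sb tb a + (rb * q - 2 * \<beta> * tb) * F1 i sb tb a + l i sb tb a) + \<epsilon>"
    using sub[OF a] sup by linarith
  also have "\<dots> = p * (F0 i sg \<tau> a - F0 i sb tb a) + q * (F1 i sg \<tau> a - F1 i sb tb a)
      + (q * (1 - rb)) * F1 i sb tb a + (l i sg \<tau> a - l i sb tb a)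
      + 2 * (\<beta> * sb * F0 i sb tb a) + 2 * (\<beta> * tb * F1 i sb tb a) + \<epsilon>"
    by (simp add: algebra_simps)
  also have "\<dots> \<le> L * (4 * R * \<epsilon>) + L * (R * (2 * k\<^sub>1 + 4 * k\<^sub>2 + 2 * k\<^sub>3) * \<epsilon>)
      + (k\<^sub>1 + 2 * k\<^sub>2 + k\<^sub>3) * \<epsilon> * M + \<zeta> + 2 * (b * M) + \<epsilon>"
  proof -
    have "p * (F0 i sg \<tau> a - F0 i sb tb a) \<le> \<bar>p\<bar> * \<bar>F0 i sg \<tau> a - F0 i sb tb a\<bar>"
      by (metis abs_ge_self abs_mult)
    also have "\<dots> \<le> \<bar>p\<bar> * (L * d)" using F0 by (intro mult_left_mono) auto
    also have "\<dots> = L * (\<bar>p\<bar> * d)" by simp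
    also have "\<dots> \<le> L * (4 * R * \<epsilon>)" using pd pos by (intro mult_left_mono) auto
    finally have 1: "p * (F0 i sg \<tau> a - F0 i sb tb a) \<le> L * (4 * R * \<epsilon>)" .
    have "q * (F1 i sg \<tau> a - F1 i sb tb a) \<le> \<bar>q\<bar> * \<bar>F1 i sg \<tau> a - F1 i sb tb a\<bar>"
      by (metis abs_ge_self abs_mult)
    also have "\<dots> \<le> \<bar>q\<bar> * (L * d)" using F1 by (intro mult_left_mono) auto
    also have "\<dots> = L * (\<bar>q\<bar> * d)" by simp
    also have "\<dots> \<le> L * (R * (2 * k\<^sub>1 + 4 * k\<^sub>2 + 2 * k\<^sub>3) * \<epsilon>)" using qd pos by (intro mult_left_mono) auto
    finally have 2: "q * (F1 i sg \<tau> a - F1 i sb tb a) \<le> L * (R * (2 * k\<^sub>1 + 4 * k\<^sub>2 + 2 * k\<^sub>3) * \<epsilon>)" .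
    have M: "\<bar>F0 i sb tb a\<bar> \<le> M" "\<bar>F1 i sb tb a\<bar> \<le> M"
      using F0_bdd[OF i _ a, of tb sb] F1_bdd[OF i _ a, of tb sb] tb by auto
    have "(q * (1 - rb)) * F1 i sb tb a \<le> \<bar>q * (1 - rb)\<bar> * \<bar>F1 i sb tb a\<bar>"
      by (metis abs_ge_self abs_mult)
    also have "\<dots> = \<bar>q\<bar> * y * \<bar>F1 i sb tb a\<bar>" by (simp add: abs_mult y_def abs_minus_commute)
    also have "\<dots> \<le> (k\<^sub>1 + 2 * k\<^sub>2 + k\<^sub>3) * \<epsilon> * M" by (rule mult_mono[OF qy M(2)]) (use k \<epsilon> in auto)
    finally have 3: "(q * (1 - rb)) * F1 i sb tb a \<le> (k\<^sub>1 + 2 * k\<^sub>2 + k\<^sub>3) * \<epsilon> * M" .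
    have "\<beta> * sb * F0 i sb tb a \<le> \<bar>\<beta> * sb\<bar> * \<bar>F0 i sb tb a\<bar>" by (metis abs_ge_self abs_mult)
    also have "\<dots> \<le> (\<beta> * \<bar>sb\<bar>) * M" using M \<beta> by (simp add: abs_mult mult_left_mono)
    finally have 4: "\<beta> * sb * F0 i sb tb a \<le> \<beta> * \<bar>sb\<bar> * M" .
    have 5: "\<beta> * tb * F1 i sb tb a \<le> \<beta> * tb * M" using M tb \<beta> by (intro mult_left_mono) auto
    have "\<beta> * (\<bar>sb\<bar> + tb) * M \<le> b * M" using b pos by (intro mult_right_mono) auto
    then have 6: "\<beta> * \<bar>sb\<bar> * M + \<beta> * tb * M \<le> b * M" by (simp add: algebra_simps)
    have "l i sg \<tau> a - l i sb tb a \<le> \<zeta>" using l[OF a] by (simp add: \<tau>_def)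
    then show ?thesis using 1 2 3 4 5 6 by linarith
  qed
  also have "\<dots> = interior_const R * \<epsilon> + 2 * b * M + \<zeta>"
    by (simp add: interior_const_def k\<^sub>1_def k\<^sub>2_def k\<^sub>3_def divide_inverse algebra_simps)
  finally show ?thesis by (simp add: \<tau>_def)
qed

section \<open>The doubled maximum and its penalty\<close>

text \<open>Using the ratio \<open>r\<close> as a variable in place of the second normal coordinate
  turns the domain into a box and gives the penalty a meaning on the edge, where \<open>r\<close> is
  free. As \<open>U\<close> and \<open>V\<close> are bounded, the penalized difference is negative
  outside a compact box, whereas the given point has a value of at least
  \<open>m > 0\<close>.\<close>

lemma doubling_max:
  assumes n: "1 \<le> n" and \<beta>: "0 < \<beta>" and m: "0 < m" and i: "i \<in> I" and t: "0 \<le> t"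
    and val: "m \<le> U i s t - V i s t - \<beta> * (s\<^sup>2 + t\<^sup>2)"
  obtains j sb sg tb rb where "j \<in> I" "0 \<le> tb" "1 / 2 \<le> rb" "rb \<le> 2"
    "m \<le> U j sg (tb * rb) - V j sb tb - n * ((sb - sg)\<^sup>2 + (rb - 1)\<^sup>2) - \<beta> * (sb\<^sup>2 + tb\<^sup>2)"
    "\<forall>j'\<in>I. \<forall>\<sigma> s t r. 0 \<le> t \<longrightarrow> 1 / 2 \<le> r \<longrightarrow> r \<le> 2 \<longrightarrow>
        U j' \<sigma> (t * r) - V j' s t - n * ((s - \<sigma>)\<^sup>2 + (r - 1)\<^sup>2) - \<beta> * (s\<^sup>2 + t\<^sup>2)
        \<le> U j sg (tb * rb) - V j sb tb - n * ((sb - sg)\<^sup>2 + (rb - 1)\<^sup>2) - \<beta> * (sb\<^sup>2 + tb\<^sup>2)"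
proof -
  \<comment> \<open>Since \<open>R \<ge> 1\<close>, also \<open>R \<le> R\<^sup>2\<close>. The first
    summand then makes \<open>\<beta> * R\<^sup>2\<close> exceed \<open>2 * M\<close>, and the rest
    does the same for \<open>n * R\<^sup>2\<close>, whatever \<open>n \<ge> 1\<close> is.\<close>
  define R where "R = 2 * M / \<beta> + 2 * M + 1"
  have R1: "1 \<le> R" unfolding R_def using pos \<beta> by simp
  then have R0: "0 \<le> R" by simp
  have RR: "R \<le> R\<^sup>2" using R1 by (simp add: power2_eq_square)
  have \<beta>R: "2 * M < \<beta> * R\<^sup>2"
  proof -
    have "2 * M = \<beta> * (2 * M / \<beta>)" using \<beta> by simp
    also have "\<dots> < \<beta> * R" using pos \<beta> by (intro mult_strict_left_mono) (auto simp: R_def)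
    also have "\<dots> \<le> \<beta> * R\<^sup>2" using RR \<beta> by (intro mult_left_mono) auto
    finally show ?thesis .
  qed
  have nR: "2 * M < n * R\<^sup>2"
  proof -
    have "2 * M < R" using pos \<beta> by (simp add: R_def add_pos_pos)
    also have "R \<le> 1 * R\<^sup>2" using RR by simp
    also have "\<dots> \<le> n * R\<^sup>2" using n by (intro mult_right_mono) auto
    finally show ?thesis .
  qed
  define \<Phi> where "\<Phi> j z = U j (fst (snd z)) (fst (snd (snd z)) * snd (snd (snd z)))
      + - V j (fst z) (fst (snd (snd z)))
      - (n * ((fst z - fst (snd z))\<^sup>2 + (snd (snd (snd z)) - 1)\<^sup>2)
          + \<beta> * ((fst z)\<^sup>2 + (fst (snd (snd z)))\<^sup>2))" for j z
  define K where "K = {- R..R} \<times> {- (2 * R)..2 * R} \<times> {0..R} \<times> {1 / 2..2 :: real}"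
  have K: "compact K" unfolding K_def by (intro compact_Times compact_Icc)
  have usc: "usc_on K (\<Phi> j)" if j: "j \<in> I" for j
    unfolding \<Phi>_def
  proof (intro usc_on_diff_continuous usc_on_add)
    have "usc_on K (\<lambda>z. (\<lambda>z. U j (fst z) (snd z)) (fst (snd z), fst (snd (snd z)) * snd (snd (snd z))))"
      by (rule usc_on_compose[OF U_usc[OF j]]) (auto simp: K_def intro!: continuous_intros)
    then show "usc_on K (\<lambda>z. U j (fst (snd z)) (fst (snd (snd z)) * snd (snd (snd z))))" by simp
    have "usc_on K (\<lambda>z. (\<lambda>z. - V j (fst z) (snd z)) (fst z, fst (snd (snd z))))"
      by (rule usc_on_compose[OF V_lsc[OF j]]) (auto simp: K_def intro!: continuous_intros)
    then show "usc_on K (\<lambda>z. - V j (fst z) (fst (snd (snd z))))" by simp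
    show "continuous_on K (\<lambda>z. n * ((fst z - fst (snd z))\<^sup>2 + (snd (snd (snd z)) - 1)\<^sup>2)
          + \<beta> * ((fst z)\<^sup>2 + (fst (snd (snd z)))\<^sup>2))"
      by (intro continuous_intros)
  qed
  have outside: "z \<in> K" if j: "j \<in> I" and z: "0 \<le> fst (snd (snd z))" "1 / 2 \<le> snd (snd (snd z))"
    "snd (snd (snd z)) \<le> 2" and ge: "0 \<le> \<Phi> j z" for j z
  proof -
    obtain s \<sigma> t r where zz: "z = (s, \<sigma>, t, r)" by (cases z)
    have tr: "0 \<le> t" "1 / 2 \<le> r" "r \<le> 2" using z by (auto simp: zz)
    have b: "\<bar>U j \<sigma> (t * r)\<bar> \<le> M" "\<bar>V j s t\<bar> \<le> M" using U_bdd[OF j] V_bdd[OF j] tr by auto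
    have le: "n * (s - \<sigma>)\<^sup>2 + n * (r - 1)\<^sup>2 + \<beta> * s\<^sup>2 + \<beta> * t\<^sup>2 \<le> 2 * M"
      using ge b by (simp add: \<Phi>_def zz algebra_simps abs_le_iff)
    have nonneg: "0 \<le> n * (s - \<sigma>)\<^sup>2" "0 \<le> n * (r - 1)\<^sup>2" "0 \<le> \<beta> * s\<^sup>2" "0 \<le> \<beta> * t\<^sup>2" using n \<beta> by auto
    have "\<beta> * s\<^sup>2 \<le> \<beta> * R\<^sup>2" "\<beta> * t\<^sup>2 \<le> \<beta> * R\<^sup>2" "n * (s - \<sigma>)\<^sup>2 \<le> n * R\<^sup>2"
      using le nonneg \<beta>R nR by linarith+
    then have "s\<^sup>2 \<le> R\<^sup>2" "t\<^sup>2 \<le> R\<^sup>2" "(s - \<sigma>)\<^sup>2 \<le> R\<^sup>2" using \<beta> n by auto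
    then have "\<bar>s\<bar> \<le> R" "\<bar>t\<bar> \<le> R" "\<bar>s - \<sigma>\<bar> \<le> R" using R0 by (auto simp: power2_le_iff_abs_le)
    then show ?thesis using tr by (auto simp: K_def zz abs_le_iff)
  qed
  have val': "m \<le> \<Phi> i (s, s, t, 1)" using val by (simp add: \<Phi>_def)
  then have start: "(s, s, t, 1) \<in> K" using outside[OF i, of "(s, s, t, 1)"] t m by simp
  then have "K \<noteq> {}" by auto
  obtain j z where j: "j \<in> I" "z \<in> K" and mx: "\<And>j' y. j' \<in> I \<Longrightarrow> y \<in> K \<Longrightarrow> \<Phi> j' y \<le> \<Phi> j z"
    using usc_on_family_attains_max[where u = \<Phi>, OF I K \<open>K \<noteq> {}\<close> usc] by blast
  have mz: "m \<le> \<Phi> j z" using val' mx[OF i start] by simp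
  obtain sb sg tb rb where z: "z = (sb, sg, tb, rb)" by (cases z)
  have glob: "\<Phi> j' (s, \<sigma>, t, r) \<le> \<Phi> j z" if "j' \<in> I" "0 \<le> t" "1 / 2 \<le> r" "r \<le> 2" for j' s \<sigma> t r
  proof (cases "0 \<le> \<Phi> j' (s, \<sigma>, t, r)")
    case True
    then show ?thesis using outside[OF that(1), of "(s, \<sigma>, t, r)"] mx that by simp
  next
    case False
    then show ?thesis using mz m by simp
  qed
  show thesis
  proof (rule that[OF j(1)])
    show "0 \<le> tb" "1 / 2 \<le> rb" "rb \<le> 2" using j(2) by (auto simp: K_def z)
    show "m \<le> U j sg (tb * rb) - V j sb tb - n * ((sb - sg)\<^sup>2 + (rb - 1)\<^sup>2) - \<beta> * (sb\<^sup>2 + tb\<^sup>2)"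
      using mz by (simp add: \<Phi>_def z)
    show "\<forall>j'\<in>I. \<forall>\<sigma> s t r. 0 \<le> t \<longrightarrow> 1 / 2 \<le> r \<longrightarrow> r \<le> 2 \<longrightarrow>
        U j' \<sigma> (t * r) - V j' s t - n * ((s - \<sigma>)\<^sup>2 + (r - 1)\<^sup>2) - \<beta> * (s\<^sup>2 + t\<^sup>2)
        \<le> U j sg (tb * rb) - V j sb tb - n * ((sb - sg)\<^sup>2 + (rb - 1)\<^sup>2) - \<beta> * (sb\<^sup>2 + tb\<^sup>2)"
    proof (intro ballI allI impI)
      fix j' \<sigma> s t r assume "j' \<in> I" "0 \<le> (t::real)" "1 / 2 \<le> r" "r \<le> (2::real)"
      from glob[OF this, of s \<sigma>]
      show "U j' \<sigma> (t * r) - V j' s t - n * ((s - \<sigma>)\<^sup>2 + (r - 1)\<^sup>2) - \<beta> * (s\<^sup>2 + t\<^sup>2)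
        \<le> U j sg (tb * rb) - V j sb tb - n * ((sb - sg)\<^sup>2 + (rb - 1)\<^sup>2) - \<beta> * (sb\<^sup>2 + tb\<^sup>2)"
        by (simp add: \<Phi>_def z)
    qed
  qed
qed

text \<open>The maximal value decreases in \<open>n\<close>. Passing from \<open>n\<close> to \<open>2 n\<close> costs at least half of the
  penalty at the new maximum, so the penalty is small for some power of two.\<close>

lemma doubling_max_small_penalty:
  assumes \<beta>: "0 < \<beta>" and m: "0 < m" and i: "i \<in> I" and t: "0 \<le> t"
    and val: "m \<le> U i s t - V i s t - \<beta> * (s\<^sup>2 + t\<^sup>2)" and \<epsilon>: "0 < \<epsilon>"
  obtains n j sb sg tb rb where "1 \<le> n" "j \<in> I" "0 \<le> tb" "1 / 2 \<le> rb" "rb \<le> 2"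
    "n * ((sb - sg)\<^sup>2 + (rb - 1)\<^sup>2) \<le> \<epsilon>"
    "m \<le> U j sg (tb * rb) - V j sb tb - n * ((sb - sg)\<^sup>2 + (rb - 1)\<^sup>2) - \<beta> * (sb\<^sup>2 + tb\<^sup>2)"
    "\<forall>j'\<in>I. \<forall>\<sigma> s t r. 0 \<le> t \<longrightarrow> 1 / 2 \<le> r \<longrightarrow> r \<le> 2 \<longrightarrow>
        U j' \<sigma> (t * r) - V j' s t - n * ((s - \<sigma>)\<^sup>2 + (r - 1)\<^sup>2) - \<beta> * (s\<^sup>2 + t\<^sup>2)
        \<le> U j sg (tb * rb) - V j sb tb - n * ((sb - sg)\<^sup>2 + (rb - 1)\<^sup>2) - \<beta> * (sb\<^sup>2 + tb\<^sup>2)"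
proof -
  define X where "X = (\<lambda>(j :: 'i, s, \<sigma>, t :: real, r). (s - \<sigma>)\<^sup>2 + (r - 1 :: real)\<^sup>2)"
  define W where "W = (\<lambda>(j, s, \<sigma>, t, r). U j \<sigma> (t * r) - V j s t - \<beta> * (s\<^sup>2 + t\<^sup>2))"
  define D where "D = {(j, s :: real, \<sigma> :: real, t :: real, r). j \<in> I \<and> 0 \<le> t \<and> 1 / 2 \<le> r \<and> r \<le> (2::real)}"
  have "\<exists>z\<in>D. m \<le> W z - 2 ^ k * X z \<and> (\<forall>y\<in>D. W y - 2 ^ k * X y \<le> W z - 2 ^ k * X z)" for k :: nat
  proof (rule doubling_max[where n = "2 ^ k", OF _ \<beta> m i t val])
    fix j sb sg tb rb assume H: "j \<in> I" "0 \<le> tb" "1 / 2 \<le> rb" "rb \<le> 2"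
      "m \<le> U j sg (tb * rb) - V j sb tb - 2 ^ k * ((sb - sg)\<^sup>2 + (rb - 1)\<^sup>2) - \<beta> * (sb\<^sup>2 + tb\<^sup>2)"
      "\<forall>j'\<in>I. \<forall>\<sigma> s t r. 0 \<le> t \<longrightarrow> 1 / 2 \<le> r \<longrightarrow> r \<le> 2 \<longrightarrow>
        U j' \<sigma> (t * r) - V j' s t - 2 ^ k * ((s - \<sigma>)\<^sup>2 + (r - 1)\<^sup>2) - \<beta> * (s\<^sup>2 + t\<^sup>2)
        \<le> U j sg (tb * rb) - V j sb tb - 2 ^ k * ((sb - sg)\<^sup>2 + (rb - 1)\<^sup>2) - \<beta> * (sb\<^sup>2 + tb\<^sup>2)"
    show ?thesis
    proof (intro bexI[of _ "(j, sb, sg, tb, rb)"] conjI ballI)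
      show "(j, sb, sg, tb, rb) \<in> D" using H by (simp add: D_def)
      show "m \<le> W (j, sb, sg, tb, rb) - 2 ^ k * X (j, sb, sg, tb, rb)"
        using H(5) by (simp add: W_def X_def)
      fix y assume y: "y \<in> D"
      obtain j' s \<sigma> t r where yy: "y = (j', s, \<sigma>, t, r)" by (cases y)
      have "j' \<in> I" "0 \<le> t" "1 / 2 \<le> r" "r \<le> 2" using y by (auto simp: D_def yy)
      from H(6)[rule_format, OF this, of \<sigma> s]
      show "W y - 2 ^ k * X y \<le> W (j, sb, sg, tb, rb) - 2 ^ k * X (j, sb, sg, tb, rb)"
        by (simp add: W_def X_def yy)
    qed
  qed simp
  then obtain z where z: "\<And>k. z k \<in> D" "\<And>k. m \<le> W (z k) - 2 ^ k * X (z k)"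
    "\<And>k y. y \<in> D \<Longrightarrow> W y - 2 ^ k * X y \<le> W (z k) - 2 ^ k * X (z k)" by metis
  define S where "S k = W (z k) - 2 ^ k * X (z k)" for k
  obtain k where k: "S k - S (Suc k) < \<epsilon> / 2"
    using decreasing_has_small_step[of S "\<epsilon> / 2"] z(2) m \<epsilon> unfolding S_def
    by (metis half_gt_zero less_imp_le order_trans)
  have "W (z (Suc k)) - 2 ^ k * X (z (Suc k)) \<le> S k" unfolding S_def using z by blast
  then have "2 ^ k * X (z (Suc k)) < \<epsilon> / 2" using k by (simp add: S_def)
  then have small: "2 ^ Suc k * X (z (Suc k)) \<le> \<epsilon>" by simp
  obtain j sb sg tb rb where zz: "z (Suc k) = (j, sb, sg, tb, rb)" by (cases "z (Suc k)")
  show thesis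
  proof (rule that[of "2 ^ Suc k" j tb rb sb sg])
    show "(1 :: real) \<le> 2 ^ Suc k" by (rule one_le_power) simp
    show "j \<in> I" "0 \<le> tb" "1 / 2 \<le> rb" "rb \<le> 2" using z(1)[of "Suc k"] by (auto simp: D_def zz)
    show "2 ^ Suc k * ((sb - sg)\<^sup>2 + (rb - 1)\<^sup>2) \<le> \<epsilon>" using small by (simp add: X_def zz)
    show "m \<le> U j sg (tb * rb) - V j sb tb - 2 ^ Suc k * ((sb - sg)\<^sup>2 + (rb - 1)\<^sup>2) - \<beta> * (sb\<^sup>2 + tb\<^sup>2)"
      using z(2)[of "Suc k"] by (simp add: X_def W_def zz)
    show "\<forall>j'\<in>I. \<forall>\<sigma> s t r. 0 \<le> t \<longrightarrow> 1 / 2 \<le> r \<longrightarrow> r \<le> 2 \<longrightarrow>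
        U j' \<sigma> (t * r) - V j' s t - 2 ^ Suc k * ((s - \<sigma>)\<^sup>2 + (r - 1)\<^sup>2) - \<beta> * (s\<^sup>2 + t\<^sup>2)
        \<le> U j sg (tb * rb) - V j sb tb - 2 ^ Suc k * ((sb - sg)\<^sup>2 + (rb - 1)\<^sup>2) - \<beta> * (sb\<^sup>2 + tb\<^sup>2)"
    proof (intro ballI allI impI)
      fix j' \<sigma> s t r assume "j' \<in> I" "0 \<le> (t::real)" "1 / 2 \<le> r" "r \<le> (2::real)"
      then have "(j', s, \<sigma>, t, r) \<in> D" by (simp add: D_def)
      from z(3)[OF this, of "Suc k"]
      show "U j' \<sigma> (t * r) - V j' s t - 2 ^ Suc k * ((s - \<sigma>)\<^sup>2 + (r - 1)\<^sup>2) - \<beta> * (s\<^sup>2 + t\<^sup>2)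
        \<le> U j sg (tb * rb) - V j sb tb - 2 ^ Suc k * ((sb - sg)\<^sup>2 + (rb - 1)\<^sup>2) - \<beta> * (sb\<^sup>2 + tb\<^sup>2)"
        by (simp add: X_def W_def zz)
    qed
  qed
qed

section \<open>Comparison in coordinates\<close>

lemma interior_const_nonneg: "0 \<le> R \<Longrightarrow> 0 \<le> interior_const R"
  unfolding interior_const_def using pos by (intro add_nonneg_nonneg mult_nonneg_nonneg) auto

lemma edge_const_nonneg: "0 \<le> edge_const"
  unfolding edge_const_def using pos transfer_const_pos by (intro add_nonneg_nonneg mult_nonneg_nonneg) auto

text \<open>At a doubled maximum the gap is at least \<open>m\<close>, while the estimates bound
  \<open>lam\<close> times the gap by three errors \<open>C * \<epsilon>\<close>,
  \<open>2 * b * M\<close> and \<zeta>, each at most \<open>lam * m / 4\<close>. The order of choice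
  matters: \<beta> is fixed first, because \<open>R\<close>, and with it \<open>C\<close>, depends
  on it; \<epsilon> follows and \<open>n\<close> comes last.\<close>

theorem comparison:
  assumes i: "i \<in> I" and t: "0 \<le> t"
  shows "U i s t \<le> V i s t"
proof (rule ccontr)
  assume gt: "\<not> ?thesis"
  define m where "m = (U i s t - V i s t) / 2"
  have m: "0 < m" using gt by (simp add: m_def)
  define b where "b = lam * m / (8 * M)"
  have b: "0 < b" using pos m by (simp add: b_def)
  \<comment> \<open>The first bound ensures \<open>\<beta> * (\<bar>sb\<bar> + tb) \<le> b\<close>:
    boundedness of \<open>U\<close> and \<open>V\<close> gives
    \<open>\<beta> * (sb\<^sup>2 + tb\<^sup>2) \<le> 2 * M\<close>, so the square of the left side
    is at most \<open>4 * M * \<beta>\<close>. The second leaves at least \<open>m\<close> of the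
    gap \<open>2 * m\<close> at the given point.\<close>
  define \<beta> where "\<beta> = min (b\<^sup>2 / (4 * M)) (m / (s\<^sup>2 + t\<^sup>2 + 1))"
  have \<beta>: "0 < \<beta>" unfolding \<beta>_def using b m pos by (auto intro!: divide_pos_pos add_nonneg_pos)
  have \<beta>b: "4 * M * \<beta> \<le> b\<^sup>2"
  proof -
    have "\<beta> \<le> b\<^sup>2 / (4 * M)" by (simp add: \<beta>_def)
    then show ?thesis using pos by (simp add: pos_le_divide_eq mult.commute)
  qed
  have val: "m \<le> U i s t - V i s t - \<beta> * (s\<^sup>2 + t\<^sup>2)"
  proof -
    have "\<beta> \<le> m / (s\<^sup>2 + t\<^sup>2 + 1)" by (simp add: \<beta>_def)
    then have "\<beta> * (s\<^sup>2 + t\<^sup>2 + 1) \<le> m" by (simp add: pos_le_divide_eq add_nonneg_pos)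
    then have "\<beta> * (s\<^sup>2 + t\<^sup>2) \<le> m" using \<beta> by (simp add: distrib_left)
    moreover have "U i s t - V i s t = 2 * m" by (simp add: m_def)
    ultimately show ?thesis by linarith
  qed
  define R where "R = 2 * M / \<beta> + 1"
  have R: "1 \<le> R" using pos \<beta> by (simp add: R_def)
  define \<zeta> where "\<zeta> = lam * m / 4"
  have \<zeta>: "0 < \<zeta>" using pos m by (simp add: \<zeta>_def)
  obtain \<eta> where \<eta>: "0 < \<eta>" "\<And>i s s' t t' a. i \<in> I \<Longrightarrow> a \<in> A i \<Longrightarrow> 0 \<le> t \<Longrightarrow> 0 \<le> t' \<Longrightarrow>
      \<bar>s - s'\<bar> + \<bar>t - t'\<bar> < \<eta> \<Longrightarrow> \<bar>l i s t a - l i s' t' a\<bar> < \<zeta>"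
    using l_unif[OF \<zeta>] by blast
  define C where "C = interior_const R + edge_const + 1"
  have C: "0 < C" "interior_const R \<le> C" "edge_const \<le> C"
    using interior_const_nonneg[of R] edge_const_nonneg R by (auto simp: C_def)
  \<comment> \<open>Since \<open>tb \<le> R\<close>, the two points will be at distance at most
    \<open>(1 + R) * \<epsilon>\<close>; the second entry keeps this below \<eta>.\<close>
  define \<epsilon> where "\<epsilon> = Min {1 / 4, \<eta> / (2 * (1 + R)), lam * m / (4 * C)}"
  have \<epsilon>0: "0 < \<epsilon>" unfolding \<epsilon>_def using \<eta>(1) R C m pos by simp
  have \<epsilon>le: "\<epsilon> \<le> 1 / 4" "\<epsilon> \<le> \<eta> / (2 * (1 + R))" "\<epsilon> \<le> lam * m / (4 * C)"
    unfolding \<epsilon>_def by (intro Min_le; simp)+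
  have C\<epsilon>: "C * \<epsilon> \<le> lam * m / 4" using \<epsilon>le(3) C by (simp add: field_simps)
  have R\<epsilon>: "(1 + R) * \<epsilon> < \<eta>"
  proof -
    have "(1 + R) * \<epsilon> \<le> \<eta> / 2" using \<epsilon>le(2) R by (simp add: field_simps)
    then show ?thesis using \<eta>(1) by simp
  qed
  have "0 < \<epsilon>\<^sup>2" using \<epsilon>0 by simp
  then obtain n j sb sg tb rb where n: "1 \<le> n" and j: "j \<in> I" and tb: "0 \<le> tb"
    and rb: "1 / 2 \<le> rb" "rb \<le> 2" and small: "n * ((sb - sg)\<^sup>2 + (rb - 1)\<^sup>2) \<le> \<epsilon>\<^sup>2"
    and mz: "m \<le> U j sg (tb * rb) - V j sb tb - n * ((sb - sg)\<^sup>2 + (rb - 1)\<^sup>2) - \<beta> * (sb\<^sup>2 + tb\<^sup>2)"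
    and mx: "\<forall>j'\<in>I. \<forall>\<sigma> s t r. 0 \<le> t \<longrightarrow> 1 / 2 \<le> r \<longrightarrow> r \<le> 2 \<longrightarrow>
        U j' \<sigma> (t * r) - V j' s t - n * ((s - \<sigma>)\<^sup>2 + (r - 1)\<^sup>2) - \<beta> * (s\<^sup>2 + t\<^sup>2)
        \<le> U j sg (tb * rb) - V j sb tb - n * ((sb - sg)\<^sup>2 + (rb - 1)\<^sup>2) - \<beta> * (sb\<^sup>2 + tb\<^sup>2)"
    by (rule doubling_max_small_penalty[OF \<beta> m i t val])
  have bd: "\<bar>U j sg (tb * rb)\<bar> \<le> M" "\<bar>V j sb tb\<bar> \<le> M" using U_bdd[OF j] V_bdd[OF j] tb rb by auto
  have pen0: "0 \<le> n * (sb - sg)\<^sup>2" "0 \<le> n * (rb - 1)\<^sup>2" "0 \<le> \<beta> * (sb\<^sup>2 + tb\<^sup>2)" using n \<beta> by auto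
  have UV: "m \<le> U j sg (tb * rb) - V j sb tb" and \<beta>2: "\<beta> * (sb\<^sup>2 + tb\<^sup>2) \<le> 2 * M"
    using mz pen0 bd m by (auto simp: distrib_left abs_le_iff)
  have \<beta>x: "\<beta> * (\<bar>sb\<bar> + tb) \<le> b"
  proof -
    have "(\<beta> * (\<bar>sb\<bar> + tb))\<^sup>2 \<le> \<beta>\<^sup>2 * (2 * (sb\<^sup>2 + tb\<^sup>2))"
      using sum_squares_bound[of "\<bar>sb\<bar>" tb]
      unfolding power_mult_distrib by (intro mult_left_mono) (auto simp: power2_sum)
    also have "\<dots> = 2 * \<beta> * (\<beta> * (sb\<^sup>2 + tb\<^sup>2))" by (simp add: power2_eq_square)
    also have "\<dots> \<le> 2 * \<beta> * (2 * M)" using \<beta>2 \<beta> by (intro mult_left_mono) auto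
    also have "\<dots> \<le> b\<^sup>2" using \<beta>b by (simp add: mult.commute mult.left_commute)
    finally show ?thesis using b by (simp add: power2_le_iff_abs_le)
  qed
  have sq: "(sb - sg)\<^sup>2 \<le> \<epsilon>\<^sup>2" "(rb - 1)\<^sup>2 \<le> \<epsilon>\<^sup>2" "n * (sb - sg)\<^sup>2 \<le> \<epsilon>\<^sup>2"
    using small pen0 mult_right_mono[OF n, of "(sb - sg)\<^sup>2"] mult_right_mono[OF n, of "(rb - 1)\<^sup>2"]
    by (simp_all add: distrib_left)
  then have xy: "\<bar>sb - sg\<bar> \<le> \<epsilon>" "\<bar>rb - 1\<bar> \<le> \<epsilon>" using \<epsilon>0 by (auto simp: power2_le_iff_abs_le)
  have tbR: "tb \<le> R"
  proof (cases "tb \<le> 1")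
    case False
    have "\<beta> * tb\<^sup>2 \<le> 2 * M" using \<beta>2 \<beta> by (simp add: distrib_left) (smt (verit) zero_le_mult_iff zero_le_power2)
    then have "tb\<^sup>2 \<le> 2 * M / \<beta>" using \<beta> by (simp add: pos_le_divide_eq mult.commute)
    moreover have "tb \<le> tb\<^sup>2" using False by (simp add: power2_eq_square)
    ultimately show ?thesis by (simp add: R_def)
  qed (use R in simp)
  have "lam * (U j sg (tb * rb) - V j sb tb) \<le> C * \<epsilon> + 2 * b * M + \<zeta>"
  proof (cases "tb = 0")
    case True
    have "lam * (U j sg 0 - V j sb 0) \<le> edge_const * \<epsilon> + 2 * b * M + \<zeta>"
    proof (rule edge_estimate[OF j n \<beta> \<epsilon>0 _ _ sq(3)])
      show "\<epsilon> \<le> 1" "\<beta> * \<bar>sb\<bar> \<le> b" using \<epsilon>le(1) \<beta>x True by auto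
      fix j' \<sigma> s t assume jt: "j' \<in> I" "0 \<le> (t::real)"
      have "U j' \<sigma> (t * 1) - V j' s t - n * ((s - \<sigma>)\<^sup>2 + (1 - 1)\<^sup>2) - \<beta> * (s\<^sup>2 + t\<^sup>2)
        \<le> U j sg (tb * rb) - V j sb tb - n * ((sb - sg)\<^sup>2 + (rb - 1)\<^sup>2) - \<beta> * (sb\<^sup>2 + tb\<^sup>2)"
        using mx[rule_format, OF jt, of 1 \<sigma> s] by simp
      then show "U j' \<sigma> t - V j' s t - n * (s - \<sigma>)\<^sup>2 - \<beta> * (s\<^sup>2 + t\<^sup>2)
        \<le> U j sg 0 - V j sb 0 - n * (sb - sg)\<^sup>2 - \<beta> * sb\<^sup>2"
        using pen0 True by (simp add: distrib_left)
    next
      fix i a assume ia: "i \<in> I" "a \<in> A i"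
      have "\<bar>sg - sb\<bar> + \<bar>0 - 0\<bar> \<le> 1 * \<epsilon>" using xy by simp
      also have "\<dots> \<le> (1 + R) * \<epsilon>" using R \<epsilon>0 by (intro mult_right_mono) auto
      also have "\<dots> < \<eta>" by (rule R\<epsilon>)
      finally show "\<bar>l i sg 0 a - l i sb 0 a\<bar> \<le> \<zeta>"
        using \<eta>(2)[OF ia, of 0 0 sg sb] by simp
    qed
    moreover have "edge_const * \<epsilon> \<le> C * \<epsilon>" using C \<epsilon>0 by (intro mult_right_mono) auto
    ultimately show ?thesis using True by simp
  next
    case False
    then have tb0: "0 < tb" using tb by simp
    have "lam * (U j sg (tb * rb) - V j sb tb) \<le> interior_const R * \<epsilon> + 2 * b * M + \<zeta>"
    proof (rule interior_estimate[OF j n \<beta> \<epsilon>0 \<epsilon>le(1) tb0 tbR R _ small \<beta>x])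
      show "U j \<sigma> (t * r) - V j s t - n * ((s - \<sigma>)\<^sup>2 + (r - 1)\<^sup>2) - \<beta> * (s\<^sup>2 + t\<^sup>2)
        \<le> U j sg (tb * rb) - V j sb tb - n * ((sb - sg)\<^sup>2 + (rb - 1)\<^sup>2) - \<beta> * (sb\<^sup>2 + tb\<^sup>2)"
        if "0 \<le> t" "1 / 2 \<le> r" "r \<le> 2" for \<sigma> s t r using mx j that by blast
      fix a assume a: "a \<in> A j"
      have "tb * rb - tb = tb * (rb - 1)" by (simp add: algebra_simps)
      then have "\<bar>tb * rb - tb\<bar> = tb * \<bar>rb - 1\<bar>" using tb by (simp add: abs_mult)
      also have "\<dots> \<le> R * \<epsilon>" using tb tbR R xy by (intro mult_mono) auto
      finally have "\<bar>sg - sb\<bar> + \<bar>tb * rb - tb\<bar> < \<eta>" using xy R\<epsilon> by (simp add: distrib_right)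
      then show "\<bar>l j sg (tb * rb) a - l j sb tb a\<bar> \<le> \<zeta>"
        using \<eta>(2)[OF j a, of "tb * rb" tb sg sb] tb rb by simp
    qed
    moreover have "interior_const R * \<epsilon> \<le> C * \<epsilon>" using C \<epsilon>0 by (intro mult_right_mono) auto
    ultimately show ?thesis by simp
  qed
  moreover have "2 * b * M = lam * m / 4" using pos by (simp add: b_def)
  moreover have "lam * m \<le> lam * (U j sg (tb * rb) - V j sb tb)" using UV pos by (intro mult_left_mono) auto
  moreover have "0 < lam * m" using pos m by simp
  ultimately show False using C\<epsilon> unfolding \<zeta>_def by linarith
qed

end


section \<open>Geometry of the junction\<close>

locale unit_junction =
  fixes e :: "nat \<Rightarrow> real^3" and N :: nat
  assumes e_inj: "inj_on e {0..N}"
    and unit: "\<And>i. i \<in> {0..N} \<Longrightarrow> norm (e i) = 1"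
    and orth: "\<And>i. i \<in> {1..N} \<Longrightarrow> e i \<bullet> e 0 = 0"
begin

definition pt :: "nat \<Rightarrow> real \<Rightarrow> real \<Rightarrow> real^3" where
  "pt i s t = s *\<^sub>R e 0 + t *\<^sub>R e i"

lemma e_sq: "i \<in> {0..N} \<Longrightarrow> e i \<bullet> e i = 1"
  using unit[of i] by (simp add: dot_square_norm)

lemma pt_inner:
  assumes "i \<in> {1..N}"
  shows "pt i s t \<bullet> e 0 = s" "pt i s t \<bullet> e i = t"
  using assms orth[of i] e_sq[of i] e_sq[of 0] by (auto simp: pt_def inner_add_left inner_add_right inner_commute)

lemma half_plane_iff: "x \<in> half_plane e i \<longleftrightarrow> (\<exists>s t. x = pt i s t \<and> 0 \<le> t)"
  by (auto simp: half_plane_def pt_def)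

lemma pt_half_plane: "0 \<le> t \<Longrightarrow> pt i s t \<in> half_plane e i"
  unfolding half_plane_iff by blast

lemma half_plane_coords:
  assumes "i \<in> {1..N}" "x \<in> half_plane e i"
  shows "x = pt i (x \<bullet> e 0) (x \<bullet> e i)" "0 \<le> x \<bullet> e i"
  using assms(2) pt_inner[OF assms(1)] unfolding half_plane_iff by auto

lemma edge_iff: "x \<in> edge e \<longleftrightarrow> (\<exists>s. x = s *\<^sub>R e 0)"
  by (auto simp: edge_def span_singleton)

lemma pt_edge_iff:
  assumes "i \<in> {1..N}"
  shows "pt i s t \<in> edge e \<longleftrightarrow> t = 0"
proof
  assume "pt i s t \<in> edge e"
  then obtain c where "pt i s t = c *\<^sub>R e 0" by (auto simp: edge_iff)
  then have "pt i s t \<bullet> e i = c * (e 0 \<bullet> e i)" by simp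
  then show "t = 0" using pt_inner(2)[OF assms] orth[OF assms] by (simp add: inner_commute)
qed (auto simp: edge_iff pt_def)

lemma pt_0: "pt i s 0 = s *\<^sub>R e 0"
  by (simp add: pt_def)

text \<open>The part of \<open>x\<close> orthogonal to \<open>e 0\<close> is a non-negative multiple
  of \<open>e i\<close> and of \<open>e j\<close>. Equal norms make the two multiples equal, and
  distinct vectors then force them to be 0. The sign matters, since \<open>e j = - e i\<close> is
  allowed.\<close>

lemma half_planes_meet:
  assumes "i \<in> {1..N}" "j \<in> {1..N}" "x \<in> half_plane e i" "x \<in> half_plane e j" "i \<noteq> j"
  shows "x \<bullet> e i = 0"
proof -
  define t where "t = x \<bullet> e i"
  define t' where "t' = x \<bullet> e j"
  have "t *\<^sub>R e i = t' *\<^sub>R e j"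
    using half_plane_coords(1)[OF assms(1,3)] half_plane_coords(1)[OF assms(2,4)]
    unfolding pt_def t_def t'_def by (metis add_left_cancel)
  moreover have "0 \<le> t" "0 \<le> t'" using half_plane_coords(2) assms by (auto simp: t_def t'_def)
  ultimately have tt: "t = t'" using unit assms by (metis abs_of_nonneg atLeastAtMost_iff le0 mult.right_neutral norm_scaleR)
  have "e i \<noteq> e j" using e_inj assms by (auto dest: inj_onD)
  then have "t = 0" using \<open>t *\<^sub>R e i = t' *\<^sub>R e j\<close> tt by auto
  then show ?thesis by (simp add: t_def)
qed

lemma closed_half_plane:
  assumes "i \<in> {1..N}"
  shows "closed (half_plane e i)"
proof -
  have "half_plane e i = {x. x = pt i (x \<bullet> e 0) (x \<bullet> e i)} \<inter> {x. 0 \<le> x \<bullet> e i}"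
  proof (intro equalityI subsetI)
    fix x assume "x \<in> {x. x = pt i (x \<bullet> e 0) (x \<bullet> e i)} \<inter> {x. 0 \<le> x \<bullet> e i}"
    then show "x \<in> half_plane e i" unfolding half_plane_iff by blast
  qed (use half_plane_coords[OF assms] in simp)
  moreover have "closed {x. x = pt i (x \<bullet> e 0) (x \<bullet> e i)}"
    unfolding pt_def by (intro closed_Collect_eq continuous_intros)
  moreover have "closed {x. 0 \<le> x \<bullet> e i}" by (intro closed_Collect_le continuous_intros)
  ultimately show ?thesis by auto
qed

lemma half_plane_subset_junction: "i \<in> {1..N} \<Longrightarrow> half_plane e i \<subseteq> junction e N"
  by (auto simp: junction_def)

lemma pt_dist:
  assumes "i \<in> {1..N}"
  shows "norm (pt i s t - pt i s' t') \<le> \<bar>s - s'\<bar> + \<bar>t - t'\<bar>"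
proof -
  have "pt i s t - pt i s' t' = (s - s') *\<^sub>R e 0 + (t - t') *\<^sub>R e i"
    by (simp add: pt_def algebra_simps)
  also have "norm \<dots> \<le> norm ((s - s') *\<^sub>R e 0) + norm ((t - t') *\<^sub>R e i)" by (rule norm_triangle_ineq)
  also have "\<dots> = \<bar>s - s'\<bar> + \<bar>t - t'\<bar>" using assms unit[of 0] unit[of i] by simp
  finally show ?thesis .
qed

lemma inner_unit_le:
  assumes "i \<in> {0..N}"
  shows "\<bar>x \<bullet> e i\<bar> \<le> norm x"
  using Cauchy_Schwarz_ineq2[of x "e i"] unit[OF assms] by simp

section \<open>Neighbourhoods in the junction\<close>

text \<open>The other half-planes are closed and miss the point, so near it the junction consists of
  branch \<open>i\<close> alone, where a Euclidean ball controls both coordinates.\<close>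

lemma eventually_interior:
  assumes i: "i \<in> {1..N}" and t: "0 < t" and \<eta>: "0 < \<eta>"
    and P: "\<And>s' t'. \<bar>s' - s\<bar> < \<eta> \<Longrightarrow> \<bar>t' - t\<bar> < \<eta> \<Longrightarrow> 0 \<le> t' \<Longrightarrow> P (pt i s' t')"
  shows "\<forall>\<^sub>F y in at (pt i s t) within junction e N. P y"
proof -
  define x where "x = pt i s t"
  define D where "D = (\<Union>j\<in>{1..N} - {i}. half_plane e j)"
  have "closed D" unfolding D_def using closed_half_plane by (intro closed_UN) auto
  have "x \<notin> D"
  proof
    assume "x \<in> D"
    then obtain j where j: "j \<in> {1..N}" "j \<noteq> i" "x \<in> half_plane e j" unfolding D_def by blast
    have "x \<in> half_plane e i" unfolding x_def using t by (intro pt_half_plane) simp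
    with half_planes_meet[OF i j(1) this j(3)] j(2) have "x \<bullet> e i = 0" by simp
    then show False using pt_inner(2)[OF i] t by (simp add: x_def)
  qed
  have "\<forall>y\<in>(- D) \<inter> ball x \<eta>. y \<noteq> x \<longrightarrow> y \<in> junction e N \<longrightarrow> P y"
  proof (intro ballI impI)
    fix y assume y: "y \<in> (- D) \<inter> ball x \<eta>" "y \<in> junction e N"
    then have yi: "y \<in> half_plane e i" by (auto simp: junction_def D_def)
    have d: "norm (y - x) < \<eta>" using y by (simp add: dist_norm norm_minus_commute)
    have "\<bar>(y - x) \<bullet> e 0\<bar> < \<eta>" "\<bar>(y - x) \<bullet> e i\<bar> < \<eta>"
      using inner_unit_le[of 0 "y - x"] inner_unit_le[of i "y - x"] d i by auto
    then have "P (pt i (y \<bullet> e 0) (y \<bullet> e i))"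
      using half_plane_coords(2)[OF i yi] pt_inner[OF i]
      by (intro P) (auto simp: inner_diff_left x_def)
    then show "P y" using half_plane_coords(1)[OF i yi] by simp
  qed
  moreover have "open ((- D) \<inter> ball x \<eta>)" using \<open>closed D\<close> by auto
  moreover have "x \<in> (- D) \<inter> ball x \<eta>" using \<open>x \<notin> D\<close> \<eta> by simp
  ultimately show ?thesis unfolding eventually_at_topological x_def by blast
qed

lemma eventually_edge:
  assumes \<eta>: "0 < \<eta>"
    and P: "\<And>j s' t'. j \<in> {1..N} \<Longrightarrow> \<bar>s' - s\<bar> < \<eta> \<Longrightarrow> 0 \<le> t' \<Longrightarrow> t' < \<eta> \<Longrightarrow> P (pt j s' t')"
  shows "\<forall>\<^sub>F y in at (s *\<^sub>R e 0) within junction e N. P y"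
  unfolding eventually_at
proof (intro exI[of _ \<eta>] conjI ballI impI \<eta>)
  fix y assume y: "y \<in> junction e N" "y \<noteq> s *\<^sub>R e 0 \<and> dist y (s *\<^sub>R e 0) < \<eta>"
  then obtain j where j: "j \<in> {1..N}" "y \<in> half_plane e j" by (auto simp: junction_def)
  define x where "x = pt j s 0"
  have d: "norm (y - x) < \<eta>" using y by (simp add: dist_norm x_def pt_0)
  have "\<bar>(y - x) \<bullet> e 0\<bar> < \<eta>" "\<bar>(y - x) \<bullet> e j\<bar> < \<eta>"
    using inner_unit_le[of 0 "y - x"] inner_unit_le[of j "y - x"] d j by auto
  then have "P (pt j (y \<bullet> e 0) (y \<bullet> e j))"
    using half_plane_coords(2)[OF j] pt_inner[OF j(1)]
    by (intro P j) (auto simp: inner_diff_left x_def)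
  then show "P y" using half_plane_coords(1)[OF j] by simp
qed

section \<open>Quadratic test functions\<close>

text \<open>On the edge the choice of the branch is immaterial, since the normal coordinate vanishes.\<close>

definition quadratic_test ::
    "real \<Rightarrow> real \<Rightarrow> (nat \<Rightarrow> real) \<Rightarrow> (nat \<Rightarrow> real) \<Rightarrow> real^3 \<Rightarrow> real" where
  "quadratic_test a\<^sub>1 a\<^sub>2 b\<^sub>1 b\<^sub>2 x = (let j = (SOME j. j \<in> {1..N} \<and> x \<in> half_plane e j) in
     a\<^sub>1 * (x \<bullet> e 0) + a\<^sub>2 * (x \<bullet> e 0)\<^sup>2 + b\<^sub>1 j * (x \<bullet> e j) + b\<^sub>2 j * (x \<bullet> e j)\<^sup>2)"

lemma quadratic_test_half_plane:
  assumes i: "i \<in> {1..N}" and x: "x \<in> half_plane e i"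
  shows "quadratic_test a\<^sub>1 a\<^sub>2 b\<^sub>1 b\<^sub>2 x =
    a\<^sub>1 * (x \<bullet> e 0) + a\<^sub>2 * (x \<bullet> e 0)\<^sup>2 + b\<^sub>1 i * (x \<bullet> e i) + b\<^sub>2 i * (x \<bullet> e i)\<^sup>2"
proof -
  define j where "j = (SOME j. j \<in> {1..N} \<and> x \<in> half_plane e j)"
  have j: "j \<in> {1..N}" "x \<in> half_plane e j"
    using someI[of "\<lambda>j. j \<in> {1..N} \<and> x \<in> half_plane e j" i] i x by (auto simp: j_def)
  have "b\<^sub>1 j * (x \<bullet> e j) + b\<^sub>2 j * (x \<bullet> e j)\<^sup>2 = b\<^sub>1 i * (x \<bullet> e i) + b\<^sub>2 i * (x \<bullet> e i)\<^sup>2"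
  proof (cases "i = j")
    case False
    then show ?thesis
      using half_planes_meet[OF i j(1) x j(2)] half_planes_meet[OF j(1) i j(2) x] by simp
  qed simp
  then show ?thesis unfolding quadratic_test_def j_def[symmetric] Let_def by simp
qed

lemma quadratic_test_pt:
  assumes "i \<in> {1..N}" "0 \<le> t"
  shows "quadratic_test a\<^sub>1 a\<^sub>2 b\<^sub>1 b\<^sub>2 (pt i s t) = a\<^sub>1 * s + a\<^sub>2 * s\<^sup>2 + b\<^sub>1 i * t + b\<^sub>2 i * t\<^sup>2"
  using quadratic_test_half_plane[OF assms(1) pt_half_plane[OF assms(2)]] pt_inner[OF assms(1)] by simp

lemma quadratic_test_gradient:
  assumes i: "i \<in> {1..N}" and x: "x \<in> half_plane e i"
  shows "has_gradient e i (quadratic_test a\<^sub>1 a\<^sub>2 b\<^sub>1 b\<^sub>2)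
    ((a\<^sub>1 + 2 * a\<^sub>2 * (x \<bullet> e 0)) *\<^sub>R e 0 + (b\<^sub>1 i + 2 * b\<^sub>2 i * (x \<bullet> e i)) *\<^sub>R e i) x"
  unfolding has_gradient_def
proof
  show "(a\<^sub>1 + 2 * a\<^sub>2 * (x \<bullet> e 0)) *\<^sub>R e 0 + (b\<^sub>1 i + 2 * b\<^sub>2 i * (x \<bullet> e i)) *\<^sub>R e i \<in> plane e i"
    unfolding plane_def by (intro span_add span_scale span_base) auto
  have "((\<lambda>x. a\<^sub>1 * (x \<bullet> e 0) + a\<^sub>2 * (x \<bullet> e 0)\<^sup>2 + b\<^sub>1 i * (x \<bullet> e i) + b\<^sub>2 i * (x \<bullet> e i)\<^sup>2) has_derivative
     (\<lambda>h. ((a\<^sub>1 + 2 * a\<^sub>2 * (x \<bullet> e 0)) *\<^sub>R e 0 + (b\<^sub>1 i + 2 * b\<^sub>2 i * (x \<bullet> e i)) *\<^sub>R e i) \<bullet> h))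
     (at x within half_plane e i)"
    by (auto intro!: derivative_eq_intros simp: inner_add_left inner_commute algebra_simps)
  then show "(quadratic_test a\<^sub>1 a\<^sub>2 b\<^sub>1 b\<^sub>2 has_derivative
     (\<lambda>h. ((a\<^sub>1 + 2 * a\<^sub>2 * (x \<bullet> e 0)) *\<^sub>R e 0 + (b\<^sub>1 i + 2 * b\<^sub>2 i * (x \<bullet> e i)) *\<^sub>R e i) \<bullet> h))
     (at x within half_plane e i)"
    by (rule has_derivative_transform[OF x, rotated]) (rule quadratic_test_half_plane[OF i])
qed

text \<open>On the edge \<open>grad\<close> is a limit from outside the edge; continuity of the
  candidate gradient lets \<open>grad_eq\<close> cover that case too.\<close>

lemma quadratic_test_grad:
  assumes i: "i \<in> {1..N}" and x: "x \<in> half_plane e i"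
  shows "grad e i (quadratic_test a\<^sub>1 a\<^sub>2 b\<^sub>1 b\<^sub>2) x
    = (a\<^sub>1 + 2 * a\<^sub>2 * (x \<bullet> e 0)) *\<^sub>R e 0 + (b\<^sub>1 i + 2 * b\<^sub>2 i * (x \<bullet> e i)) *\<^sub>R e i"
  by (rule grad_eq[OF unit unit orth _ quadratic_test_gradient x])
     (use i in \<open>auto intro!: continuous_intros\<close>)

lemma quadratic_test_in_test_functions: "quadratic_test a\<^sub>1 a\<^sub>2 b\<^sub>1 b\<^sub>2 \<in> test_functions e N"
proof -
  have "continuous_on (junction e N) (quadratic_test a\<^sub>1 a\<^sub>2 b\<^sub>1 b\<^sub>2)"
    unfolding junction_def
  proof (rule continuous_on_closed_Union)
    fix i assume i: "i \<in> {1..N}"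
    show "closed (half_plane e i)" by (rule closed_half_plane[OF i])
    show "continuous_on (half_plane e i) (quadratic_test a\<^sub>1 a\<^sub>2 b\<^sub>1 b\<^sub>2)"
      by (rule continuous_on_eq[OF _ quadratic_test_half_plane[OF i, symmetric]])
         (auto intro!: continuous_intros)
  qed simp
  moreover have "C1_half_plane e i (quadratic_test a\<^sub>1 a\<^sub>2 b\<^sub>1 b\<^sub>2)" if i: "i \<in> {1..N}" for i
    unfolding C1_half_plane_def
  proof (intro conjI ballI)
    fix x assume "x \<in> half_plane e i - edge e"
    then show "quadratic_test a\<^sub>1 a\<^sub>2 b\<^sub>1 b\<^sub>2 differentiable (at x within half_plane e i)"
      using quadratic_test_gradient[OF i, of x] unfolding has_gradient_def differentiable_def by blast
  next
    show "continuous_on (half_plane e i) (grad e i (quadratic_test a\<^sub>1 a\<^sub>2 b\<^sub>1 b\<^sub>2))"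
      by (rule continuous_on_eq[OF _ quadratic_test_grad[OF i, symmetric]])
         (auto intro!: continuous_intros)
  qed
  ultimately show ?thesis by (simp add: test_functions_def)
qed

end


section \<open>Hamiltonians as suprema over the controls\<close>

lemma SUP_upper_bounded:
  fixes h :: "'a \<Rightarrow> real"
  assumes "a \<in> B" "\<And>b. b \<in> B \<Longrightarrow> h b \<le> C"
  shows "h a \<le> (SUP b\<in>B. h b)"
  using assms by (intro cSUP_upper bdd_aboveI2)

text \<open>Source of the \<epsilon> in \<open>super_interior\<close> and \<open>super_edge\<close>:
  an almost optimal control is enough there.\<close>

lemma SUP_approx:
  fixes h :: "'a \<Rightarrow> real"
  assumes "B \<noteq> {}" "\<And>b. b \<in> B \<Longrightarrow> h b \<le> C" "0 < \<epsilon>"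
  shows "\<exists>a\<in>B. (SUP b\<in>B. h b) - \<epsilon> \<le> h a"
proof -
  have "bdd_above (h ` B)" using assms(2) by (intro bdd_aboveI2)
  then have "\<exists>a\<in>B. (SUP b\<in>B. h b) - \<epsilon> < h a"
    using less_cSUP_iff[OF assms(1), of h "(SUP b\<in>B. h b) - \<epsilon>"] assms(3) by simp
  then show ?thesis by (meson less_imp_le)
qed

section \<open>Comparison on the junction\<close>

theorem theorem3p4:
  fixes e :: "nat \<Rightarrow> real^3" and N :: nat and lam :: real
    and A :: "nat \<Rightarrow> 'a::metric_space set"
    and f :: "nat \<Rightarrow> real^3 \<Rightarrow> 'a \<Rightarrow> real^3"
    and l :: "nat \<Rightarrow> real^3 \<Rightarrow> 'a \<Rightarrow> real"
    and u v :: "real^3 \<Rightarrow> real"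
  assumes N: "N > 1"
    and e_distinct: "inj_on e {0..N}"
    and e_unit: "\<And>i. i \<in> {0..N} \<Longrightarrow> norm (e i) = 1"
    and e_orth: "\<And>i. i \<in> {1..N} \<Longrightarrow> e i \<bullet> e 0 = 0"
    and lam: "lam > 0"
    and H0_A: "\<And>i. i \<in> {1..N} \<Longrightarrow> A i \<noteq> {} \<and> compact (A i)"
    and H0_disjoint: "disjoint_family_on A {1..N}"
    and H0_range: "\<And>i x a. i \<in> {1..N} \<Longrightarrow> x \<in> half_plane e i \<Longrightarrow> a \<in> A i \<Longrightarrow> f i x a \<in> plane e i"
    and H0_cont: "\<And>i. i \<in> {1..N} \<Longrightarrow> continuous_on (half_plane e i \<times> A i) (\<lambda>(x, a). f i x a)"
    and H0_bdd: "\<And>i. i \<in> {1..N} \<Longrightarrow> bounded ((\<lambda>(x, a). f i x a) ` (half_plane e i \<times> A i))"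
    and H0_Lipschitz: "\<exists>L>0. \<forall>i\<in>{1..N}. \<forall>x\<in>half_plane e i. \<forall>y\<in>half_plane e i. \<forall>a\<in>A i.
           norm (f i x a - f i y a) \<le> L * norm (x - y)"
    and H1_cont: "\<And>i. i \<in> {1..N} \<Longrightarrow> continuous_on (half_plane e i \<times> A i) (\<lambda>(x, a). l i x a)"
    and H1_bdd: "\<And>i. i \<in> {1..N} \<Longrightarrow> bounded ((\<lambda>(x, a). l i x a) ` (half_plane e i \<times> A i))"
    and H1_modulus: "\<exists>\<omega>. modulus_of_continuity \<omega> \<and>
           (\<forall>i\<in>{1..N}. \<forall>x\<in>half_plane e i. \<forall>y\<in>half_plane e i. \<forall>a\<in>A i.
              \<bar>l i x a - l i y a\<bar> \<le> \<omega> (norm (x - y)))"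
    and H2: "\<And>i x. i \<in> {1..N} \<Longrightarrow> x \<in> half_plane e i \<Longrightarrow> convex ((\<lambda>a. (f i x a, l i x a)) ` A i)"
    and H3: "\<exists>\<delta>>0. \<forall>i\<in>{1..N}. \<forall>x\<in>edge e. {-\<delta>..\<delta>} \<subseteq> (\<lambda>a. f i x a \<bullet> e i) ` A i"
    and u: "bounded (u ` junction e N)" "viscosity_subsolution e N A f l lam u"
    and v: "bounded (v ` junction e N)" "viscosity_supersolution e N A f l lam v"
  shows "\<forall>x\<in>junction e N. u x \<le> v x"
proof -
  interpret unit_junction e N
    using N e_distinct e_unit e_orth by unfold_locales auto
  have "\<exists>B. \<forall>x\<in>half_plane e i. \<forall>a\<in>A i. norm (f i x a) \<le> B" if "i \<in> {1..N}" for i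
    using H0_bdd[OF that] by (fastforce simp: bounded_iff)
  then obtain Bf where Bf: "\<And>i x a. i \<in> {1..N} \<Longrightarrow> x \<in> half_plane e i \<Longrightarrow> a \<in> A i \<Longrightarrow> norm (f i x a) \<le> Bf i"
    by metis
  have "\<exists>B. \<forall>x\<in>half_plane e i. \<forall>a\<in>A i. \<bar>l i x a\<bar> \<le> B" if "i \<in> {1..N}" for i
    using H1_bdd[OF that] by (fastforce simp: bounded_iff)
  then obtain Bl where Bl: "\<And>i x a. i \<in> {1..N} \<Longrightarrow> x \<in> half_plane e i \<Longrightarrow> a \<in> A i \<Longrightarrow> \<bar>l i x a\<bar> \<le> Bl i"
    by metis
  obtain Bu Bv where Bu: "\<And>x. x \<in> junction e N \<Longrightarrow> \<bar>u x\<bar> \<le> Bu"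
    and Bv: "\<And>x. x \<in> junction e N \<Longrightarrow> \<bar>v x\<bar> \<le> Bv"
    using u(1) v(1) by (auto simp: bounded_iff)
  \<comment> \<open>One bound for \<open>u\<close>, \<open>v\<close> and the data of all branches.
    The summand 1 makes it positive, as later constants divide by it.\<close>
  define M where "M = 1 + \<bar>Bu\<bar> + \<bar>Bv\<bar> + (\<Sum>i\<in>{1..N}. \<bar>Bf i\<bar> + \<bar>Bl i\<bar>)"
  have sum0: "0 \<le> (\<Sum>i\<in>{1..N}. \<bar>Bf i\<bar> + \<bar>Bl i\<bar>)" by (intro sum_nonneg) auto
  have "\<bar>Bf i\<bar> + \<bar>Bl i\<bar> \<le> M" if "i \<in> {1..N}" for i
  proof -
    have "\<bar>Bf i\<bar> + \<bar>Bl i\<bar> \<le> (\<Sum>i\<in>{1..N}. \<bar>Bf i\<bar> + \<bar>Bl i\<bar>)" using that by (intro member_le_sum) auto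
    then show ?thesis by (simp add: M_def)
  qed
  then have fM: "norm (f i x a) \<le> M" and lM: "\<bar>l i x a\<bar> \<le> M"
    if "i \<in> {1..N}" "x \<in> half_plane e i" "a \<in> A i" for i x a
    using Bf[OF that] Bl[OF that] that(1) by fastforce+
  have uM: "\<bar>u x\<bar> \<le> M" and vM: "\<bar>v x\<bar> \<le> M" if "x \<in> junction e N" for x
    using Bu[OF that] Bv[OF that] sum0 by (auto simp: M_def)
  have M: "0 < M" using sum0 by (simp add: M_def)
  obtain L where L: "0 < L" "\<And>i x y a. i \<in> {1..N} \<Longrightarrow> x \<in> half_plane e i \<Longrightarrow> y \<in> half_plane e i \<Longrightarrow>
      a \<in> A i \<Longrightarrow> norm (f i x a - f i y a) \<le> L * norm (x - y)"
    using H0_Lipschitz by blast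
  obtain \<omega> where \<omega>: "modulus_of_continuity \<omega>" "\<And>i x y a. i \<in> {1..N} \<Longrightarrow> x \<in> half_plane e i \<Longrightarrow>
      y \<in> half_plane e i \<Longrightarrow> a \<in> A i \<Longrightarrow> \<bar>l i x a - l i y a\<bar> \<le> \<omega> (norm (x - y))"
    using H1_modulus by blast
  obtain \<delta> where \<delta>: "0 < \<delta>" "\<And>i x. i \<in> {1..N} \<Longrightarrow> x \<in> edge e \<Longrightarrow> {-\<delta>..\<delta>} \<subseteq> (\<lambda>a. f i x a \<bullet> e i) ` A i"
    using H3 by blast
  have pt_J: "pt i s t \<in> junction e N" if "i \<in> {1..N}" "0 \<le> t" for i s t
    using pt_half_plane[OF that(2)] half_plane_subset_junction[OF that(1)] by blast
  have comp_le: "\<bar>x \<bullet> e i\<bar> \<le> C" if "norm x \<le> C" "i \<in> {0..N}" for x i C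
    using inner_unit_le[OF that(2), of x] that(1) by linarith
  have integrand_le: "- (p \<bullet> f i x a) - l i x a \<le> norm p * M + M"
    if "i \<in> {1..N}" "x \<in> half_plane e i" "a \<in> A i" for i x a p
  proof -
    have "\<bar>p \<bullet> f i x a\<bar> \<le> norm p * norm (f i x a)" by (rule Cauchy_Schwarz_ineq2)
    also have "\<dots> \<le> norm p * M" using fM[OF that] by (intro mult_left_mono) auto
    finally show ?thesis using lM[OF that] by linarith
  qed
  have pt_cont: "continuous_on S (\<lambda>z. pt i (fst z) (snd z))" for S i
    unfolding pt_def by (intro continuous_intros)
  have grad_inner: "((a\<^sub>1 *\<^sub>R e 0 + b\<^sub>1 *\<^sub>R e i) \<bullet> w) = a\<^sub>1 * (w \<bullet> e 0) + b\<^sub>1 * (w \<bullet> e i)" for a\<^sub>1 b\<^sub>1 i w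
    by (simp add: inner_add_left inner_add_right inner_commute)
  have grad_pt: "grad e i (quadratic_test a\<^sub>1 a\<^sub>2 b\<^sub>1 b\<^sub>2) (pt i s t)
      = (a\<^sub>1 + 2 * a\<^sub>2 * s) *\<^sub>R e 0 + (b\<^sub>1 i + 2 * b\<^sub>2 i * t) *\<^sub>R e i"
    if "i \<in> {1..N}" "0 \<le> t" for i a\<^sub>1 a\<^sub>2 b\<^sub>1 b\<^sub>2 s t
    using quadratic_test_grad[OF that(1) pt_half_plane[OF that(2)]] pt_inner[OF that(1)] by simp
  \<comment> \<open>The speed 0 is among the controllable ones, so the supremum in
    \<open>ham_plus\<close> runs over a non-empty set.\<close>
  have inward: "{a \<in> A i. 0 \<le> f i (pt i s 0) a \<bullet> e i} \<noteq> {}" if "i \<in> {1..N}" for i s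
  proof -
    have "(0 :: real) \<in> {-\<delta>..\<delta>}" using \<delta>(1) by simp
    moreover have "pt i s 0 \<in> edge e" using pt_edge_iff[OF that] by simp
    ultimately have "0 \<in> (\<lambda>a. f i (pt i s 0) a \<bullet> e i) ` A i" using \<delta>(2)[OF that] by blast
    then show ?thesis by auto
  qed
  \<comment> \<open>The test conditions of the locale are the viscosity inequalities for
    \<open>quadratic_test\<close>. For \<open>u\<close> each control is dominated by the supremum;
    for \<open>v\<close> an almost optimal control is selected.\<close>
  interpret J: junction_coords "{1..N}" "\<lambda>i s t. u (pt i s t)" "\<lambda>i s t. v (pt i s t)" A
    "\<lambda>i s t a. f i (pt i s t) a \<bullet> e 0" "\<lambda>i s t a. f i (pt i s t) a \<bullet> e i" "\<lambda>i s t a. l i (pt i s t) a"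
    lam M L \<delta>
  proof
    show "finite {1..N}" "{1..N} \<noteq> {}" using N by auto
    show "u (pt i s 0) = u (pt j s 0)" "v (pt i s 0) = v (pt j s 0)" for i j s by (simp_all add: pt_0)
    show "0 < lam" "0 < M" "0 < L" "0 < \<delta>" by fact+
  next
    fix i assume i: "i \<in> {1..N}"
    have im: "(\<lambda>z. pt i (fst z) (snd z)) ` {z. 0 \<le> snd z} \<subseteq> junction e N" using pt_J[OF i] by auto
    show "usc_on {z. 0 \<le> snd z} (\<lambda>z. u (pt i (fst z) (snd z)))"
      using usc_on_compose[OF _ pt_cont im, of u] u(2) by (simp add: viscosity_subsolution_def)
    show "usc_on {z. 0 \<le> snd z} (\<lambda>z. - v (pt i (fst z) (snd z)))"
      using usc_on_compose[OF usc_on_uminus_lsc pt_cont im, of v] v(2)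
      by (simp add: viscosity_supersolution_def)
  next
    fix i s t assume i: "i \<in> {1..N}" and t: "0 \<le> (t :: real)"
    show "\<bar>u (pt i s t)\<bar> \<le> M" "\<bar>v (pt i s t)\<bar> \<le> M" using uM vM pt_J[OF i t] by auto
    fix a assume a: "a \<in> A i"
    show "\<bar>f i (pt i s t) a \<bullet> e 0\<bar> \<le> M" "\<bar>f i (pt i s t) a \<bullet> e i\<bar> \<le> M" "\<bar>l i (pt i s t) a\<bar> \<le> M"
      using fM[OF i pt_half_plane[OF t] a] lM[OF i pt_half_plane[OF t] a] i by (auto intro!: comp_le)
    fix s' t' assume t': "0 \<le> (t' :: real)"
    have "norm (f i (pt i s t) a - f i (pt i s' t') a) \<le> L * norm (pt i s t - pt i s' t')"
      by (rule L(2)[OF i pt_half_plane[OF t] pt_half_plane[OF t'] a])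
    also have "\<dots> \<le> L * (\<bar>s - s'\<bar> + \<bar>t - t'\<bar>)" using pt_dist[OF i] L(1) by (intro mult_left_mono) auto
    finally have lip: "norm (f i (pt i s t) a - f i (pt i s' t') a) \<le> L * (\<bar>s - s'\<bar> + \<bar>t - t'\<bar>)" .
    show "\<bar>f i (pt i s t) a \<bullet> e 0 - f i (pt i s' t') a \<bullet> e 0\<bar> \<le> L * (\<bar>s - s'\<bar> + \<bar>t - t'\<bar>)"
      using comp_le[OF lip, of 0] by (simp add: inner_diff_left)
    show "\<bar>f i (pt i s t) a \<bullet> e i - f i (pt i s' t') a \<bullet> e i\<bar> \<le> L * (\<bar>s - s'\<bar> + \<bar>t - t'\<bar>)"
      using comp_le[OF lip, of i] i by (simp add: inner_diff_left)
  next
    fix \<epsilon> :: real assume \<epsilon>: "0 < \<epsilon>"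
    have "(\<omega> \<longlongrightarrow> 0) (at_right 0)" using \<omega>(1) by (simp add: modulus_of_continuity_def)
    then have "\<forall>\<^sub>F d in at_right 0. \<omega> d < \<epsilon>" using \<epsilon> by (rule order_tendstoD)
    then obtain \<eta> where \<eta>: "0 < \<eta>" "\<And>d. 0 < d \<Longrightarrow> d < \<eta> \<Longrightarrow> \<omega> d < \<epsilon>"
      unfolding eventually_at_right_field by auto
    \<comment> \<open>The limit from the right says nothing at 0, where
      \<open>\<omega> 0 = 0\<close> is used instead.\<close>
    have \<omega>\<eta>: "\<omega> d < \<epsilon>" if "0 \<le> d" "d < \<eta>" for d
      using \<eta>(2)[of d] \<omega>(1) \<epsilon> that by (cases "d = 0") (auto simp: modulus_of_continuity_def)
    show "\<exists>\<eta>>0. \<forall>i\<in>{1..N}. \<forall>s s' t t'. \<forall>a\<in>A i. 0 \<le> t \<longrightarrow> 0 \<le> t' \<longrightarrow>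
          \<bar>s - s'\<bar> + \<bar>t - t'\<bar> < \<eta> \<longrightarrow> \<bar>l i (pt i s t) a - l i (pt i s' t') a\<bar> < \<epsilon>"
    proof (intro exI[of _ \<eta>] conjI ballI allI impI \<eta>(1))
      fix i s s' t t' a assume i: "i \<in> {1..N}" and a: "a \<in> A i" and t: "0 \<le> t" "0 \<le> (t' :: real)"
        and d: "\<bar>s - s'\<bar> + \<bar>t - t'\<bar> < \<eta>"
      have "\<omega> (norm (pt i s t - pt i s' t')) < \<epsilon>" using pt_dist[OF i, of s t s' t'] d by (intro \<omega>\<eta>) auto
      then show "\<bar>l i (pt i s t) a - l i (pt i s' t') a\<bar> < \<epsilon>"
        using \<omega>(2)[OF i pt_half_plane[OF t(1)] pt_half_plane[OF t(2)] a, of s s'] by linarith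
    qed
  next
    fix i s y assume i: "i \<in> {1..N}" and y: "\<bar>y\<bar> \<le> \<delta>"
    have "y \<in> {-\<delta>..\<delta>}" using y by (simp add: abs_le_iff)
    moreover have "pt i s 0 \<in> edge e" using pt_edge_iff[OF i] by simp
    ultimately have "y \<in> (\<lambda>a. f i (pt i s 0) a \<bullet> e i) ` A i" using \<delta>(2)[OF i] by blast
    then show "\<exists>a\<in>A i. f i (pt i s 0) a \<bullet> e i = y" by auto
  next
    fix i s a b and \<mu> :: real
    assume i: "i \<in> {1..N}" and ab: "a \<in> A i" "b \<in> A i" and \<mu>: "0 \<le> \<mu>" "\<mu> \<le> 1"
    define h where "h = (\<lambda>a. (f i (pt i s 0) a, l i (pt i s 0) a))"
    have "convex (h ` A i)" unfolding h_def by (rule H2[OF i pt_half_plane]) simp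
    then have "(1 - \<mu>) *\<^sub>R h a + \<mu> *\<^sub>R h b \<in> h ` A i" using ab \<mu> by (auto simp: convex_alt)
    then obtain c where "c \<in> A i" "h c = (1 - \<mu>) *\<^sub>R h a + \<mu> *\<^sub>R h b" by auto
    then show "\<exists>c\<in>A i. f i (pt i s 0) c \<bullet> e 0 = (1 - \<mu>) * (f i (pt i s 0) a \<bullet> e 0) + \<mu> * (f i (pt i s 0) b \<bullet> e 0) \<and>
        f i (pt i s 0) c \<bullet> e i = (1 - \<mu>) * (f i (pt i s 0) a \<bullet> e i) + \<mu> * (f i (pt i s 0) b \<bullet> e i) \<and>
        l i (pt i s 0) c = (1 - \<mu>) * l i (pt i s 0) a + \<mu> * l i (pt i s 0) b"
      by (intro bexI[of _ c]) (auto simp: h_def inner_add_left)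
  next
    fix i s t \<eta> a\<^sub>1 a\<^sub>2 b\<^sub>1 b\<^sub>2 a
    assume i: "i \<in> {1..N}" and t: "0 < (t :: real)" and \<eta>: "0 < (\<eta> :: real)" and a: "a \<in> A i"
      and mx: "\<And>s' t'. \<bar>s' - s\<bar> < \<eta> \<Longrightarrow> \<bar>t' - t\<bar> < \<eta> \<Longrightarrow> 0 \<le> t' \<Longrightarrow>
        u (pt i s' t') - (a\<^sub>1 * s' + a\<^sub>2 * s'\<^sup>2 + b\<^sub>1 * t' + b\<^sub>2 * t'\<^sup>2)
        \<le> u (pt i s t) - (a\<^sub>1 * s + a\<^sub>2 * s\<^sup>2 + b\<^sub>1 * t + b\<^sub>2 * t\<^sup>2)"
    define \<phi> where "\<phi> = quadratic_test a\<^sub>1 a\<^sub>2 (\<lambda>_. b\<^sub>1) (\<lambda>_. b\<^sub>2)"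
    have "\<forall>\<^sub>F y in at (pt i s t) within junction e N. u y - \<phi> y \<le> u (pt i s t) - \<phi> (pt i s t)"
      unfolding \<phi>_def by (rule eventually_interior[OF i t \<eta>]) (use mx t in \<open>simp add: quadratic_test_pt[OF i]\<close>)
    then have "local_max_on (junction e N) (\<lambda>y. u y - \<phi> y) (pt i s t)"
      using pt_J[OF i] t by (simp add: local_max_on_def)
    moreover have "\<phi> \<in> test_functions e N" unfolding \<phi>_def by (rule quadratic_test_in_test_functions)
    moreover have hp: "pt i s t \<in> half_plane e i" using t by (intro pt_half_plane) simp
    ultimately have "lam * u (pt i s t) + ham A f l i (pt i s t) (grad e i \<phi> (pt i s t)) \<le> 0"
      using u(2) pt_edge_iff[OF i, of s t] t i pt_J[OF i, of t s]
      unfolding viscosity_subsolution_def by auto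
    moreover have "- (grad e i \<phi> (pt i s t) \<bullet> f i (pt i s t) a) - l i (pt i s t) a
        \<le> ham A f l i (pt i s t) (grad e i \<phi> (pt i s t))"
      unfolding ham_def by (rule SUP_upper_bounded[OF a]) (rule integrand_le[OF i hp])
    moreover have "grad e i \<phi> (pt i s t) \<bullet> f i (pt i s t) a = (a\<^sub>1 + 2 * a\<^sub>2 * s) * (f i (pt i s t) a \<bullet> e 0)
        + (b\<^sub>1 + 2 * b\<^sub>2 * t) * (f i (pt i s t) a \<bullet> e i)"
      unfolding \<phi>_def grad_pt[OF i less_imp_le[OF t]] grad_inner ..
    ultimately show "lam * u (pt i s t) - (a\<^sub>1 + 2 * a\<^sub>2 * s) * (f i (pt i s t) a \<bullet> e 0)
        - (b\<^sub>1 + 2 * b\<^sub>2 * t) * (f i (pt i s t) a \<bullet> e i) - l i (pt i s t) a \<le> 0" by linarith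
  next
    fix i s \<eta> a\<^sub>1 a\<^sub>2 b\<^sub>1 b\<^sub>2 a
    assume \<eta>: "0 < (\<eta> :: real)" and i: "i \<in> {1..N}" and a: "a \<in> A i" "0 \<le> f i (pt i s 0) a \<bullet> e i"
      and mx: "\<And>j s' t'. j \<in> {1..N} \<Longrightarrow> \<bar>s' - s\<bar> < \<eta> \<Longrightarrow> 0 \<le> t' \<Longrightarrow> t' < \<eta> \<Longrightarrow>
        u (pt j s' t') - (a\<^sub>1 * s' + a\<^sub>2 * s'\<^sup>2 + b\<^sub>1 j * t' + b\<^sub>2 j * t'\<^sup>2)
        \<le> u (pt j s 0) - (a\<^sub>1 * s + a\<^sub>2 * s\<^sup>2)"
    define \<phi> where "\<phi> = quadratic_test a\<^sub>1 a\<^sub>2 b\<^sub>1 b\<^sub>2"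
    have \<phi>0: "\<phi> (s *\<^sub>R e 0) = a\<^sub>1 * s + a\<^sub>2 * s\<^sup>2"
      using quadratic_test_pt[OF i, of 0 a\<^sub>1 a\<^sub>2 b\<^sub>1 b\<^sub>2 s] by (simp add: \<phi>_def pt_0)
    have "\<forall>\<^sub>F y in at (s *\<^sub>R e 0) within junction e N. u y - \<phi> y \<le> u (s *\<^sub>R e 0) - \<phi> (s *\<^sub>R e 0)"
      by (rule eventually_edge[OF \<eta>]) (use mx in \<open>simp add: \<phi>0 pt_0, simp add: \<phi>_def quadratic_test_pt\<close>)
    then have lm: "local_max_on (junction e N) (\<lambda>y. u y - \<phi> y) (pt i s 0)"
      using pt_J[OF i, of 0 s] by (simp add: local_max_on_def pt_0)
    have \<phi>: "\<phi> \<in> test_functions e N" unfolding \<phi>_def by (rule quadratic_test_in_test_functions)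
    have "pt i s 0 \<in> edge e" using pt_edge_iff[OF i] by simp
    then have "lam * u (pt i s 0) + ham_edge e N A f l (pt i s 0) (\<lambda>j. grad e j \<phi> (pt i s 0)) \<le> 0"
      using u(2)[unfolded viscosity_subsolution_def, THEN conjunct2, THEN bspec, OF \<phi>,
          THEN bspec, OF pt_J[OF i order_refl], THEN mp, OF lm] by simp
    moreover have "ham_plus e A f l i (pt i s 0) (grad e i \<phi> (pt i s 0))
        \<le> ham_edge e N A f l (pt i s 0) (\<lambda>j. grad e j \<phi> (pt i s 0))"
      unfolding ham_edge_def using i by (intro Max_ge) auto
    moreover have "- (grad e i \<phi> (pt i s 0) \<bullet> f i (pt i s 0) a) - l i (pt i s 0) a
        \<le> ham_plus e A f l i (pt i s 0) (grad e i \<phi> (pt i s 0))"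
      unfolding ham_plus_def
      by (rule SUP_upper_bounded) (use a integrand_le[OF i pt_half_plane] in auto)
    moreover have "grad e i \<phi> (pt i s 0) \<bullet> f i (pt i s 0) a = (a\<^sub>1 + 2 * a\<^sub>2 * s) * (f i (pt i s 0) a \<bullet> e 0)
        + b\<^sub>1 i * (f i (pt i s 0) a \<bullet> e i)"
      unfolding \<phi>_def grad_pt[OF i order_refl] grad_inner by simp
    ultimately show "lam * u (pt i s 0) - (a\<^sub>1 + 2 * a\<^sub>2 * s) * (f i (pt i s 0) a \<bullet> e 0)
        - b\<^sub>1 i * (f i (pt i s 0) a \<bullet> e i) - l i (pt i s 0) a \<le> 0" by linarith
  next
    fix i s t \<eta> a\<^sub>1 a\<^sub>2 b\<^sub>1 b\<^sub>2 \<epsilon>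
    assume i: "i \<in> {1..N}" and t: "0 < (t :: real)" and \<eta>: "0 < (\<eta> :: real)" and \<epsilon>: "0 < (\<epsilon> :: real)"
      and mn: "\<And>s' t'. \<bar>s' - s\<bar> < \<eta> \<Longrightarrow> \<bar>t' - t\<bar> < \<eta> \<Longrightarrow> 0 \<le> t' \<Longrightarrow>
        v (pt i s t) - (a\<^sub>1 * s + a\<^sub>2 * s\<^sup>2 + b\<^sub>1 * t + b\<^sub>2 * t\<^sup>2)
        \<le> v (pt i s' t') - (a\<^sub>1 * s' + a\<^sub>2 * s'\<^sup>2 + b\<^sub>1 * t' + b\<^sub>2 * t'\<^sup>2)"
    define \<phi> where "\<phi> = quadratic_test a\<^sub>1 a\<^sub>2 (\<lambda>_. b\<^sub>1) (\<lambda>_. b\<^sub>2)"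
    have "\<forall>\<^sub>F y in at (pt i s t) within junction e N. v (pt i s t) - \<phi> (pt i s t) \<le> v y - \<phi> y"
      unfolding \<phi>_def by (rule eventually_interior[OF i t \<eta>]) (use mn t in \<open>simp add: quadratic_test_pt[OF i]\<close>)
    then have "local_min_on (junction e N) (\<lambda>y. v y - \<phi> y) (pt i s t)"
      using pt_J[OF i] t by (simp add: local_min_on_def)
    moreover have "\<phi> \<in> test_functions e N" unfolding \<phi>_def by (rule quadratic_test_in_test_functions)
    moreover have hp: "pt i s t \<in> half_plane e i" using t by (intro pt_half_plane) simp
    ultimately have "0 \<le> lam * v (pt i s t) + ham A f l i (pt i s t) (grad e i \<phi> (pt i s t))"
      using v(2) pt_edge_iff[OF i, of s t] t i pt_J[OF i, of t s]
      unfolding viscosity_supersolution_def by auto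
    moreover obtain a where a: "a \<in> A i" "ham A f l i (pt i s t) (grad e i \<phi> (pt i s t)) - \<epsilon>
        \<le> - (grad e i \<phi> (pt i s t) \<bullet> f i (pt i s t) a) - l i (pt i s t) a"
      using SUP_approx[of "A i" "\<lambda>a. - (grad e i \<phi> (pt i s t) \<bullet> f i (pt i s t) a) - l i (pt i s t) a",
          OF _ integrand_le[OF i hp] \<epsilon>] H0_A[OF i]
      unfolding ham_def by auto
    moreover have "grad e i \<phi> (pt i s t) \<bullet> f i (pt i s t) a = (a\<^sub>1 + 2 * a\<^sub>2 * s) * (f i (pt i s t) a \<bullet> e 0)
        + (b\<^sub>1 + 2 * b\<^sub>2 * t) * (f i (pt i s t) a \<bullet> e i)"
      unfolding \<phi>_def grad_pt[OF i less_imp_le[OF t]] grad_inner ..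
    ultimately have "- \<epsilon> \<le> lam * v (pt i s t) - (a\<^sub>1 + 2 * a\<^sub>2 * s) * (f i (pt i s t) a \<bullet> e 0)
        - (b\<^sub>1 + 2 * b\<^sub>2 * t) * (f i (pt i s t) a \<bullet> e i) - l i (pt i s t) a" by linarith
    with a(1) show "\<exists>a\<in>A i. - \<epsilon> \<le> lam * v (pt i s t) - (a\<^sub>1 + 2 * a\<^sub>2 * s) * (f i (pt i s t) a \<bullet> e 0)
        - (b\<^sub>1 + 2 * b\<^sub>2 * t) * (f i (pt i s t) a \<bullet> e i) - l i (pt i s t) a" by blast
  next
    fix s \<eta> a\<^sub>1 a\<^sub>2 b\<^sub>1 b\<^sub>2 \<epsilon>
    assume \<eta>: "0 < (\<eta> :: real)" and \<epsilon>: "0 < (\<epsilon> :: real)"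
      and mn: "\<And>j s' t'. j \<in> {1..N} \<Longrightarrow> \<bar>s' - s\<bar> < \<eta> \<Longrightarrow> 0 \<le> t' \<Longrightarrow> t' < \<eta> \<Longrightarrow>
        v (pt j s 0) - (a\<^sub>1 * s + a\<^sub>2 * s\<^sup>2)
        \<le> v (pt j s' t') - (a\<^sub>1 * s' + a\<^sub>2 * s'\<^sup>2 + b\<^sub>1 j * t' + b\<^sub>2 j * t'\<^sup>2)"
    define \<phi> where "\<phi> = quadratic_test a\<^sub>1 a\<^sub>2 b\<^sub>1 b\<^sub>2"
    define x where "x = s *\<^sub>R e 0"
    have x: "pt i s 0 = x" for i by (simp add: pt_0 x_def)
    have one: "1 \<in> {1..N}" using N by simp
    have \<phi>0: "\<phi> x = a\<^sub>1 * s + a\<^sub>2 * s\<^sup>2"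
      using quadratic_test_pt[OF one, of 0 a\<^sub>1 a\<^sub>2 b\<^sub>1 b\<^sub>2 s] by (simp add: \<phi>_def x)
    have "\<forall>\<^sub>F y in at (s *\<^sub>R e 0) within junction e N. v x - \<phi> x \<le> v y - \<phi> y"
      by (rule eventually_edge[OF \<eta>]) (use mn in \<open>simp add: \<phi>0 x, simp add: \<phi>_def quadratic_test_pt\<close>)
    then have "local_min_on (junction e N) (\<lambda>y. v y - \<phi> y) x"
      using pt_J[OF one, of 0 s] by (simp add: local_min_on_def x x_def[symmetric])
    moreover have "\<phi> \<in> test_functions e N" unfolding \<phi>_def by (rule quadratic_test_in_test_functions)
    ultimately have "0 \<le> lam * v x + ham_edge e N A f l x (\<lambda>i. grad e i \<phi> x)"
      using v(2) pt_edge_iff[OF one, of s 0] pt_J[OF one, of 0 s]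
      unfolding viscosity_supersolution_def x by auto
    \<comment> \<open>The maximum over the finitely many branches is attained; the branch that
      attains it is the one asked for by \<open>super_edge\<close>.\<close>
    moreover have "ham_edge e N A f l x (\<lambda>i. grad e i \<phi> x) \<in> (\<lambda>i. ham_plus e A f l i x (grad e i \<phi> x)) ` {1..N}"
      unfolding ham_edge_def using one by (intro Max_in) auto
    ultimately obtain i where i: "i \<in> {1..N}" and ge: "0 \<le> lam * v x + ham_plus e A f l i x (grad e i \<phi> x)"
      by auto
    have hp: "x \<in> half_plane e i" using pt_half_plane[of 0 i s] by (simp add: x)
    obtain a where a: "a \<in> A i" "0 \<le> f i x a \<bullet> e i" and
      "ham_plus e A f l i x (grad e i \<phi> x) - \<epsilon> \<le> - (grad e i \<phi> x \<bullet> f i x a) - l i x a"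
      using SUP_approx[OF inward[OF i, of s], of "\<lambda>a. - (grad e i \<phi> x \<bullet> f i x a) - l i x a"
          "norm (grad e i \<phi> x) * M + M", OF _ \<epsilon>] integrand_le[OF i hp]
      unfolding ham_plus_def x by auto
    moreover have "grad e i \<phi> x \<bullet> f i x a = (a\<^sub>1 + 2 * a\<^sub>2 * s) * (f i x a \<bullet> e 0) + b\<^sub>1 i * (f i x a \<bullet> e i)"
      using grad_pt[OF i order_refl, of a\<^sub>1 a\<^sub>2 b\<^sub>1 b\<^sub>2 s] by (simp add: \<phi>_def x grad_inner)
    ultimately have "- \<epsilon> \<le> lam * v x - (a\<^sub>1 + 2 * a\<^sub>2 * s) * (f i x a \<bullet> e 0) - b\<^sub>1 i * (f i x a \<bullet> e i) - l i x a"
      using ge by linarith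
    with i a show "\<exists>i\<in>{1..N}. \<exists>a\<in>A i. 0 \<le> f i (pt i s 0) a \<bullet> e i \<and>
        - \<epsilon> \<le> lam * v (pt i s 0) - (a\<^sub>1 + 2 * a\<^sub>2 * s) * (f i (pt i s 0) a \<bullet> e 0)
          - b\<^sub>1 i * (f i (pt i s 0) a \<bullet> e i) - l i (pt i s 0) a"
      unfolding x by blast
  qed
  show ?thesis
  proof
    fix x assume "x \<in> junction e N"
    then obtain i where i: "i \<in> {1..N}" "x \<in> half_plane e i" by (auto simp: junction_def)
    show "u x \<le> v x"
      using J.comparison[OF i(1) half_plane_coords(2)[OF i], of "x \<bullet> e 0"] half_plane_coords(1)[OF i]
      by simp
  qed
qed

end
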